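(* Let $K$ be algebraically closed with surjective valuation $\nu\colon K^\ast\to\mathbb R$. Let $x\in\mathcal{T}\mathrm{Gr}(2,n)$ have vanishing set $J=J(x)$, let $ij\notin J$, and let $y=(x_{kl}-x_{ij})_{kl\notin J\cup\{ij\}}$ be the corresponding point of the tropicalization $\mathcal{T}\mathrm{Gr}_J(2,n)\subset\mathbb R^{\binom{[n]}2\smallsetminus(J\cup\{ij\})}$. Let $T$ be a tree with $x\in\overline{\mathscr C_T}$, let $\preceq$ be a partial order on $[n]\smallsetminus\{i,j\}$ with the cherry property on $T$ with respect to $i,j$, and let $I$ be compatible with $\preceq$ and $J(ij)$. Then $$\mathrm{in}_y\mathfrak I=\langle u_{kl}-\mathrm{in}_y(f_{kl}): kl\notin I\cup J\cup\{ij\}\rangle\subset\widetilde K[u_{kl}^{\pm}:kl\notin J\cup\{ij\}],$$ where $\mathfrak I$ is the defining ideal of $\mathrm{Gr}_J(2,n)$ in the torus $\operatorname{Spec}K[u_{kl}^{\pm}:kl\notin J\cup\{ij\}]$.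
   Context: $K$ is a field complete with respect to a non-Archimedean valuation $\nu$, $|\cdot|=\exp(-\nu(\cdot))$, with residue field $\widetilde K$. Pairs $kl\in\binom{[n]}2$ are unordered. $\mathrm{Gr}(2,n)\subset\mathbb{P}_K^{\binom n2-1}$ is embedded by Plücker coordinates $p_{kl}$ ($p_{lk}=-p_{kl}$); $^{\mathrm{an}}$ is Berkovich analytification. $\overline{\mathbb R}=\mathbb R\cup\{-\infty\}$, $\log0=-\infty$. $\mathbb{TP}^{N}=(\overline{\mathbb R}^{N+1}\smallsetminus\{(-\infty,\dots,-\infty)\})/\mathbb R\cdot(1,\dots,1)$. $\mathrm{trop}\colon\mathrm{Gr}(2,n)^{\mathrm{an}}\to\mathbb{TP}^{\binom n2-1}$ sends $\gamma$ over $\{p_{ij}\ne0\}$ to the class of $x$ with $x_{kl}-x_{ij}=\log\gamma(p_{kl}/p_{ij})$; $\mathcal{T}\mathrm{Gr}(2,n)$ is its image; $J(x)=\{kl:x_{kl}=-\infty\}$. $\mathrm{Gr}_J(2,n)$ is the reduced locally closed subscheme of $\mathrm{Gr}(2,n)$ where exactly the Plücker coordinates in $J$ vanish; via the coordinates $u_{kl}=p_{kl}/p_{ij}$ it is a closed subscheme of the torus $\operatorname{Spec}K[u_{kl}^{\pm}:kl\notin J\cup\{ij\}]$. Initial forms: fix a $K$-point $\tau=(\tau_{kl})$ of this torus with $\log|\tau_{kl}|=y_{kl}$ for all $kl$. For a nonzero Laurent polynomial $f=\sum_\alpha c_\alpha u^\alpha$, $\mathrm{in}_y(f)=\sum_\alpha\overline{\lambda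 c_\alpha\tau^\alpha}\,u^\alpha$, where $\lambda\in K^\ast$ satisfies $\nu(\lambda)=\max_\alpha\{-\nu(c_\alpha)+\langle\alpha,y\rangle\}$ and the bar is the residue class in $\widetilde K$ (so $\mathrm{in}_y(f)$ is defined up to a nonzero scalar); $\mathrm{in}_y\mathfrak I$ is the ideal generated by all $\mathrm{in}_y(f)$, $f\in\mathfrak I$. The maximum for $f_{kl}$ (defined below) equals $y_{kl}$, and in the statement $\mathrm{in}_y(f_{kl})$ is normalized by $\lambda=\tau_{kl}^{-1}$. $R(ij)=K[u_{kl}:kl\in I(ij)]$ (polynomial ring), $I(ij)=\{il,jl:l\ne i,j\}$, is the coordinate ring of $\{p_{ij}\ne0\}\subset\mathrm{Gr}(2,n)$; for $k,l\notin\{i,j\}$, $u_{kl}=u_{ik}u_{jl}-u_{il}u_{jk}\in R(ij)$. Trees: a tree $T$ on $n$ leaves is a finite connected acyclic graph without degree-two vertices whose leaves are labeled bijectively by $[n]$; inner edges are those not ending in a leaf. $\mathscr{C}_T\subset\mathbb R^{\binom n2}/\mathbb R\cdot(1,\dots,1)\subset\mathbb{TP}^{\binom n2-1}$ is the set of classes of vectors $x$ for which there is $\omega\colon E(T)\to\mathbb R$, nonnegative on inner edges, with $x_{kl}$ the sum of $\omega(e)$ over the edges $e$ of the path from $k$ to $l$; $\overline{\mathscr C_T}$ is its closure in $\mathbb{TP}^{\binom n2-1}$ (quotient topology, $[-\infty,a)$ being basic neighborhoods of $-\infty$). Given $i\ne j$, let $v_1,\dots,v_m$ be the internal vertices of the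 path from $i$ to $j$ in $T$, and let $T_a$ be the set of leaves $l\neq i,j$ whose path to the $i$–$j$ path first meets it at $v_a$. A quartet $\{a,b,c,d\}$ of $T$ is the subtree spanned by four leaves (degree-two vertices suppressed); a cherry is a pair of leaves adjacent to the same vertex. A partial order $\preceq$ on $[n]\smallsetminus\{i,j\}$ has the cherry property on $T$ with respect to $i,j$ if: leaves in different $T_a,T_b$ are incomparable; $\preceq$ is total on each $T_a$; and whenever $k\prec l\prec v$, either $\{k,l\}$ or $\{l,v\}$ is a cherry of the quartet $\{i,k,l,v\}$. Put $J(ij)=J\cap I(ij)$. A set $I\subset\binom{[n]}2$ of size $2(n-2)$ with $ij\notin I$ is compatible with $\preceq$ and $J(ij)$ if for each $a$ and each $k\in T_a$ exactly one of the following holds: (i) $ik,jk\in I$, and for all $l\prec k$ we have $il\in J(ij)$ or $jl\in J(ij)$; (ii) $ik\notin I$, $jl\in I$ for all $l\in T_a$, there is $t\prec k$ in $T_a$ with $it,jt\notin J(ij)$, and for the maximal such $t$, $kt\in I$; (iii) the same as (ii) with the roles of $i$ and $j$ exchanged. Let $H=I\cap I(ij)$. The $u_{kl}$, $kl\in I$, are algebraically independent over $K$, and inside the fraction field of $R(ij)$ there is an inclusion $\mu\colon R(ij)\hookrightarrow K[u_{kl}:kl\in I][u_{kl}^{-1}:kl\in H\smallsetminus J]$. For $rs\notin J\cup\{ij\}$, $f_{rs}\in K[u_{kl}:kl\in I\smallsetminus J][u_{kl}^{-1}:kl\in H\smallsetminus J]$ is obtained from $\mu(u_{rs})$ by setting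 $u_{kl}=0$ for all $kl\in I\cap J$. *)

theory Defs
  imports
    "HOL-Analysis.Analysis"
    "HOL-Computational_Algebra.Fraction_Field"
    "HOL-Library.Poly_Mapping"
    "HOL-Library.Uprod"
begin

section \<open>Non-Archimedean valued fields and their residue fields\<close>

text \<open>The value of \<^term>\<open>val\<close> at \<open>0\<close> is left unspecified; only \<open>absv\<close> below is meaningful there.\<close>

class valued_field = field +
  fixes val :: "'a \<Rightarrow> real"
  assumes val_mult: "a \<noteq> 0 \<Longrightarrow> b \<noteq> 0 \<Longrightarrow> val (a * b) = val a + val b"
    and val_add: "a \<noteq> 0 \<Longrightarrow> b \<noteq> 0 \<Longrightarrow> a + b \<noteq> 0 \<Longrightarrow> min (val a) (val b) \<le> val (a + b)"

definition absv :: "'a::valued_field \<Rightarrow> real" where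
  "absv a = (if a = 0 then 0 else exp (- val a))"

definition complete_valued :: "'a::valued_field itself \<Rightarrow> bool" where
  "complete_valued _ \<longleftrightarrow> Metric_space.mcomplete (UNIV :: 'a set) (\<lambda>a b. absv (a - b))"

lemma absv_nonneg: "0 \<le> absv a"
  by (simp add: absv_def)

lemma absv_0 [simp]: "absv 0 = 0"
  by (simp add: absv_def)

lemma absv_mult: "absv (a * b) = absv a * absv b"
  by (auto simp: absv_def val_mult exp_add [symmetric])

lemma val_1: "val (1 :: 'a::valued_field) = 0"
  using val_mult [of "1 :: 'a" 1] by simp

lemma absv_1 [simp]: "absv 1 = 1"
  by (simp add: absv_def val_1)

lemma val_uminus:
  fixes a :: "'a::valued_field"
  assumes "a \<noteq> 0"
  shows "val (- a) = val a"
proof -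
  have "val (- 1 :: 'a) + val (- 1 :: 'a) = 0"
    using val_mult [of "- 1 :: 'a" "- 1"] by (simp add: val_1)
  then have "val (- 1 :: 'a) = 0" by simp
  then show ?thesis using val_mult [of "- 1" a] assms by simp
qed

lemma absv_uminus [simp]: "absv (- a) = absv a"
  by (simp add: absv_def val_uminus)

lemma absv_add: "absv (a + b) \<le> max (absv a) (absv b)"
proof (cases "a = 0 \<or> b = 0 \<or> a + b = 0")
  case True
  then show ?thesis by (auto simp: absv_def le_max_iff_disj)
next
  case False
  then show ?thesis using val_add [of a b] by (auto simp: absv_def le_max_iff_disj min_le_iff_disj)
qed

lemma absv_diff: "absv (a - b) \<le> max (absv a) (absv b)"
  using absv_add [of a "- b"] by simp

lemma absv_inverse: "absv (inverse a) = inverse (absv a)"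
proof (cases "a = 0")
  case False
  then have "absv a * absv (inverse a) = 1"
    by (simp add: absv_mult [symmetric])
  then show ?thesis
    by (metis inverse_unique)
qed simp

text \<open>The residue field is the quotient of the valuation ring \<open>{a. absv a \<le> 1}\<close> by its maximal
  ideal \<open>{a. absv a < 1}\<close>.\<close>

definition residue_rel :: "'a::valued_field \<Rightarrow> 'a \<Rightarrow> bool" where
  "residue_rel a b \<longleftrightarrow> absv a \<le> 1 \<and> absv b \<le> 1 \<and> absv (a - b) < 1"

lemma part_equivp_residue_rel: "part_equivp (residue_rel :: 'a::valued_field \<Rightarrow> _)"
proof (rule part_equivpI)
  show "\<exists>x :: 'a. residue_rel x x"
    by (rule exI [of _ 0]) (simp add: residue_rel_def)
  show "symp (residue_rel :: 'a \<Rightarrow> _)"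
  proof (rule sympI)
    fix a b :: 'a
    assume "residue_rel a b"
    then show "residue_rel b a"
      using absv_uminus [of "a - b"] by (simp add: residue_rel_def)
  qed
  show "transp (residue_rel :: 'a \<Rightarrow> _)"
  proof (rule transpI)
    fix x y z :: 'a
    assume "residue_rel x y" "residue_rel y z"
    then show "residue_rel x z"
      using absv_add [of "x - y" "y - z"] by (auto simp: residue_rel_def)
  qed
qed

quotient_type (overloaded) 'a residue_field = "'a::valued_field" / partial: residue_rel
  by (rule part_equivp_residue_rel)

lemma residue_rel_mult:
  assumes "residue_rel a b" "residue_rel c d"
  shows "residue_rel (a * c) (b * d)"
proof -
  have "absv (a * (c - d)) < 1"
    using assms mult_right_mono [of "absv a" 1 "absv (c - d)"]
    by (auto simp: residue_rel_def absv_mult absv_nonneg)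
  moreover have "absv ((a - b) * d) < 1"
    using assms mult_left_mono [of "absv d" 1 "absv (a - b)"]
    by (auto simp: residue_rel_def absv_mult absv_nonneg)
  moreover have "a * c - b * d = a * (c - d) + (a - b) * d"
    by (simp add: algebra_simps)
  ultimately have "absv (a * c - b * d) < 1"
    using absv_add [of "a * (c - d)" "(a - b) * d"] by simp
  then show ?thesis
    using assms by (auto simp: residue_rel_def absv_mult absv_nonneg mult_le_one)
qed

lemma residue_rel_add:
  assumes "residue_rel a b" "residue_rel c d"
  shows "residue_rel (a + c) (b + d)"
proof -
  have *: "a + c - (b + d) = (a - b) + (c - d)" by simp
  have "absv (a + c - (b + d)) < 1"
    unfolding * using absv_add [of "a - b" "c - d"] assms by (auto simp: residue_rel_def)
  then show ?thesis
    using absv_add [of a c] absv_add [of b d] assms by (auto simp: residue_rel_def)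
qed

lemma residue_rel_uminus: "residue_rel a b \<Longrightarrow> residue_rel (- a) (- b)"
  using absv_uminus [of "a - b"] by (simp add: residue_rel_def)

lemma residue_rel_unit:
  assumes "residue_rel a b"
  shows "absv a < 1 \<longleftrightarrow> absv b < 1"
  using absv_add [of "a - b" b] absv_diff [of a "a - b"] assms by (auto simp: residue_rel_def)

lemma residue_rel_inverse:
  assumes "residue_rel a b"
  shows "residue_rel (if absv a < 1 then 0 else inverse a) (if absv b < 1 then 0 else inverse b)"
proof (cases "absv a < 1")
  case True
  then show ?thesis using residue_rel_unit [OF assms] by (simp add: residue_rel_def)
next
  case False
  then have 1: "absv a = 1" "absv b = 1"
    using residue_rel_unit [OF assms] assms by (auto simp: residue_rel_def)
  then have "a \<noteq> 0" "b \<noteq> 0" by auto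
  then have "inverse a - inverse b = - (inverse a * (a - b) * inverse b)"
    by (simp add: field_simps)
  then have "absv (inverse a - inverse b) = absv (a - b)"
    by (simp add: absv_mult absv_inverse 1)
  then show ?thesis
    using assms by (simp add: residue_rel_def 1 absv_inverse)
qed

lemma residue_rel_diff:
  assumes "residue_rel a b" "residue_rel c d"
  shows "residue_rel (a - c) (b - d)"
  using residue_rel_add [OF assms(1) residue_rel_uminus [OF assms(2)]] by simp

context
  fixes a b c :: "'a::valued_field"
  assumes a: "residue_rel a a" and b: "residue_rel b b" and c: "residue_rel c c"
begin

lemma residue_rel_mult3: "residue_rel (a * b * c) (a * (b * c))"
  using residue_rel_mult [OF residue_rel_mult [OF a b] c] by (simp add: mult.assoc)

lemma residue_rel_add3: "residue_rel (a + b + c) (a + (b + c))"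
  using residue_rel_add [OF residue_rel_add [OF a b] c] by (simp add: add.assoc)

lemma residue_rel_distrib: "residue_rel ((a + b) * c) (a * c + b * c)"
  using residue_rel_mult [OF residue_rel_add [OF a b] c] by (simp add: distrib_right)

end

context
  fixes a b :: "'a::valued_field"
  assumes a: "residue_rel a a" and b: "residue_rel b b"
begin

lemma residue_rel_mult_commute: "residue_rel (a * b) (b * a)"
  using residue_rel_mult [OF a b] by (simp add: mult.commute)

lemma residue_rel_add_commute: "residue_rel (a + b) (b + a)"
  using residue_rel_add [OF a b] by (simp add: add.commute)

lemma residue_rel_minus: "residue_rel (a - b) (a + - b)"
  using residue_rel_diff [OF a b] by simp

end

lemma residue_rel_left_inverse:
  assumes "residue_rel a a" "\<not> residue_rel a 0"
  shows "residue_rel ((if absv a < 1 then 0 else inverse a) * a) 1"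
proof -
  have "\<not> absv a < 1" "a \<noteq> 0"
    using assms by (auto simp: residue_rel_def)
  then show ?thesis by (simp add: residue_rel_def)
qed

instantiation residue_field :: (valued_field) field
begin

lift_definition zero_residue_field :: "'a residue_field" is 0
  by (simp add: residue_rel_def)

lift_definition one_residue_field :: "'a residue_field" is 1
  by (simp add: residue_rel_def)

lift_definition plus_residue_field :: "'a residue_field \<Rightarrow> 'a residue_field \<Rightarrow> 'a residue_field"
  is "(+)" by (rule residue_rel_add)

lift_definition uminus_residue_field :: "'a residue_field \<Rightarrow> 'a residue_field"
  is uminus by (rule residue_rel_uminus)

lift_definition minus_residue_field :: "'a residue_field \<Rightarrow> 'a residue_field \<Rightarrow> 'a residue_field"
  is "(-)" by (rule residue_rel_diff)

lift_definition times_residue_field :: "'a residue_field \<Rightarrow> 'a residue_field \<Rightarrow> 'a residue_field"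
  is "(*)" by (rule residue_rel_mult)

lift_definition inverse_residue_field :: "'a residue_field \<Rightarrow> 'a residue_field"
  is "\<lambda>a. if absv a < 1 then 0 else inverse a" by (rule residue_rel_inverse)

definition divide_residue_field :: "'a residue_field \<Rightarrow> 'a residue_field \<Rightarrow> 'a residue_field"
  where "divide_residue_field a b = a * inverse b"

instance
proof
  fix a b c :: "'a residue_field"
  show "a * b * c = a * (b * c)"
    by transfer (rule residue_rel_mult3)
  show "a * b = b * a"
    by transfer (rule residue_rel_mult_commute)
  show "1 * a = a" by transfer simp
  show "a + b + c = a + (b + c)"
    by transfer (rule residue_rel_add3)
  show "a + b = b + a"
    by transfer (rule residue_rel_add_commute)
  show "0 + a = a" by transfer simp
  show "- a + a = 0" by transfer (simp add: residue_rel_def)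
  show "a - b = a + - b" by transfer (rule residue_rel_minus)
  show "(a + b) * c = a * c + b * c" by transfer (rule residue_rel_distrib)
  show "(0 :: 'a residue_field) \<noteq> 1" by transfer (simp add: residue_rel_def)
  show "a \<noteq> 0 \<Longrightarrow> inverse a * a = 1" by transfer (rule residue_rel_left_inverse)
  show "a div b = a * inverse b" by (rule divide_residue_field_def)
  show "inverse (0 :: 'a residue_field) = 0" by transfer (simp add: residue_rel_def)
qed

end

text \<open>The residue class; \<open>abs_residue_field\<close> is meaningful on the valuation ring only.\<close>

definition residue_class :: "'a::valued_field \<Rightarrow> 'a residue_field" where
  "residue_class a = (if absv a \<le> 1 then abs_residue_field a else 0)"


section \<open>Variables, polynomials and Laurent polynomials\<close>

text \<open>The linear order on unordered pairs has no mathematical meaning here: the library needs some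
  order on the variables in order to see that polynomial rings are integral domains.\<close>

instantiation uprod :: (linorder) linorder
begin

definition less_eq_uprod :: "'a uprod \<Rightarrow> 'a uprod \<Rightarrow> bool" where
  "less_eq_uprod e f \<longleftrightarrow> Max (set_uprod e) < Max (set_uprod f) \<or>
     Max (set_uprod e) = Max (set_uprod f) \<and> Min (set_uprod e) \<le> Min (set_uprod f)"

definition less_uprod :: "'a uprod \<Rightarrow> 'a uprod \<Rightarrow> bool" where
  "less_uprod e f \<longleftrightarrow> e \<le> f \<and> \<not> f \<le> e"

instance
proof
  fix e f g :: "'a uprod"
  show "e < f \<longleftrightarrow> e \<le> f \<and> \<not> f \<le> e" by (rule less_uprod_def)
  show "e \<le> e" by (simp add: less_eq_uprod_def)
  show "e \<le> f \<Longrightarrow> f \<le> g \<Longrightarrow> e \<le> g" by (auto simp: less_eq_uprod_def)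
  show "e \<le> f \<or> f \<le> e" by (auto simp: less_eq_uprod_def)
  show "e \<le> f \<Longrightarrow> f \<le> e \<Longrightarrow> e = f"
    by (cases e; cases f) (auto simp: less_eq_uprod_def max_def min_def split: if_splits)
qed

end

type_synonym 'k upoly = "(nat uprod \<Rightarrow>\<^sub>0 nat) \<Rightarrow>\<^sub>0 'k"
type_synonym 'k ulaurent = "(nat uprod \<Rightarrow>\<^sub>0 int) \<Rightarrow>\<^sub>0 'k"

definition uvar :: "nat uprod \<Rightarrow> 'k::comm_ring_1 upoly" where
  "uvar e = Poly_Mapping.single (Poly_Mapping.single e 1) 1"

definition lvar :: "nat uprod \<Rightarrow> 'k::comm_ring_1 ulaurent" where
  "lvar e = Poly_Mapping.single (Poly_Mapping.single e 1) 1"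

text \<open>The ring of polynomials in the variables \<open>S\<close>, in which those in \<open>D\<close> are inverted.\<close>

definition localized_ring :: "nat uprod set \<Rightarrow> nat uprod set \<Rightarrow> 'k::comm_ring_1 ulaurent set" where
  "localized_ring S D = {f. \<forall>\<alpha>\<in>Poly_Mapping.keys f. Poly_Mapping.keys \<alpha> \<subseteq> S \<and>
     (\<forall>e. Poly_Mapping.lookup \<alpha> e < 0 \<longrightarrow> e \<in> D)}"

definition laurent_ring :: "nat uprod set \<Rightarrow> 'k::comm_ring_1 ulaurent set" where
  "laurent_ring S = localized_ring S S"

definition ideal_gen :: "'a::comm_ring_1 set \<Rightarrow> 'a set \<Rightarrow> 'a set" where
  "ideal_gen A G = {\<Sum>g\<in>F. c g * g | F c. finite F \<and> F \<subseteq> G \<and> c ` F \<subseteq> A}"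

definition radical_in :: "'a::comm_ring_1 set \<Rightarrow> 'a set \<Rightarrow> 'a set" where
  "radical_in A M = {f \<in> A. \<exists>N. f ^ N \<in> M}"


section \<open>The Grassmannian in the chart where \<open>p_ij\<close> does not vanish\<close>

definition pairs :: "nat \<Rightarrow> nat uprod set" where
  "pairs n = {Upair k l | k l. k \<in> {1..n} \<and> l \<in> {1..n} \<and> k \<noteq> l}"

definition chart_pairs :: "nat \<Rightarrow> nat \<Rightarrow> nat \<Rightarrow> nat uprod set" where
  "chart_pairs n i j = {e \<in> pairs n - {Upair i j}. i \<in> set_uprod e \<or> j \<in> set_uprod e}"

definition chart_ring :: "nat \<Rightarrow> nat \<Rightarrow> nat \<Rightarrow> 'k::comm_ring_1 upoly set" where
  "chart_ring n i j = {f. \<forall>\<alpha>\<in>Poly_Mapping.keys f. Poly_Mapping.keys \<alpha> \<subseteq> chart_pairs n i j}"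

text \<open>Since \<open>p_lk = - p_kl\<close>, a sign has to be fixed for the coordinate of an unordered pair:
  the variable of \<open>Upair k l\<close> with \<open>k < l\<close> stands for \<open>u_kl = p_kl / p_ij\<close>, for the given ordered
  pair \<open>i\<close>, \<open>j\<close>, and then \<open>u_lk\<close> is its negative.\<close>

definition pair_sign :: "nat \<Rightarrow> nat \<Rightarrow> 'k::comm_ring_1" where
  "pair_sign k l = (if k < l then 1 else - 1)"

definition oriented_var :: "nat \<Rightarrow> nat \<Rightarrow> 'k::comm_ring_1 upoly" where
  "oriented_var k l = Poly_Mapping.single 0 (pair_sign k l) * uvar (Upair k l)"

text \<open>The element of \<open>R(ij)\<close> representing \<open>p_kl / p_ij\<close>, where \<open>e = Upair k l\<close> and \<open>k < l\<close>.\<close>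

definition chart_coord :: "nat \<Rightarrow> nat \<Rightarrow> nat uprod \<Rightarrow> 'k::comm_ring_1 upoly" where
  "chart_coord i j e =
     (if e = Upair i j then Poly_Mapping.single 0 (pair_sign i j)
      else if i \<in> set_uprod e \<or> j \<in> set_uprod e then uvar e
      else let k = Min (set_uprod e); l = Max (set_uprod e) in
        oriented_var i k * oriented_var j l - oriented_var i l * oriented_var j k)"

text \<open>Evaluation of a Laurent polynomial at \<open>u_kl = p_kl / p_ij\<close> in the fraction field of
  \<open>R(ij)\<close>.  (The type below is the fraction field of the polynomial ring in all conceivable
  variables, which contains that of \<open>R(ij)\<close>.)\<close>

definition frac_eval :: "nat \<Rightarrow> nat \<Rightarrow> 'k::field ulaurent \<Rightarrow> 'k upoly fract" where
  "frac_eval i j f = (\<Sum>\<alpha>\<in>Poly_Mapping.keys f.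
     Fract (Poly_Mapping.single 0 (Poly_Mapping.lookup f \<alpha>)) 1 *
     (\<Prod>e\<in>Poly_Mapping.keys \<alpha>. Fract (chart_coord i j e) 1 powi Poly_Mapping.lookup \<alpha> e))"

definition torus_pairs :: "nat \<Rightarrow> nat \<Rightarrow> nat \<Rightarrow> nat uprod set \<Rightarrow> nat uprod set" where
  "torus_pairs n i j J = pairs n - (J \<union> {Upair i j})"

text \<open>The localization of \<open>R(ij)\<close> at the \<open>u_kl\<close> with \<open>kl \<notin> J\<close>, inside the fraction field.\<close>

definition localized_chart :: "nat \<Rightarrow> nat \<Rightarrow> nat \<Rightarrow> nat uprod set \<Rightarrow> 'k::field upoly fract set" where
  "localized_chart n i j J =
     {Fract a (\<Prod>e\<in>pairs n - J. chart_coord i j e ^ m e) | a m. a \<in> chart_ring n i j}"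

text \<open>The reduced subscheme of the chart on which exactly the \<open>p_kl\<close> with \<open>kl \<in> J\<close> vanish is the
  spectrum of the localization above modulo the radical of the ideal generated by the \<open>u_kl\<close> with
  \<open>kl \<in> J\<close>; its defining ideal in the torus is the kernel of the map from the Laurent
  polynomial ring to the quotient.\<close>

definition grass_ideal :: "nat \<Rightarrow> nat \<Rightarrow> nat \<Rightarrow> nat uprod set \<Rightarrow> 'k::field ulaurent set" where
  "grass_ideal n i j J = {f \<in> laurent_ring (torus_pairs n i j J).
     frac_eval i j f \<in> radical_in (localized_chart n i j J)
       (ideal_gen (localized_chart n i j J) ((\<lambda>e. Fract (chart_coord i j e) 1) ` J))}"


section \<open>Tropical projective space and the tropical Grassmannian\<close>

definition tp_vecs :: "nat \<Rightarrow> (nat uprod \<Rightarrow> ereal) set" where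
  "tp_vecs n = {x \<in> pairs n \<rightarrow>\<^sub>E {..<\<infinity>}. \<exists>e\<in>pairs n. x e \<noteq> - \<infinity>}"

definition tp_rel :: "nat \<Rightarrow> ((nat uprod \<Rightarrow> ereal) \<times> (nat uprod \<Rightarrow> ereal)) set" where
  "tp_rel n = {(x, z). x \<in> tp_vecs n \<and> z \<in> tp_vecs n \<and>
     (\<exists>c::real. \<forall>e\<in>pairs n. z e = x e + ereal c)}"

definition tp_class :: "nat \<Rightarrow> (nat uprod \<Rightarrow> ereal) \<Rightarrow> (nat uprod \<Rightarrow> ereal) set" where
  "tp_class n x = tp_rel n `` {x}"

definition tp_space :: "nat \<Rightarrow> (nat uprod \<Rightarrow> ereal) set set" where
  "tp_space n = tp_vecs n // tp_rel n"

definition tp_vecs_topology :: "nat \<Rightarrow> (nat uprod \<Rightarrow> ereal) topology" where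
  "tp_vecs_topology n =
     subtopology (product_topology (\<lambda>_. subtopology euclidean {..<\<infinity>}) (pairs n)) (tp_vecs n)"

text \<open>The quotient topology.\<close>

definition tp_topology :: "nat \<Rightarrow> (nat uprod \<Rightarrow> ereal) set topology" where
  "tp_topology n = topology (\<lambda>U. U \<subseteq> tp_space n \<and>
     openin (tp_vecs_topology n) {x \<in> tp_vecs n. tp_class n x \<in> U})"

lemma openin_tp_topology:
  "openin (tp_topology n) U \<longleftrightarrow>
     U \<subseteq> tp_space n \<and> openin (tp_vecs_topology n) {x \<in> tp_vecs n. tp_class n x \<in> U}"
proof -
  have "istopology (\<lambda>U. U \<subseteq> tp_space n \<and>
     openin (tp_vecs_topology n) {x \<in> tp_vecs n. tp_class n x \<in> U})"
    unfolding istopology_def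
  proof (rule conjI; intro allI impI conjI)
    fix S T
    assume S: "S \<subseteq> tp_space n \<and> openin (tp_vecs_topology n) {x \<in> tp_vecs n. tp_class n x \<in> S}"
      and T: "T \<subseteq> tp_space n \<and> openin (tp_vecs_topology n) {x \<in> tp_vecs n. tp_class n x \<in> T}"
    show "S \<inter> T \<subseteq> tp_space n" using S by blast
    have "{x \<in> tp_vecs n. tp_class n x \<in> S \<inter> T} =
      {x \<in> tp_vecs n. tp_class n x \<in> S} \<inter> {x \<in> tp_vecs n. tp_class n x \<in> T}" by blast
    then show "openin (tp_vecs_topology n) {x \<in> tp_vecs n. tp_class n x \<in> S \<inter> T}"
      using S T by (simp add: openin_Int)
  next
    fix \<K>
    assume K: "\<forall>U\<in>\<K>. U \<subseteq> tp_space n \<and>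
      openin (tp_vecs_topology n) {x \<in> tp_vecs n. tp_class n x \<in> U}"
    show "\<Union>\<K> \<subseteq> tp_space n" using K by blast
    have "{x \<in> tp_vecs n. tp_class n x \<in> \<Union>\<K>} =
      (\<Union>U\<in>\<K>. {x \<in> tp_vecs n. tp_class n x \<in> U})" by blast
    then show "openin (tp_vecs_topology n) {x \<in> tp_vecs n. tp_class n x \<in> \<Union>\<K>}"
      using K by auto
  qed
  then show ?thesis by (simp only: tp_topology_def topology_inverse')
qed

definition vanishing_set :: "nat \<Rightarrow> (nat uprod \<Rightarrow> ereal) \<Rightarrow> nat uprod set" where
  "vanishing_set n x = {e \<in> pairs n. x e = - \<infinity>}"

text \<open>The points of the Berkovich analytification of the affine chart \<open>Spec R(ij)\<close>: the
  multiplicative (non-Archimedean) seminorms extending the absolute value of the base field.  The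
  values of \<open>\<gamma>\<close> outside \<open>R(ij)\<close> are irrelevant.\<close>

definition berkovich_chart :: "nat \<Rightarrow> nat \<Rightarrow> nat \<Rightarrow> ('k::valued_field upoly \<Rightarrow> real) set" where
  "berkovich_chart n i j = {\<gamma>.
     (\<forall>f\<in>chart_ring n i j. 0 \<le> \<gamma> f) \<and>
     (\<forall>f\<in>chart_ring n i j. \<forall>g\<in>chart_ring n i j. \<gamma> (f * g) = \<gamma> f * \<gamma> g) \<and>
     (\<forall>f\<in>chart_ring n i j. \<forall>g\<in>chart_ring n i j. \<gamma> (f + g) \<le> max (\<gamma> f) (\<gamma> g)) \<and>
     (\<forall>c. \<gamma> (Poly_Mapping.single 0 c) = absv c)}"

definition elog :: "real \<Rightarrow> ereal" where
  "elog r = (if r = 0 then - \<infinity> else ereal (ln r))"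

text \<open>The representative below is the one whose coordinate at \<open>Upair i j\<close> is \<open>0\<close>.\<close>

definition trop_chart :: "nat \<Rightarrow> nat \<Rightarrow> nat \<Rightarrow> ('k::valued_field upoly \<Rightarrow> real) \<Rightarrow>
    (nat uprod \<Rightarrow> ereal) set" where
  "trop_chart n i j \<gamma> = tp_class n (\<lambda>e\<in>pairs n. elog (\<gamma> (chart_coord i j e)))"

text \<open>The analytification of \<open>Gr(2,n)\<close> is covered by those of the charts, so the image of \<open>trop\<close>
  is the union of the images of the charts.\<close>

definition trop_grass :: "'k::valued_field itself \<Rightarrow> nat \<Rightarrow> (nat uprod \<Rightarrow> ereal) set set" where
  "trop_grass _ n = (\<Union>i\<in>{1..n}. \<Union>j\<in>{1..n} - {i}.
     trop_chart n i j ` (berkovich_chart n i j :: ('k upoly \<Rightarrow> real) set))"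


section \<open>Initial forms\<close>

text \<open>\<open>c\<close> is the scalar normalizing the maximal absolute value of the terms to \<open>1\<close>.\<close>

definition init_form :: "(nat uprod \<Rightarrow> 'k::valued_field) \<Rightarrow> 'k \<Rightarrow> 'k ulaurent \<Rightarrow>
    'k residue_field ulaurent" where
  "init_form \<tau> c f = (\<Sum>\<alpha>\<in>Poly_Mapping.keys f. Poly_Mapping.single \<alpha>
     (residue_class (c * Poly_Mapping.lookup f \<alpha> *
        (\<Prod>e\<in>Poly_Mapping.keys \<alpha>. \<tau> e powi Poly_Mapping.lookup \<alpha> e))))"

definition trop_max :: "(nat uprod \<Rightarrow> real) \<Rightarrow> 'k::valued_field ulaurent \<Rightarrow> real" where
  "trop_max y f = Max ((\<lambda>\<alpha>. - val (Poly_Mapping.lookup f \<alpha>) +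
     (\<Sum>e\<in>Poly_Mapping.keys \<alpha>. of_int (Poly_Mapping.lookup \<alpha> e) * y e)) ` Poly_Mapping.keys f)"

definition init_ideal :: "nat uprod set \<Rightarrow> (nat uprod \<Rightarrow> real) \<Rightarrow> (nat uprod \<Rightarrow> 'k::valued_field) \<Rightarrow>
    'k ulaurent set \<Rightarrow> 'k residue_field ulaurent set" where
  "init_ideal S y \<tau> M = ideal_gen (laurent_ring S)
     {init_form \<tau> c f | c f. f \<in> M \<and> f \<noteq> 0 \<and> c \<noteq> 0 \<and> val c = trop_max y f}"


section \<open>Trees\<close>

record 'v sgraph =
  verts :: "'v set"
  edges :: "'v set set"

definition gpath :: "('v, 'z) sgraph_scheme \<Rightarrow> 'v \<Rightarrow> 'v list \<Rightarrow> 'v \<Rightarrow> bool" where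
  "gpath G u p w \<longleftrightarrow> p \<noteq> [] \<and> hd p = u \<and> last p = w \<and> distinct p \<and> set p \<subseteq> verts G \<and>
     successively (\<lambda>a b. {a, b} \<in> edges G) p"

definition gcycle :: "('v, 'z) sgraph_scheme \<Rightarrow> 'v list \<Rightarrow> bool" where
  "gcycle G p \<longleftrightarrow> 3 \<le> length p \<and> gpath G (hd p) p (last p) \<and> {last p, hd p} \<in> edges G"

definition is_tree :: "('v, 'z) sgraph_scheme \<Rightarrow> bool" where
  "is_tree G \<longleftrightarrow> finite (verts G) \<and> verts G \<noteq> {} \<and>
     edges G \<subseteq> {{u, w} | u w. u \<in> verts G \<and> w \<in> verts G \<and> u \<noteq> w} \<and>
     (\<forall>u\<in>verts G. \<forall>w\<in>verts G. \<exists>p. gpath G u p w) \<and> (\<nexists>p. gcycle G p)"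

definition vdegree :: "('v, 'z) sgraph_scheme \<Rightarrow> 'v \<Rightarrow> nat" where
  "vdegree G v = card {e \<in> edges G. v \<in> e}"

definition leaves :: "('v, 'z) sgraph_scheme \<Rightarrow> 'v set" where
  "leaves G = {v \<in> verts G. vdegree G v = 1}"

definition inner_edges :: "('v, 'z) sgraph_scheme \<Rightarrow> 'v set set" where
  "inner_edges G = {e \<in> edges G. e \<inter> leaves G = {}}"

definition tree_path :: "('v, 'z) sgraph_scheme \<Rightarrow> 'v \<Rightarrow> 'v \<Rightarrow> 'v list" where
  "tree_path G u w = (THE p. gpath G u p w)"

definition path_edges :: "'v list \<Rightarrow> 'v set set" where
  "path_edges p = {{a, b} | a b. (a, b) \<in> set (zip p (tl p))}"

record 'v ltree = "'v sgraph" +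
  label :: "nat \<Rightarrow> 'v"

definition labeled_tree :: "nat \<Rightarrow> 'v ltree \<Rightarrow> bool" where
  "labeled_tree n T \<longleftrightarrow> is_tree T \<and> (\<forall>v\<in>verts T. vdegree T v \<noteq> 2) \<and>
     bij_betw (label T) {1..n} (leaves T)"

abbreviation leaf_path :: "'v ltree \<Rightarrow> nat \<Rightarrow> nat \<Rightarrow> 'v list" where
  "leaf_path T k l \<equiv> tree_path T (label T k) (label T l)"

definition tree_cone :: "nat \<Rightarrow> 'v ltree \<Rightarrow> (nat uprod \<Rightarrow> ereal) set set" where
  "tree_cone n T = {tp_class n x | x. x \<in> tp_vecs n \<and>
     (\<exists>\<omega> :: 'v set \<Rightarrow> real. (\<forall>e\<in>inner_edges T. 0 \<le> \<omega> e) \<and>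
       (\<forall>k\<in>{1..n}. \<forall>l\<in>{1..n}. k \<noteq> l \<longrightarrow>
          x (Upair k l) = ereal (\<Sum>e\<in>path_edges (leaf_path T k l). \<omega> e)))}"

definition spanned_subtree :: "('v, 'z) sgraph_scheme \<Rightarrow> 'v set \<Rightarrow> 'v sgraph" where
  "spanned_subtree G A = \<lparr>
     verts = (\<Union>u\<in>A. \<Union>w\<in>A. set (tree_path G u w)),
     edges = (\<Union>u\<in>A. \<Union>w\<in>A. path_edges (tree_path G u w))\<rparr>"

text \<open>Maximal chains through degree-two vertices are replaced by single edges.\<close>

definition suppress :: "('v, 'z) sgraph_scheme \<Rightarrow> 'v sgraph" where
  "suppress G = \<lparr>
     verts = {v \<in> verts G. vdegree G v \<noteq> 2},
     edges = {{u, w} | u w p. gpath G u p w \<and> u \<noteq> w \<and> vdegree G u \<noteq> 2 \<and> vdegree G w \<noteq> 2 \<and>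
       (\<forall>v\<in>set p - {u, w}. vdegree G v = 2)}\<rparr>"

definition quartet :: "'v ltree \<Rightarrow> nat \<Rightarrow> nat \<Rightarrow> nat \<Rightarrow> nat \<Rightarrow> 'v sgraph" where
  "quartet T a b c d = suppress (spanned_subtree T (label T ` {a, b, c, d}))"

definition cherry :: "('v, 'z) sgraph_scheme \<Rightarrow> 'v \<Rightarrow> 'v \<Rightarrow> bool" where
  "cherry G a b \<longleftrightarrow> a \<noteq> b \<and> a \<in> leaves G \<and> b \<in> leaves G \<and>
     (\<exists>w\<in>verts G. {a, w} \<in> edges G \<and> {b, w} \<in> edges G)"

definition path_internal :: "'v ltree \<Rightarrow> nat \<Rightarrow> nat \<Rightarrow> 'v set" where
  "path_internal T i j = set (leaf_path T i j) - {label T i, label T j}"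

text \<open>The set \<open>T_a\<close> for the internal vertex \<open>v = v_a\<close> of the path from \<open>i\<close> to \<open>j\<close>.\<close>

definition branch :: "nat \<Rightarrow> 'v ltree \<Rightarrow> nat \<Rightarrow> nat \<Rightarrow> 'v \<Rightarrow> nat set" where
  "branch n T i j v = {l \<in> {1..n} - {i, j}.
     set (tree_path T (label T l) v) \<inter> set (leaf_path T i j) = {v}}"


section \<open>The cherry property and compatible index sets\<close>

abbreviation strictly_below :: "(nat \<times> nat) set \<Rightarrow> nat \<Rightarrow> nat \<Rightarrow> bool" where
  "strictly_below r k l \<equiv> (k, l) \<in> r \<and> k \<noteq> l"

definition cherry_property :: "nat \<Rightarrow> 'v ltree \<Rightarrow> nat \<Rightarrow> nat \<Rightarrow> (nat \<times> nat) set \<Rightarrow> bool" where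
  "cherry_property n T i j r \<longleftrightarrow>
     (\<forall>v\<in>path_internal T i j. \<forall>w\<in>path_internal T i j. v \<noteq> w \<longrightarrow>
        (\<forall>k\<in>branch n T i j v. \<forall>l\<in>branch n T i j w. (k, l) \<notin> r \<and> (l, k) \<notin> r)) \<and>
     (\<forall>v\<in>path_internal T i j. total_on (branch n T i j v) r) \<and>
     (\<forall>k l m. strictly_below r k l \<and> strictly_below r l m \<longrightarrow>
        cherry (quartet T i k l m) (label T k) (label T l) \<or>
        cherry (quartet T i k l m) (label T l) (label T m))"

text \<open>Conditions (i) and (ii) for a leaf \<open>k\<close> in the set \<open>B = T_a\<close>; (iii) is (ii) with \<open>i\<close> and \<open>j\<close>
  exchanged.  \<open>Jc\<close> is \<open>J(ij)\<close>.\<close>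

definition compat_both :: "(nat \<times> nat) set \<Rightarrow> nat uprod set \<Rightarrow> nat uprod set \<Rightarrow> nat \<Rightarrow> nat \<Rightarrow>
    nat \<Rightarrow> bool" where
  "compat_both r Jc I i j k \<longleftrightarrow> Upair i k \<in> I \<and> Upair j k \<in> I \<and>
     (\<forall>l. strictly_below r l k \<longrightarrow> Upair i l \<in> Jc \<or> Upair j l \<in> Jc)"

definition compat_one :: "(nat \<times> nat) set \<Rightarrow> nat uprod set \<Rightarrow> nat uprod set \<Rightarrow> nat set \<Rightarrow> nat \<Rightarrow> nat \<Rightarrow>
    nat \<Rightarrow> bool" where
  "compat_one r Jc I B i j k \<longleftrightarrow> Upair i k \<notin> I \<and> (\<forall>l\<in>B. Upair j l \<in> I) \<and>
     (\<exists>t\<in>B. strictly_below r t k \<and> Upair i t \<notin> Jc \<and> Upair j t \<notin> Jc \<and>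
        (\<forall>s\<in>B. strictly_below r s k \<and> Upair i s \<notin> Jc \<and> Upair j s \<notin> Jc \<longrightarrow> (s, t) \<in> r) \<and>
        Upair k t \<in> I)"

definition compatible :: "nat \<Rightarrow> 'v ltree \<Rightarrow> nat \<Rightarrow> nat \<Rightarrow> (nat \<times> nat) set \<Rightarrow> nat uprod set \<Rightarrow>
    nat uprod set \<Rightarrow> bool" where
  "compatible n T i j r Jc I \<longleftrightarrow>
     I \<subseteq> pairs n \<and> card I = 2 * (n - 2) \<and> Upair i j \<notin> I \<and>
     (\<forall>v\<in>path_internal T i j. \<forall>k\<in>branch n T i j v.
        let c1 = compat_both r Jc I i j k;
            c2 = compat_one r Jc I (branch n T i j v) i j k;
            c3 = compat_one r Jc I (branch n T i j v) j i k
        in c1 \<and> \<not> c2 \<and> \<not> c3 \<or> \<not> c1 \<and> c2 \<and> \<not> c3 \<or> \<not> c1 \<and> \<not> c2 \<and> c3)"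

text \<open>The inclusion \<open>\<mu>\<close> of \<open>R(ij)\<close> into the localized polynomial ring in the \<open>u_kl\<close>, \<open>kl \<in> I\<close>: the
  latter embeds into the fraction field of \<open>R(ij)\<close>, the \<open>u_kl\<close> with \<open>kl \<in> I\<close> being algebraically
  independent, and \<open>g\<close> is the unique element with the same image as \<open>a\<close>.\<close>

definition mu :: "nat \<Rightarrow> nat \<Rightarrow> nat \<Rightarrow> nat uprod set \<Rightarrow> nat uprod set \<Rightarrow> 'k::field upoly \<Rightarrow>
    'k ulaurent" where
  "mu n i j J I a = (THE g. g \<in> localized_ring I (I \<inter> chart_pairs n i j - J) \<and>
     frac_eval i j g = Fract a 1)"

text \<open>Setting the variables in \<open>Z\<close> to \<open>0\<close>, for \<open>f\<close> in which they have no negative exponents.\<close>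

definition set_zero :: "nat uprod set \<Rightarrow> 'k::comm_ring_1 ulaurent \<Rightarrow> 'k ulaurent" where
  "set_zero Z f = (\<Sum>\<alpha>\<in>{\<alpha> \<in> Poly_Mapping.keys f. Poly_Mapping.keys \<alpha> \<inter> Z = {}}.
     Poly_Mapping.single \<alpha> (Poly_Mapping.lookup f \<alpha>))"

definition f_coord :: "nat \<Rightarrow> nat \<Rightarrow> nat \<Rightarrow> nat uprod set \<Rightarrow> nat uprod set \<Rightarrow> nat uprod \<Rightarrow>
    'k::field ulaurent" where
  "f_coord n i j J I e = set_zero (I \<inter> J) (mu n i j J I (chart_coord i j e))"

end

(*
  Rescaling the coordinates by tau makes all weights zero, and the relations u_kl - f_kl then have
  coefficients in the valuation ring as soon as the Gauss norm of f_kl is at most |tau_kl|.  Division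
  by these relations can be carried out over the valuation ring, so an element of the ideal of norm at
  most 1 is congruent, modulo an integral combination of them, to an element of the ideal involving only
  the variables in I; that element is zero because the u_kl, kl in I - J, are algebraically independent on
  the stratum.  Reducing the combination gives the initial ideal.

  The Gauss norm of f_kl is bounded by induction along the order: for l < t < k with t the predecessor
  of k in its branch, the Pluecker relation expresses u_kl u_jt by u_kt u_jl and u_jk u_tl, and the cherry
  property says precisely that x_kl + x_jt dominates the two corresponding sums.  Such inequalities hold on
  a tree cone because no edge induces the forbidden split, and they pass to the closure.
*)
theory Submission
  imports Defs
begin

section \<open>Edges of a tree and the splits they induce\<close>

text \<open>Three obstacles shape the proof. \<open>mu\<close> is a definite description, so an
  explicit candidate is needed: \<open>phi\<close> solves a Pluecker relation for each chart
  coordinate outside \<open>I\<close>, all other coordinates are minors in \<open>phi\<close>, and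
  uniqueness comes from a substitution that inverts evaluation on the variables in \<open>I\<close>.
  The ideal of the stratum is a radical inside a localization; it is squeezed between the relations,
  whose values lie in the ideal generated by the coordinates in \<open>J\<close>, and the kernel of
  the substitution u_kl -> f_kl, which meets the Laurent ring in the variables of
  \<open>I - J\<close> only in 0. For that kernel to contain the ideal, the restricted minors must
  vanish exactly for the pairs in \<open>J\<close>. Vanishing is the Gauss norm bound with bound 0,
  which is why the inequalities are exponentiated: -\<infinity> becomes 0. Nonvanishing needs a
  point of the stratum over K; \<open>x\<close> only provides a seminorm, so its vanishing pattern,
  a matroid of rank two, is realized anew over the infinite field K.\<close>

lemma path_edges_simps [simp]:
  "path_edges [] = {}" "path_edges [u] = {}"
  "path_edges (u # w # p) = insert {u, w} (path_edges (w # p))"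
  by (auto simp: path_edges_def)

lemma path_edges_append: "path_edges (p @ v # q) = path_edges (p @ [v]) \<union> path_edges (v # q)"
proof (induction p)
  case (Cons u p)
  then show ?case by (cases p) auto
qed simp

lemma path_edges_subset: "e \<in> path_edges p \<Longrightarrow> e \<subseteq> set p"
  by (induction p rule: induct_list012) auto

lemma path_edges_edges:
  "successively (\<lambda>a b. {a, b} \<in> E) p \<Longrightarrow> path_edges p \<subseteq> E"
  by (induction p rule: induct_list012) auto

lemma gpath_path_edges: "gpath G u p w \<Longrightarrow> path_edges p \<subseteq> edges G"
  unfolding gpath_def by (intro path_edges_edges) auto

lemma gpath_split:
  assumes "gpath G u (p @ v # q) w"
  shows "gpath G u (p @ [v]) v" "gpath G v (v # q) w"
  using assms by (auto simp: gpath_def successively_append_iff hd_append split: if_splits)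

lemma gpath_rev: "gpath G u p w \<Longrightarrow> gpath G w (rev p) u"
  by (auto simp: gpath_def hd_rev last_rev successively_rev insert_commute)

lemma gpath_single: "u \<in> verts G \<Longrightarrow> gpath G u [u] u"
  by (simp add: gpath_def)

lemma gpath_snoc:
  assumes "gpath G u p w" "{w, z} \<in> edges G" "z \<in> verts G" "z \<notin> set p"
  shows "gpath G u (p @ [z]) z"
  using assms by (auto simp: gpath_def successively_append_iff)

lemma gpath_ends: "gpath G u p w \<Longrightarrow> u \<in> set p \<and> w \<in> set p \<and> set p \<subseteq> verts G"
  by (auto simp: gpath_def)

lemma gpath_mono:
  assumes "gpath G u p w" "verts G \<subseteq> verts H" "edges G \<subseteq> edges H"
  shows "gpath H u p w"
  using assms unfolding gpath_def by (auto elim: successively_mono)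

text \<open>A walk that returns to a vertex of the path built so far is cut back to that vertex;
  otherwise the path is extended.\<close>

lemma rtrancl_gpath:
  assumes "(u, w) \<in> {(a, b). {a, b} \<in> edges G}\<^sup>*" "u \<in> verts G"
    and E: "\<And>a b. {a, b} \<in> edges G \<Longrightarrow> b \<in> verts G"
  shows "\<exists>p. gpath G u p w"
  using assms(1)
proof (induction rule: rtrancl_induct)
  case base
  then show ?case using gpath_single [OF assms(2)] by (rule exI)
next
  case (step w z)
  then obtain p where p: "gpath G u p w" by blast
  show ?case
  proof (cases "z \<in> set p")
    case True
    then show ?thesis using p gpath_split(1) by (metis split_list)
  next
    case False
    then show ?thesis using p gpath_snoc [of G u p w z] step E by blast
  qed
qed

lemma tree_edgeE:
  assumes "is_tree G" "e \<in> edges G"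
  obtains a b where "e = {a, b}" "a \<noteq> b" "a \<in> verts G" "b \<in> verts G"
  using assms unfolding is_tree_def by blast

lemma is_tree_edge: "is_tree G \<Longrightarrow> {a, b} \<in> edges G \<Longrightarrow> a \<noteq> b \<and> a \<in> verts G \<and> b \<in> verts G"
  unfolding is_tree_def by (auto simp: doubleton_eq_iff subset_iff)

text \<open>Removing \<open>e\<close> disconnects a tree, because a path joining its ends without
  \<open>e\<close> would close up to a cycle. Reachability from one end without \<open>e\<close>
  therefore gives two colours that differ across \<open>e\<close> and agree across every other edge,
  and a path with distinct vertices uses \<open>e\<close> at most once.\<close>

lemma is_tree_side:
  fixes G :: "('v, 'z) sgraph_scheme"
  assumes G: "is_tree G" and e: "e \<in> edges G"
  shows "\<exists>s :: 'v \<Rightarrow> bool. \<forall>u p w. gpath G u p w \<longrightarrow> (e \<in> path_edges p \<longleftrightarrow> s u \<noteq> s w)"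
proof -
  obtain a b where ab: "e = {a, b}" "a \<noteq> b" "a \<in> verts G" "b \<in> verts G"
    using tree_edgeE [OF G e] .
  let ?R = "{(u, w). {u, w} \<in> edges G - {e}}"
  define s where "s u \<longleftrightarrow> (a, u) \<in> ?R\<^sup>*" for u
  have sa: "s a" by (simp add: s_def)
  have sb: "\<not> s b"
  proof
    assume "s b"
    define H :: "'v sgraph" where "H = \<lparr>verts = verts G, edges = edges G - {e}\<rparr>"
    have "\<exists>p. gpath H a p b"
    proof (rule rtrancl_gpath)
      show "(a, b) \<in> {(a, b). {a, b} \<in> edges H}\<^sup>*"
        using \<open>s b\<close> by (simp add: s_def H_def)
      show "a \<in> verts H" using ab by (simp add: H_def)
      show "v \<in> verts H" if "{u, v} \<in> edges H" for u v
        using that is_tree_edge [OF G, of u v] by (simp add: H_def)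
    qed
    then obtain p where p: "gpath H a p b" by blast
    have pG: "gpath G a p b"
      by (rule gpath_mono [OF p]) (auto simp: H_def)
    have 1: "p \<noteq> []" "hd p = a" "last p = b" using p by (auto simp: gpath_def)
    \<comment> \<open>A cycle needs three vertices; the only shorter path from \<open>a\<close> to
      \<open>b\<close> consists of the deleted edge.\<close>
    have "3 \<le> length p"
    proof (rule ccontr)
      assume "\<not> 3 \<le> length p"
      then have "p = [a, b]" using 1 ab(2)
        by (cases p; cases "tl p"; cases "tl (tl p)") auto
      then have "{a, b} \<in> edges G - {e}" using p by (simp add: gpath_def H_def)
      then show False using ab by blast
    qed
    then have "gcycle G p"
      using pG 1 e ab unfolding gcycle_def by (simp add: insert_commute)
    then show False using G unfolding is_tree_def by blast
  qed
  have step: "s u \<longleftrightarrow> s w" if "{u, w} \<in> edges G" "{u, w} \<noteq> e" for u w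
  proof -
    have "(u, w) \<in> ?R" "(w, u) \<in> ?R" using that by (auto simp: insert_commute)
    then show ?thesis unfolding s_def by (meson rtrancl.rtrancl_into_rtrancl)
  qed
  have cross: "s u \<noteq> s w" if "{u, w} = e" for u w
    using that ab sa sb by (auto simp: doubleton_eq_iff)
  have *: "e \<in> path_edges p \<longleftrightarrow> s (hd p) \<noteq> s (last p)"
    if "p \<noteq> []" "distinct p" "successively (\<lambda>a b. {a, b} \<in> edges G) p" for p
    using that
  proof (induction p rule: induct_list012)
    case (3 u w p)
    show ?case
    proof (cases "{u, w} = e")
      case True
      have "e \<notin> path_edges (w # p)"
        using path_edges_subset [of e "w # p"] "3.prems" True by auto
      then show ?thesis using 3 True cross by auto
    next
      case False
      then show ?thesis using 3 step [of u w] by auto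
    qed
  qed auto
  have "e \<in> path_edges p \<longleftrightarrow> s u \<noteq> s w" if "gpath G u p w" for u p w
    using * [of p] that unfolding gpath_def by simp
  then show ?thesis by (intro exI [of _ s]) simp
qed

text \<open>Only the comparison of two vertices is meaningful: exchanging the two values gives
  another admissible choice.\<close>

definition side :: "('v, 'z) sgraph_scheme \<Rightarrow> 'v set \<Rightarrow> 'v \<Rightarrow> bool" where
  "side G e = (SOME s. \<forall>u p w. gpath G u p w \<longrightarrow> (e \<in> path_edges p \<longleftrightarrow> s u \<noteq> s w))"

lemma side_iff:
  assumes "is_tree G" "e \<in> edges G" "gpath G u p w"
  shows "e \<in> path_edges p \<longleftrightarrow> side G e u \<noteq> side G e w"
  using someI_ex [OF is_tree_side [OF assms(1,2)]] assms(3) unfolding side_def by blast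

text \<open>The first edge of one path separates \<open>u\<close> from \<open>w\<close>, hence lies
  on the other path too. As \<open>u\<close> occurs there only at the head, it is the first edge
  there as well, and induction applies to the tails.\<close>

lemma gpath_unique:
  assumes G: "is_tree G" and "gpath G u p w" "gpath G u q w"
  shows "p = q"
  using assms(2,3)
proof (induction p arbitrary: u q rule: induct_list012)
  case 1
  then show ?case by (simp add: gpath_def)
next
  case (2 v)
  then have "hd q = last q" "q \<noteq> []" "distinct q" "v = hd q" by (auto simp: gpath_def)
  then show ?case by (cases q) (auto split: if_splits)
next
  case (3 v a p)
  have v: "v = u" using "3.prems" by (simp add: gpath_def)
  have "w \<in> set (a # p)" "u \<notin> set (a # p)"
    using "3.prems"(1) last_in_set [of "a # p"] unfolding gpath_def by (auto simp del: last.simps simp: last_ConsR)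
  then have uw: "u \<noteq> w" by blast
  obtain b q' where q: "q = u # b # q'"
    using "3.prems" uw by (cases q; cases "tl q") (auto simp: gpath_def)
  have e: "{u, a} \<in> edges G" using "3.prems" v by (simp add: gpath_def)
  have "{u, a} \<in> path_edges (v # a # p)" using v by simp
  then have "{u, a} \<in> path_edges q"
    using side_iff [OF G e] "3.prems" by blast
  moreover have "{u, a} \<notin> path_edges (b # q')"
    using path_edges_subset [of "{u, a}" "b # q'"] "3.prems" q by (auto simp: gpath_def)
  ultimately have ba: "b = a" using q by (auto simp: doubleton_eq_iff)
  have "gpath G a (a # p) w" "gpath G a (b # q') w"
    using "3.prems" q ba by (auto simp: gpath_def)
  then show ?case using "3.IH"(2) q v ba by blast
qed

lemma tree_path_eq: "is_tree G \<Longrightarrow> gpath G u p w \<Longrightarrow> tree_path G u w = p"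
  unfolding tree_path_def by (rule the_equality) (auto dest: gpath_unique)

lemma gpath_tree_path:
  assumes "is_tree G" "u \<in> verts G" "w \<in> verts G"
  shows "gpath G u (tree_path G u w) w"
proof -
  obtain p where "gpath G u p w" using assms unfolding is_tree_def by blast
  then show ?thesis using tree_path_eq [OF assms(1)] by simp
qed

text \<open>In quartet notation, \<open>e\<close> induces the split ab|cd.\<close>

definition splits :: "('v, 'z) sgraph_scheme \<Rightarrow> 'v set \<Rightarrow> 'v \<Rightarrow> 'v \<Rightarrow> 'v \<Rightarrow> 'v \<Rightarrow> bool" where
  "splits G e a b c d \<longleftrightarrow> e \<in> edges G \<and> side G e a = side G e b \<and> side G e c = side G e d \<and>
     side G e a \<noteq> side G e c"

text \<open>Every path leaving the leaf \<open>a\<close> starts with its only edge.\<close>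

lemma leaf_edge_side:
  assumes G: "is_tree G" and e: "e \<in> edges G" and a: "a \<in> e" "a \<in> leaves G"
    and u: "u \<in> verts G" "u \<noteq> a"
  shows "side G e u \<noteq> side G e a"
proof -
  have aV: "a \<in> verts G" using a by (simp add: leaves_def)
  have p: "gpath G a (tree_path G a u) u" (is "gpath G a ?p u")
    using gpath_tree_path [OF G aV u(1)] .
  then obtain b q where q: "?p = a # b # q"
    using u(2) by (cases ?p; cases "tl ?p") (auto simp: gpath_def)
  have ab: "{a, b} \<in> edges G" using p q by (simp add: gpath_def)
  have "card {f \<in> edges G. a \<in> f} = 1"
    using a by (simp add: leaves_def vdegree_def)
  then obtain f where f: "{f \<in> edges G. a \<in> f} = {f}" by (rule card_1_singletonE)
  have "{a, b} \<in> {f}" "e \<in> {f}"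
    using e a(1) ab by (simp_all flip: f)
  then have "{a, b} = e" by simp
  then have "e \<in> path_edges ?p" using q by simp
  then show ?thesis using side_iff [OF G e p] by simp
qed

lemma finite_edges: "is_tree G \<Longrightarrow> finite (edges G)"
proof -
  assume "is_tree G"
  then have "edges G \<subseteq> Pow (verts G)" "finite (verts G)" unfolding is_tree_def by auto
  then show ?thesis by (meson finite_Pow_iff finite_subset)
qed

text \<open>With one index set for all pairs of vertices, inequalities between sums of distances can
  be checked edge by edge.\<close>

lemma path_weight:
  fixes \<omega> :: "'v set \<Rightarrow> real"
  assumes G: "is_tree G" and "u \<in> verts G" "w \<in> verts G"
  shows "(\<Sum>e\<in>path_edges (tree_path G u w). \<omega> e) =
    (\<Sum>e\<in>edges G. if side G e u \<noteq> side G e w then \<omega> e else 0)"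
proof -
  have p: "gpath G u (tree_path G u w) w" by (rule gpath_tree_path [OF assms])
  have "e \<in> path_edges (tree_path G u w) \<longleftrightarrow> e \<in> edges G \<and> side G e u \<noteq> side G e w" for e
  proof (cases "e \<in> edges G")
    case True
    then show ?thesis using side_iff [OF G True p] by simp
  next
    case False
    then show ?thesis using gpath_path_edges [OF p] by (auto dest: subsetD)
  qed
  then have "path_edges (tree_path G u w) = {e \<in> edges G. side G e u \<noteq> side G e w}"
    by (intro set_eqI) simp
  then show ?thesis
    by (simp only: sum.inter_filter [OF finite_edges [OF G]])
qed

text \<open>For an edge of nonnegative weight, the split ab|cd' is the only one that can contribute
  more to the left than to the right. Edges at leaves, whose weight may be negative, contribute
  equally to both sides, since such an edge separates at most one of the four leaves from the
  others.\<close>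

lemma four_point:
  fixes \<omega> :: "'v set \<Rightarrow> real" and G :: "('v, 'z) sgraph_scheme"
  defines "d \<equiv> \<lambda>u w. \<Sum>e\<in>path_edges (tree_path G u w). \<omega> e"
  assumes G: "is_tree G" and L: "{a, b, c, d'} \<subseteq> leaves G" and D: "distinct [a, b, c, d']"
    and \<omega>: "\<forall>e\<in>inner_edges G. 0 \<le> \<omega> e"
    and ns: "\<nexists>e. splits G e a b c d'"
  shows "d a c + d b d' \<le> d a b + d c d'"
proof -
  have V: "a \<in> verts G" "b \<in> verts G" "c \<in> verts G" "d' \<in> verts G"
    using L by (auto simp: leaves_def)
  let ?f = "\<lambda>u w e. if side G e u \<noteq> side G e w then \<omega> e else 0"
  have "?f a c e + ?f b d' e \<le> ?f a b e + ?f c d' e" if e: "e \<in> edges G" for e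
  proof (cases "e \<in> inner_edges G")
    case True
    then have "0 \<le> \<omega> e" using \<omega> by blast
    moreover have "\<not> splits G e a b c d'" using ns by blast
    ultimately show ?thesis using e by (auto simp: splits_def)
  next
    case False
    then obtain l where l: "l \<in> e" "l \<in> leaves G" using e by (auto simp: inner_edges_def)
    have *: "side G e u \<noteq> side G e w \<longleftrightarrow> (u = l) \<noteq> (w = l)"
      if "u \<in> {a, b, c, d'}" "w \<in> {a, b, c, d'}" for u w
      using leaf_edge_side [OF G e l, of u] leaf_edge_side [OF G e l, of w] that V by auto
    have "?f u w e = (if (u = l) \<noteq> (w = l) then \<omega> e else 0)"
      if "u \<in> {a, b, c, d'}" "w \<in> {a, b, c, d'}" for u w
      using * [OF that] by simp
    then show ?thesis using D by auto
  qed
  then have "(\<Sum>e\<in>edges G. ?f a c e + ?f b d' e) \<le> (\<Sum>e\<in>edges G. ?f a b e + ?f c d' e)"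
    by (rule sum_mono)
  then show ?thesis
    unfolding d_def using path_weight [OF G] V by (simp add: sum.distrib)
qed

section \<open>Leaves hanging off a path\<close>

lemma gpath_between:
  assumes "gpath G x p y" "v \<in> set p" "w \<in> set p"
  shows "\<exists>q. gpath G v q w \<and> set q \<subseteq> set p"
proof (cases "v = w")
  case True
  then show ?thesis using assms gpath_ends [OF assms(1)] by (intro exI [of _ "[v]"]) (auto simp: gpath_def)
next
  case False
  obtain xs ys where p: "p = xs @ v # ys" using assms(2) by (meson split_list)
  show ?thesis
  proof (cases "w \<in> set ys")
    case True
    then obtain as bs where ys: "ys = as @ w # bs" by (meson split_list)
    have "gpath G v (v # ys) y" using assms(1) unfolding p by (rule gpath_split(2))
    then have "gpath G v ((v # as) @ w # bs) y" by (simp add: ys)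
    then have "gpath G v ((v # as) @ [w]) w" by (rule gpath_split(1))
    then show ?thesis by (intro exI [of _ "(v # as) @ [w]"]) (auto simp: p ys)
  next
    case False
    then have "w \<in> set xs" using assms(3) p \<open>v \<noteq> w\<close> by auto
    then obtain as bs where xs: "xs = as @ w # bs" by (meson split_list)
    have "gpath G x (xs @ [v]) v" using assms(1) unfolding p by (rule gpath_split(1))
    then have "gpath G x (as @ w # (bs @ [v])) v" by (simp add: xs)
    then have "gpath G w (w # (bs @ [v])) v" by (rule gpath_split(2))
    then have "gpath G v (rev (w # (bs @ [v]))) w" by (rule gpath_rev)
    then show ?thesis by (intro exI [of _ "rev (w # (bs @ [v]))"]) (auto simp: p xs)
  qed
qed

lemma gpath_side_const:
  assumes "is_tree G" "e \<in> edges G" "gpath G x p y" "e \<notin> path_edges p" "u \<in> set p"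
  shows "side G e u = side G e x"
proof -
  obtain xs ys where p: "p = xs @ u # ys" using assms(5) by (meson split_list)
  have "gpath G x (xs @ [u]) u" using assms(3) unfolding p by (rule gpath_split(1))
  moreover have "e \<notin> path_edges (xs @ [u])"
    using assms(4) path_edges_append [of xs u ys] p by simp
  ultimately show ?thesis using side_iff [OF assms(1,2)] by blast
qed

text \<open>\<open>p\<close> touches \<open>Q\<close> in a single vertex, so it contains no edge
  inside \<open>Q\<close> and never changes sides with respect to one.\<close>

lemma hang_side:
  assumes G: "is_tree G" and p: "gpath G a p v" and pq: "set p \<inter> Q = {v}"
    and e: "e \<in> edges G" "e \<subseteq> Q" and u: "u \<in> set p"
  shows "side G e u = side G e v"
proof -
  have "e \<notin> path_edges p"
  proof
    assume "e \<in> path_edges p"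
    then have "e \<subseteq> {v}" using path_edges_subset [of e p] e(2) pq by blast
    moreover obtain b c where "e = {b, c}" "b \<noteq> c" using tree_edgeE [OF G e(1)] by metis
    ultimately show False by blast
  qed
  then show ?thesis
    using gpath_side_const [OF G e(1) p _ u] side_iff [OF G e(1) p] by simp
qed

text \<open>An edge separating \<open>x\<close> from \<open>y\<close> lies on \<open>P\<close>, and
  for such an edge both hanging paths stay on the side of their common foot
  \<open>v\<close>.\<close>

lemma no_split_same_hang:
  assumes G: "is_tree G" and P: "gpath G x P y"
    and p: "gpath G a p v" "set p \<inter> set P = {v}" and q: "gpath G b q v" "set q \<inter> set P = {v}"
  shows "\<not> splits G e x a y b"
proof
  assume s: "splits G e x a y b"
  then have e: "e \<in> edges G" "side G e x \<noteq> side G e y" by (auto simp: splits_def)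
  then have "e \<subseteq> set P" using side_iff [OF G e(1) P] path_edges_subset by blast
  then have "side G e a = side G e b"
    using hang_side [OF G p e(1)] hang_side [OF G q e(1)] gpath_ends [OF p(1)] gpath_ends [OF q(1)]
    by blast
  then show False using s by (auto simp: splits_def)
qed

text \<open>An edge with \<open>x\<close>, \<open>y\<close> on one side and \<open>a\<close>,
  \<open>b\<close> on the other would lie off \<open>P\<close> and on both hanging paths. These
  cannot share a vertex, because an edge of \<open>P\<close> between the two feet separates all of
  \<open>p\<close> from all of \<open>q\<close>.\<close>

lemma no_split_diff_hang:
  assumes G: "is_tree G" and P: "gpath G x P y"
    and p: "gpath G a p v" "set p \<inter> set P = {v}" and q: "gpath G b q w" "set q \<inter> set P = {w}"
    and vw: "v \<noteq> w"
  shows "\<not> splits G e x y a b"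
proof
  assume s: "splits G e x y a b"
  then have e: "e \<in> edges G" by (simp add: splits_def)
  have eP: "e \<notin> path_edges P" using s side_iff [OF G e P] by (simp add: splits_def)
  have vP: "v \<in> set P" "w \<in> set P" using p(2) q(2) by blast+
  have "side G e v = side G e x" "side G e w = side G e x"
    using gpath_side_const [OF G e P eP] vP by blast+
  then have "e \<in> path_edges p" "e \<in> path_edges q"
    using s side_iff [OF G e p(1)] side_iff [OF G e q(1)] by (auto simp: splits_def)
  then have ep: "e \<subseteq> set p" "e \<subseteq> set q" using path_edges_subset by blast+
  obtain c c' where c: "e = {c, c'}" using tree_edgeE [OF G e] by metis
  obtain r where r: "gpath G v r w" "set r \<subseteq> set P" using gpath_between [OF P vP] by blast
  then obtain b' r' where r': "r = v # b' # r'"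
    using vw by (cases r; cases "tl r") (auto simp: gpath_def)
  define e' where "e' = {v, b'}"
  have e': "e' \<in> edges G" "e' \<subseteq> set P" "e' \<in> path_edges r"
    using r r' vP by (auto simp: gpath_def e'_def)
  have "side G e' c = side G e' v" "side G e' c = side G e' w"
    using hang_side [OF G p e'(1,2)] hang_side [OF G q e'(1,2)] ep c by blast+
  then show False using side_iff [OF G e'(1) r(1)] e'(3) by simp
qed

lemma leaf_edgeE:
  assumes "a \<in> leaves G"
  obtains e where "e \<in> edges G" "a \<in> e"
proof -
  have "card {e \<in> edges G. a \<in> e} = 1" using assms by (simp add: leaves_def vdegree_def)
  then have "{e \<in> edges G. a \<in> e} \<noteq> {}" by (metis card.empty zero_neq_one)
  then show ?thesis using that by blast
qed

text \<open>The foot is the first vertex of \<open>P\<close> met on the way from \<open>a\<close> to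
  \<open>x\<close>. It is not an end of \<open>P\<close>: the edge at a leaf end lies on
  \<open>P\<close>, so \<open>a\<close> would be on the side of that leaf, which contains the leaf
  alone.\<close>

lemma leaf_hangs:
  assumes G: "is_tree G" and L: "x \<in> leaves G" "y \<in> leaves G" "x \<noteq> y"
    and a: "a \<in> verts G" "a \<noteq> x" "a \<noteq> y" and P: "gpath G x P y"
  shows "\<exists>v \<in> set P - {x, y}. \<exists>p. gpath G a p v \<and> set p \<inter> set P = {v}"
proof -
  have xy: "x \<in> verts G" "y \<in> verts G" using L by (auto simp: leaves_def)
  have p: "gpath G a (tree_path G a x) x" (is "gpath G a ?p x")
    using gpath_tree_path [OF G a(1) xy(1)] .
  have "\<exists>z\<in>set ?p. z \<in> set P" using gpath_ends [OF p] gpath_ends [OF P] by blast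
  then obtain as v bs where v: "?p = as @ v # bs" "v \<in> set P" "\<forall>z\<in>set as. z \<notin> set P"
    using split_list_first_prop [of ?p "\<lambda>z. z \<in> set P"] by blast
  have q: "gpath G a (as @ [v]) v" using p unfolding v(1) by (rule gpath_split(1))
  have qP: "set (as @ [v]) \<inter> set P = {v}" using v(2,3) by auto
  have "v \<noteq> z" if z: "z \<in> {x, y}" for z
  proof
    assume vz: "v = z"
    have zl: "z \<in> leaves G" using z L by blast
    obtain e where e: "e \<in> edges G" "z \<in> e" using leaf_edgeE [OF zl] .
    note ls = leaf_edge_side [OF G e zl]
    have "side G e x \<noteq> side G e y" using ls [of x] ls [of y] xy L(3) z by auto
    then have "e \<subseteq> set P" using side_iff [OF G e(1) P] path_edges_subset by blast
    then have "side G e a = side G e z"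
      using hang_side [OF G q qP e(1)] gpath_ends [OF q] vz by blast
    then show False using ls [of a] a z by auto
  qed
  then show ?thesis using q qP v(2) by blast
qed

section \<open>Cherries of quartets and the splits they exclude\<close>

lemma path_crosses:
  assumes "p \<noteq> []" "hd p \<in> A" "last p \<notin> A"
  shows "\<exists>u v. {u, v} \<in> path_edges p \<and> u \<in> A \<and> v \<notin> A"
  using assms
proof (induction p rule: induct_list012)
  case (3 u v p)
  show ?case
  proof (cases "v \<in> A")
    case True
    then show ?thesis using 3 by auto
  next
    case False
    then show ?thesis using 3 by auto
  qed
qed auto

lemma path_edges_split: "e \<in> path_edges p \<Longrightarrow> \<exists>as x y bs. p = as @ x # y # bs \<and> e = {x, y}"
proof (induction p rule: induct_list012)
  case (3 u v p)
  show ?case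
  proof (cases "e = {u, v}")
    case True
    then show ?thesis by (intro exI [of _ "[]"] exI [of _ u] exI [of _ v] exI [of _ p]) simp
  next
    case False
    then have "e \<in> path_edges (v # p)" using "3.prems" by simp
    then obtain as x y bs where "v # p = as @ x # y # bs" "e = {x, y}" using "3.IH"(2) by blast
    then show ?thesis by (intro exI [of _ "u # as"] exI [of _ x] exI [of _ y] exI [of _ bs]) simp
  qed
qed auto

text \<open>Let \<open>A\<close> be the set of vertices of \<open>P\<close> up to the edge
  \<open>e\<close>. The edges of \<open>P\<close> already exhaust their degrees, so \<open>e\<close>
  is the only edge of \<open>H\<close> leaving \<open>A\<close>; as \<open>c\<close> lies outside
  \<open>A\<close>, the path \<open>Q\<close> has to leave through \<open>e\<close>.\<close>

lemma chain_edge_in_path: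
  assumes fin: "finite (edges H)"
    and P: "gpath H a P w" and deg: "\<forall>v\<in>set P - {a, w}. vdegree H v = 2" and a: "vdegree H a \<le> 1"
    and c: "vdegree H c \<noteq> 2" "c \<noteq> a" and Q: "gpath H a Q c" and e: "e \<in> path_edges P"
  shows "e \<in> path_edges Q"
proof -
  obtain as x y bs where xy: "P = as @ x # y # bs" "e = {x, y}"
    using path_edges_split [OF e] by blast
  define A where "A = set (as @ [x])"
  have dist: "distinct P" and hdP: "hd P = a" and lastP: "last P = w"
    and suc: "successively (\<lambda>a b. {a, b} \<in> edges H) P"
    using P by (auto simp: gpath_def)
  have wA: "w \<notin> A"
  proof -
    have "w = last (y # bs)" using lastP xy by simp
    then have "w \<in> set (y # bs)" by (metis last_in_set list.discI)
    then show ?thesis using dist xy unfolding A_def by auto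
  qed
  have aA: "a \<in> A" using hdP xy unfolding A_def by (cases as) auto
  have AP: "A \<subseteq> set P" using xy unfolding A_def by auto
  have cA: "c \<notin> A" using deg c wA AP by auto
  have out: "{z, v} = e" if z: "z \<in> A" "{z, v} \<in> edges H" "v \<notin> A" for z v
  proof -
    obtain ls cs where lz: "as @ [x] = ls @ z # cs"
      using z(1) unfolding A_def by (meson split_list)
    obtain nx ds where nx: "cs @ y # bs = nx # ds" by (cases cs) auto
    have Pz: "P = ls @ z # nx # ds" using xy lz nx
      by (metis append.assoc append_Cons append_Nil)
    have e1: "{z, nx} \<in> edges H" using suc by (simp add: Pz successively_append_iff)
    let ?E = "{f \<in> edges H. z \<in> f}"
    have finE: "finite ?E" using fin by simp
    have "{z, v} = {z, nx}"
    proof (cases ls rule: rev_cases)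
      case Nil
      then have "z = a" using hdP Pz by simp
      then have "card ?E \<le> 1" using a by (simp add: vdegree_def)
      moreover have "{z, v} \<in> ?E" "{z, nx} \<in> ?E" using e1 z by auto
      ultimately show ?thesis using card_le_Suc0_iff_eq [OF finE] by (metis One_nat_def)
    next
      case (snoc ms pv)
      have e2: "{pv, z} \<in> edges H" using suc by (simp add: Pz snoc successively_append_iff)
      have pvA: "pv \<in> A"
      proof -
        have "pv \<in> set (as @ [x])" unfolding lz snoc by simp
        then show ?thesis by (simp add: A_def)
      qed
      have pn: "pv \<noteq> nx" "pv \<noteq> z" using dist by (auto simp: Pz snoc)
      have "z \<noteq> a" using hdP dist Pz snoc by (cases ms) auto
      then have "vdegree H z = 2" using deg z(1) wA AP by auto
      then have card2: "card ?E = 2" by (simp add: vdegree_def)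
      have sub: "{{pv, z}, {z, nx}, {z, v}} \<subseteq> ?E" using e1 e2 z(2) by auto
      have ne: "{pv, z} \<noteq> {z, nx}" "{pv, z} \<noteq> {z, v}"
        using pn pvA z(3) by (auto simp: doubleton_eq_iff)
      show ?thesis
      proof (rule ccontr)
        assume "{z, v} \<noteq> {z, nx}"
        then have "card {{pv, z}, {z, nx}, {z, v}} = 3" using ne by auto
        then show False using card_mono [OF finE sub] card2 by simp
      qed
    qed
    then have "v = nx" by (auto simp: doubleton_eq_iff)
    moreover have "cs = []"
    proof (rule ccontr)
      assume "cs \<noteq> []"
      then have "nx \<in> set cs" using nx by (cases cs) auto
      then have "nx \<in> set (as @ [x])" unfolding lz by simp
      then show False using z(3) \<open>v = nx\<close> by (simp add: A_def)
    qed
    ultimately show ?thesis using xy lz nx by auto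
  qed
  have "Q \<noteq> []" "hd Q \<in> A" "last Q \<notin> A" using Q aA cA by (auto simp: gpath_def)
  then obtain u v where uv: "{u, v} \<in> path_edges Q" "u \<in> A" "v \<notin> A"
    using path_crosses by metis
  then show ?thesis using out [of u v] gpath_path_edges [OF Q] by auto
qed

lemma successively_path_edges:
  "path_edges p \<subseteq> E \<Longrightarrow> successively (\<lambda>a b. {a, b} \<in> E) p"
  by (induction p rule: induct_list012) auto

text \<open>Suppose \<open>e\<close> separates {a, c} from {b, d}, and let \<open>w\<close> be the
  common neighbour in the cherry. The chain from \<open>a\<close> to \<open>w\<close> is contained
  in the path from \<open>a\<close> to \<open>c\<close>, which avoids \<open>e\<close>, so
  \<open>w\<close> is on the side of \<open>a\<close>. Arguing with \<open>b\<close> and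
  \<open>d\<close>, it is also on the side of \<open>b\<close>.\<close>

lemma cherry_no_split:
  fixes G :: "('v, 'z) sgraph_scheme"
  assumes G: "is_tree G" and L: "A \<subseteq> leaves G" and A: "A = {a, b, c, d}" and D: "distinct [a, b, c, d]"
    and ch: "cherry (suppress (spanned_subtree G A)) a b"
  shows "\<not> splits G e a c b d"
proof
  assume s: "splits G e a c b d"
  then have e: "e \<in> edges G" by (simp add: splits_def)
  define H where "H = spanned_subtree G A"
  have AV: "u \<in> verts G" if "u \<in> A" for u using L that by (auto simp: leaves_def)
  have path: "gpath H u (tree_path G u w) w" if "u \<in> A" "w \<in> A" for u w
  proof -
    have p: "gpath G u (tree_path G u w) w" using gpath_tree_path [OF G] AV that by blast
    have "path_edges (tree_path G u w) \<subseteq> edges H" "set (tree_path G u w) \<subseteq> verts H"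
      unfolding H_def spanned_subtree_def using that by auto
    then show ?thesis using p successively_path_edges unfolding gpath_def by blast
  qed
  have HG: "verts H \<subseteq> verts G" "edges H \<subseteq> edges G"
  proof -
    have p: "gpath G u (tree_path G u w) w" if "u \<in> A" "w \<in> A" for u w
      using gpath_tree_path [OF G] AV that by blast
    show "verts H \<subseteq> verts G" unfolding H_def spanned_subtree_def
      using gpath_ends [OF p] by auto
    show "edges H \<subseteq> edges G" unfolding H_def spanned_subtree_def
      using gpath_path_edges [OF p] by auto
  qed
  have fin: "finite (edges H)" using HG(2) finite_edges [OF G] by (rule finite_subset)
  \<comment> \<open>A leaf of \<open>G\<close> keeps degree at most one in the spanned subtree, so
    it can serve both as the start of a chain and as a target of degree different from two.\<close>
  have deg: "vdegree H u \<le> 1" if "u \<in> A" for u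
  proof -
    have "vdegree G u = 1" using that L by (auto simp: leaves_def)
    moreover have "vdegree H u \<le> vdegree G u" unfolding vdegree_def
      using HG(2) finite_edges [OF G] by (intro card_mono) auto
    ultimately show ?thesis by simp
  qed
  have edge: "\<exists>P. gpath H u P w \<and> (\<forall>v\<in>set P - {u, w}. vdegree H v = 2)"
    if uw: "{u, w} \<in> edges (suppress H)" for u w
  proof -
    obtain u' w' P where P: "{u, w} = {u', w'}" "gpath H u' P w'"
      "\<forall>v\<in>set P - {u', w'}. vdegree H v = 2"
      using uw unfolding suppress_def by auto
    show ?thesis
    proof (cases "u = u' \<and> w = w'")
      case True
      then show ?thesis using P by blast
    next
      case False
      then have "u = w'" "w = u'" using P(1) by (auto simp: doubleton_eq_iff)
      then show ?thesis using P gpath_rev [OF P(2)] by (intro exI [of _ "rev P"]) auto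
    qed
  qed
  have key: "side G e u = side G e w"
    if uc: "u \<in> A" "c' \<in> A" "c' \<noteq> u" "side G e u = side G e c'" "{u, w} \<in> edges (suppress H)" for u w c'
  proof (rule ccontr)
    assume ne: "side G e u \<noteq> side G e w"
    obtain P where P: "gpath H u P w" "\<forall>v\<in>set P - {u, w}. vdegree H v = 2"
      using edge [OF uc(5)] by blast
    have "e \<in> path_edges P" using side_iff [OF G e gpath_mono [OF P(1) HG]] ne by simp
    moreover have "vdegree H c' \<noteq> 2" using deg [OF uc(2)] by simp
    ultimately have "e \<in> path_edges (tree_path G u c')"
      using chain_edge_in_path [OF fin P deg [OF uc(1)] _ uc(3) path [OF uc(1,2)]] by blast
    then show False
      using side_iff [OF G e gpath_mono [OF path [OF uc(1,2)] HG]] uc(4) by simp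
  qed
  obtain w where w: "{a, w} \<in> edges (suppress H)" "{b, w} \<in> edges (suppress H)"
    using ch unfolding cherry_def H_def by blast
  have "side G e a = side G e w" "side G e b = side G e w"
    using key [of a c w] key [of b d w] w s A D by (auto simp: splits_def)
  then show False using s by (simp add: splits_def)
qed

section \<open>Four-point inequalities on the closed tree cone\<close>

text \<open>Exponentiated tropical coordinates: sums become products, and inequalities stay
  meaningful where coordinates are -\<infinity>. The value at \<infinity> is a default; coordinates
  of points stay below \<infinity>.\<close>

definition eexp :: "ereal \<Rightarrow> real" where
  "eexp u = (if u = - \<infinity> then 0 else exp (real_of_ereal u))"

lemma eexp_simps [simp]: "eexp (- \<infinity>) = 0" "eexp (ereal a) = exp a"
  by (auto simp: eexp_def)

lemma eexp_nonneg: "0 \<le> eexp u"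
  by (simp add: eexp_def)

lemma eexp_eq_0_iff: "eexp u = 0 \<longleftrightarrow> u = - \<infinity>"
  by (simp add: eexp_def)

lemma eexp_add: "u < \<infinity> \<Longrightarrow> eexp (u + ereal c) = eexp u * exp c"
  by (cases u) (auto simp: exp_add)

lemma eexp_less_iff: "u < \<infinity> \<Longrightarrow> 0 < t \<Longrightarrow> eexp u < t \<longleftrightarrow> u < elog t"
proof -
  assume u: "u < \<infinity>" and "0 < t"
  then obtain s where "t = exp s" by (metis exp_ln)
  then show ?thesis using u by (cases u) (auto simp: elog_def)
qed

lemma less_eexp_iff: "u < \<infinity> \<Longrightarrow> 0 \<le> t \<Longrightarrow> t < eexp u \<longleftrightarrow> elog t < u"
proof -
  assume u: "u < \<infinity>" and t: "0 \<le> t"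
  show ?thesis
  proof (cases "t = 0")
    case True
    then show ?thesis using u by (cases u) (auto simp: elog_def)
  next
    case False
    then obtain s where "t = exp s" using t by (metis exp_ln less_eq_real_def)
    then show ?thesis using u by (cases u) (auto simp: elog_def)
  qed
qed

lemma continuous_on_eexp: "continuous_on {..<\<infinity>} eexp"
  unfolding continuous_on_def
proof
  fix u :: ereal
  assume u: "u \<in> {..<\<infinity>}"
  have ev: "\<forall>\<^sub>F v in at u within {..<\<infinity>}. v < \<infinity>"
    by (auto simp: eventually_at_filter)
  show "(eexp \<longlongrightarrow> eexp u) (at u within {..<\<infinity>})"
  proof (rule order_tendstoI)
    fix t assume t: "t < eexp u"
    show "\<forall>\<^sub>F v in at u within {..<\<infinity>}. t < eexp v"
    proof (cases "t < 0")
      case True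
      then show ?thesis using eexp_nonneg by (intro always_eventually) (meson less_le_trans)
    next
      case False
      then have "elog t < u" using less_eexp_iff t u by simp
      then have "\<forall>\<^sub>F v in at u within {..<\<infinity>}. elog t < v"
        using order_tendstoD(1) [OF tendsto_ident_at] by blast
      with ev show ?thesis by eventually_elim (use False less_eexp_iff in simp)
    qed
  next
    fix t assume t: "eexp u < t"
    then have t0: "0 < t" using eexp_nonneg [of u] by simp
    then have "u < elog t" using eexp_less_iff t u by simp
    then have "\<forall>\<^sub>F v in at u within {..<\<infinity>}. v < elog t"
      using order_tendstoD(2) [OF tendsto_ident_at] by blast
    with ev show "\<forall>\<^sub>F v in at u within {..<\<infinity>}. eexp v < t"
      by eventually_elim (use t0 eexp_less_iff in simp)
  qed
qed

lemma topspace_tp_vecs: "topspace (tp_vecs_topology n) = tp_vecs n"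
  by (auto simp: tp_vecs_topology_def tp_vecs_def)

lemma continuous_map_eexp:
  assumes "e \<in> pairs n"
  shows "continuous_map (tp_vecs_topology n) euclideanreal (\<lambda>z. eexp (z e))"
proof -
  have "continuous_map (tp_vecs_topology n) (subtopology euclidean {..<\<infinity>}) (\<lambda>z. z e)"
    unfolding tp_vecs_topology_def
    using assms by (intro continuous_map_from_subtopology continuous_map_product_projection)
  moreover have "continuous_map (subtopology euclidean {..<\<infinity>}) euclideanreal eexp"
    using continuous_on_eexp by (simp add: continuous_map_iff_continuous)
  ultimately have "continuous_map (tp_vecs_topology n) euclideanreal (eexp \<circ> (\<lambda>z. z e))"
    by (rule continuous_map_compose)
  then show ?thesis by (simp add: o_def)
qed

lemma tp_class_self: "z \<in> tp_vecs n \<Longrightarrow> z \<in> tp_class n z"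
proof -
  assume z: "z \<in> tp_vecs n"
  have "\<forall>e\<in>pairs n. z e = z e + ereal 0" by (simp flip: zero_ereal_def)
  then show ?thesis using z unfolding tp_class_def tp_rel_def by blast
qed

lemma tp_class_eqD:
  assumes "tp_class n z = tp_class n z'" "z \<in> tp_vecs n"
  shows "\<exists>c. \<forall>e\<in>pairs n. z e = z' e + ereal c"
  using tp_class_self [OF assms(2)] assms(1) unfolding tp_class_def tp_rel_def by auto

lemma tp_vecs_less: "z \<in> tp_vecs n \<Longrightarrow> e \<in> pairs n \<Longrightarrow> z e < \<infinity>"
  unfolding tp_vecs_def by (auto simp: PiE_def Pi_def)

text \<open>The strict reverse inequality is an open condition on representatives, since
  exponentiated coordinates are continuous even at -\<infinity>. Both sides have degree two, so it
  does not depend on the representative and defines an open set of classes. If it contained a point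
  of the closure it would meet \<open>C\<close>, where the condition fails.\<close>

lemma tp_closure_le:
  assumes C: "C = {tp_class n z | z. z \<in> tp_vecs n \<and> P z}"
    and x: "x \<in> tp_vecs n" "tp_class n x \<in> tp_topology n closure_of C"
    and abcd: "{a, b, c, d} \<subseteq> pairs n"
    and le: "\<And>z. z \<in> tp_vecs n \<Longrightarrow> P z \<Longrightarrow> eexp (z a) * eexp (z b) \<le> eexp (z c) * eexp (z d)"
  shows "eexp (x a) * eexp (x b) \<le> eexp (x c) * eexp (x d)"
proof (rule ccontr)
  define Q where "Q z \<longleftrightarrow> eexp (z c) * eexp (z d) < eexp (z a) * eexp (z b)" for z :: "nat uprod \<Rightarrow> ereal"
  define U where "U = tp_class n ` {z \<in> tp_vecs n. Q z}"
  assume "\<not> ?thesis"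
  then have "tp_class n x \<in> U" using x(1) by (auto simp: U_def Q_def)
  have inv: "Q z" if z: "z \<in> tp_vecs n" "z' \<in> tp_vecs n" "tp_class n z = tp_class n z'" "Q z'" for z z'
  proof -
    obtain k where k: "\<forall>e\<in>pairs n. z e = z' e + ereal k" using tp_class_eqD z by blast
    have *: "eexp (z e) = eexp (z' e) * exp k" if "e \<in> pairs n" for e
      using k that eexp_add [OF tp_vecs_less [OF z(2) that]] by simp
    show ?thesis using z(4) abcd by (simp add: Q_def * mult_ac)
  qed
  have "openin (tp_topology n) U"
    unfolding openin_tp_topology
  proof
    show "U \<subseteq> tp_space n"
      by (auto simp: U_def tp_space_def tp_class_def intro!: quotientI)
    have "{z \<in> tp_vecs n. tp_class n z \<in> U} =
      {z \<in> topspace (tp_vecs_topology n).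
        eexp (z c) * eexp (z d) - eexp (z a) * eexp (z b) \<in> {..<0}}"
      using inv unfolding topspace_tp_vecs by (auto simp: U_def Q_def)
    also have "openin (tp_vecs_topology n) \<dots>"
      using abcd by (intro openin_continuous_map_preimage [where Y = euclideanreal]
        continuous_map_diff continuous_map_real_mult continuous_map_eexp) auto
    finally show "openin (tp_vecs_topology n) {z \<in> tp_vecs n. tp_class n z \<in> U}" .
  qed
  then obtain y where y: "y \<in> C" "y \<in> U"
    using x(2) \<open>tp_class n x \<in> U\<close> unfolding in_closure_of by blast
  then obtain z z' where z: "z \<in> tp_vecs n" "P z" "z' \<in> tp_vecs n" "Q z'" "tp_class n z = tp_class n z'"
    unfolding C U_def by blast
  then have "Q z" using inv by blast
  then show False using le z by (force simp: Q_def)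
qed

lemma tree_cone_four_point:
  assumes T: "labeled_tree n T"
    and x: "x \<in> tp_vecs n" "tp_class n x \<in> tp_topology n closure_of tree_cone n T"
    and abcd: "{a, b, c, d} \<subseteq> {1..n}" "distinct [a, b, c, d]"
    and ns: "\<And>e. \<not> splits T e (label T a) (label T b) (label T c) (label T d)"
  shows "eexp (x (Upair a c)) * eexp (x (Upair b d)) \<le> eexp (x (Upair a b)) * eexp (x (Upair c d))"
proof (rule tp_closure_le [OF tree_cone_def x])
  have G: "is_tree T" and lab: "bij_betw (label T) {1..n} (leaves T)"
    using T by (auto simp: labeled_tree_def)
  show "{Upair a c, Upair b d, Upair a b, Upair c d} \<subseteq> pairs n"
    using abcd unfolding pairs_def by auto
  fix z
  assume "\<exists>\<omega> :: 'a set \<Rightarrow> real. (\<forall>e\<in>inner_edges T. 0 \<le> \<omega> e) \<and>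
       (\<forall>k\<in>{1..n}. \<forall>l\<in>{1..n}. k \<noteq> l \<longrightarrow>
          z (Upair k l) = ereal (\<Sum>e\<in>path_edges (leaf_path T k l). \<omega> e))"
  then obtain \<omega> :: "'a set \<Rightarrow> real" where \<omega>: "\<forall>e\<in>inner_edges T. 0 \<le> \<omega> e"
    and z: "\<And>k l. k \<in> {1..n} \<Longrightarrow> l \<in> {1..n} \<Longrightarrow> k \<noteq> l \<Longrightarrow>
          z (Upair k l) = ereal (\<Sum>e\<in>path_edges (leaf_path T k l). \<omega> e)" by blast
  have L: "{label T a, label T b, label T c, label T d} \<subseteq> leaves T"
    using lab abcd(1) by (auto simp: bij_betw_def)
  have D: "distinct [label T a, label T b, label T c, label T d]"
    using abcd inj_on_eq_iff [OF bij_betw_imp_inj_on [OF lab]] by auto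
  have "sum \<omega> (path_edges (leaf_path T a c)) + sum \<omega> (path_edges (leaf_path T b d))
    \<le> sum \<omega> (path_edges (leaf_path T a b)) + sum \<omega> (path_edges (leaf_path T c d))"
    using four_point [OF G L D \<omega>] ns by blast
  then show "eexp (z (Upair a c)) * eexp (z (Upair b d)) \<le> eexp (z (Upair a b)) * eexp (z (Upair c d))"
    using abcd by (simp add: z flip: exp_add)
qed

section \<open>Branches along a path\<close>

lemma branch_hang:
  assumes T: "labeled_tree n T" and k: "k \<in> branch n T i j v" and ij: "{i, j} \<subseteq> {1..n}"
  shows "gpath T (label T i) (leaf_path T i j) (label T j)"
    "gpath T (label T k) (tree_path T (label T k) v) v"
    "set (tree_path T (label T k) v) \<inter> set (leaf_path T i j) = {v}"
proof -
  have G: "is_tree T" and lab: "\<And>k. k \<in> {1..n} \<Longrightarrow> label T k \<in> verts T"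
    using T by (auto simp: labeled_tree_def bij_betw_def leaves_def)
  show P: "gpath T (label T i) (leaf_path T i j) (label T j)"
    using gpath_tree_path [OF G lab lab] ij by blast
  show pv: "set (tree_path T (label T k) v) \<inter> set (leaf_path T i j) = {v}"
    using k by (simp add: branch_def)
  then have "v \<in> verts T" using gpath_ends [OF P] by blast
  then show "gpath T (label T k) (tree_path T (label T k) v) v"
    using gpath_tree_path [OF G lab] k by (simp add: branch_def)
qed

lemma branch_exists:
  assumes T: "labeled_tree n T" and ij: "{i, j} \<subseteq> {1..n}" "i \<noteq> j" and k: "k \<in> {1..n} - {i, j}"
  shows "\<exists>v. v \<in> path_internal T i j \<and> k \<in> branch n T i j v"
proof -
  have G: "is_tree T" and lab: "bij_betw (label T) {1..n} (leaves T)"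
    using T by (auto simp: labeled_tree_def)
  have leaf: "label T k \<in> leaves T" if "k \<in> {1..n}" for k
    using that lab by (auto simp: bij_betw_def)
  then have vert: "label T k \<in> verts T" if "k \<in> {1..n}" for k
    using that by (auto simp: leaves_def)
  have inj: "label T k = label T l \<longleftrightarrow> k = l" if "k \<in> {1..n}" "l \<in> {1..n}" for k l
    using inj_on_eq_iff [OF bij_betw_imp_inj_on [OF lab]] that by blast
  have P: "gpath T (label T i) (leaf_path T i j) (label T j)"
    using gpath_tree_path [OF G vert vert] ij by blast
  have "\<exists>v\<in>set (leaf_path T i j) - {label T i, label T j}.
      \<exists>p. gpath T (label T k) p v \<and> set p \<inter> set (leaf_path T i j) = {v}"
    using leaf_hangs [OF G leaf leaf _ vert _ _ P] ij k inj by auto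
  then obtain v p where v: "v \<in> path_internal T i j" "gpath T (label T k) p v"
    "set p \<inter> set (leaf_path T i j) = {v}"
    unfolding path_internal_def by blast
  then have "k \<in> branch n T i j v" using k tree_path_eq [OF G v(2)] by (simp add: branch_def)
  then show ?thesis using v(1) by blast
qed

definition branch_vertex :: "nat \<Rightarrow> 'v ltree \<Rightarrow> nat \<Rightarrow> nat \<Rightarrow> nat \<Rightarrow> 'v" where
  "branch_vertex n T i j k = (SOME v. v \<in> path_internal T i j \<and> k \<in> branch n T i j v)"

lemma branch_vertex:
  assumes "labeled_tree n T" "{i, j} \<subseteq> {1..n}" "i \<noteq> j" "k \<in> {1..n} - {i, j}"
  shows "branch_vertex n T i j k \<in> path_internal T i j" "k \<in> branch n T i j (branch_vertex n T i j k)"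
  using someI_ex [OF branch_exists [OF assms]] unfolding branch_vertex_def by auto

lemma splits_swap: "splits G e a b c d \<Longrightarrow> splits G e c d a b" "splits G e a b c d \<Longrightarrow> splits G e b a c d"
  "splits G e a b c d \<Longrightarrow> splits G e a b d c"
  by (auto simp: splits_def)

locale ordered_tree =
  fixes n i j :: nat and T :: "'v ltree" and r :: "(nat \<times> nat) set"
  assumes T: "labeled_tree n T" and ij: "{i, j} \<subseteq> {1..n}" "i \<noteq> j"
    and r: "partial_order_on ({1..n} - {i, j}) r" and ch: "cherry_property n T i j r"
begin

abbreviation "L \<equiv> {1..n} - {i, j}"
abbreviation "\<beta> \<equiv> branch_vertex n T i j"

text \<open>Uniqueness comes from the order: leaves of different branches are incomparable, but
  every leaf is comparable to itself.\<close>

lemma branch_vertex_unique: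
  assumes "v \<in> path_internal T i j" "k \<in> branch n T i j v"
  shows "\<beta> k = v"
proof (rule ccontr)
  assume "\<beta> k \<noteq> v"
  have k: "k \<in> L" using assms(2) by (auto simp: branch_def)
  then have "(k, k) \<in> r" using partial_order_onD(1) [OF r] by (simp add: refl_on_def)
  then show False
    using ch assms branch_vertex [OF T ij k] \<open>\<beta> k \<noteq> v\<close> unfolding cherry_property_def by blast
qed

lemma in_branch_iff:
  assumes "k \<in> L"
  shows "l \<in> branch n T i j (\<beta> k) \<longleftrightarrow> l \<in> L \<and> \<beta> l = \<beta> k"
proof
  assume l: "l \<in> branch n T i j (\<beta> k)"
  have "\<beta> l = \<beta> k" using branch_vertex_unique [OF branch_vertex(1) [OF T ij assms] l] .
  then show "l \<in> L \<and> \<beta> l = \<beta> k" using l by (simp add: branch_def)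
next
  assume "l \<in> L \<and> \<beta> l = \<beta> k"
  then show "l \<in> branch n T i j (\<beta> k)" using branch_vertex(2) [OF T ij, of l] by simp
qed

lemma below_same_branch: "(k, l) \<in> r \<Longrightarrow> \<beta> k = \<beta> l"
proof (rule ccontr)
  assume kl: "(k, l) \<in> r" and ne: "\<beta> k \<noteq> \<beta> l"
  then have "k \<in> L" "l \<in> L" using partial_order_onD(4) [OF r] by auto
  note kb = branch_vertex [OF T ij \<open>k \<in> L\<close>] and lb = branch_vertex [OF T ij \<open>l \<in> L\<close>]
  show False
    using ch kl ne kb lb unfolding cherry_property_def by blast
qed

lemma total_on_branch:
  assumes "k \<in> L" "l \<in> L" "\<beta> k = \<beta> l" "k \<noteq> l"
  shows "(k, l) \<in> r \<or> (l, k) \<in> r"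
proof -
  have "total_on (branch n T i j (\<beta> k)) r"
    using ch branch_vertex(1) [OF T ij assms(1)] unfolding cherry_property_def by blast
  moreover have "k \<in> branch n T i j (\<beta> k)" "l \<in> branch n T i j (\<beta> k)"
    using assms in_branch_iff [OF assms(1)] by simp_all
  ultimately show ?thesis using assms(4) unfolding total_on_def by blast
qed

end

locale tropical_tree = ordered_tree n i j T r
  for n i j :: nat and T :: "'v ltree" and r :: "(nat \<times> nat) set" +
  fixes x :: "nat uprod \<Rightarrow> ereal"
  assumes x: "x \<in> tp_vecs n" "tp_class n x \<in> tp_topology n closure_of tree_cone n T"
begin

abbreviation "X k l \<equiv> eexp (x (Upair k l))"

text \<open>Leaves attached at different vertices of the path exclude the split ij|kl.\<close>

lemma different_branches:
  assumes kl: "k \<in> L" "l \<in> L" "\<beta> k \<noteq> \<beta> l"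
  shows "X i k * X j l \<le> X i j * X k l"
proof (rule tree_cone_four_point [OF T x])
  show "{i, j, k, l} \<subseteq> {1..n}" "distinct [i, j, k, l]" using kl ij by auto
  note hk = branch_hang [OF T branch_vertex(2) [OF T ij kl(1)] ij(1)]
  note hl = branch_hang [OF T branch_vertex(2) [OF T ij kl(2)] ij(1)]
  have G: "is_tree T" using T by (simp add: labeled_tree_def)
  show "\<not> splits T e (label T i) (label T j) (label T k) (label T l)" for e
    using no_split_diff_hang [OF G hk(1) hk(2,3) hl(2,3) kl(3)] .
qed

text \<open>With \<open>k\<close> and \<open>l\<close> attached at the same vertex, no edge induces
  ik|jl or il|jk. Excluding the first bounds the two other sums by x_ik + x_jl; excluding the second
  gives the reverse inequality for the equality.\<close>

lemma same_branch:
  assumes kl: "k \<in> L" "l \<in> L" "\<beta> k = \<beta> l" "k \<noteq> l"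
  shows "X i j * X k l \<le> X i k * X j l" "X i k * X j l = X i l * X j k"
proof -
  have G: "is_tree T" using T by (simp add: labeled_tree_def)
  have ns: "\<not> splits T e (label T i) (label T k) (label T j) (label T l)"
    if kl: "k \<in> L" "l \<in> L" "\<beta> k = \<beta> l" for k l e
  proof -
    note hk = branch_hang [OF T branch_vertex(2) [OF T ij kl(1)] ij(1)]
    note hl = branch_hang [OF T branch_vertex(2) [OF T ij kl(2)] ij(1)]
    show ?thesis using no_split_same_hang [OF G hk(1) hk(2,3)] hl(2,3) kl(3) by metis
  qed
  have ns': "\<not> splits T e (label T i) (label T k) (label T l) (label T j)"
    if kl: "k \<in> L" "l \<in> L" "\<beta> k = \<beta> l" for k l e
    using ns [OF kl, of e] splits_swap(3) [of T e "label T i" "label T k" "label T l" "label T j"] by blast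
  have D: "{i, k, j, l} \<subseteq> {1..n}" "distinct [i, k, j, l]" "{i, k, l, j} \<subseteq> {1..n}" "distinct [i, k, l, j]"
    "{i, l, k, j} \<subseteq> {1..n}" "distinct [i, l, k, j]"
    using kl ij by auto
  have U: "Upair l j = Upair j l" "Upair k j = Upair j k" by auto
  show "X i j * X k l \<le> X i k * X j l"
    using tree_cone_four_point [OF T x D(1,2) ns [OF kl(1-3)]] .
  have "X i l * X k j \<le> X i k * X l j"
    using tree_cone_four_point [OF T x D(3,4) ns' [OF kl(1-3)]] .
  moreover have "X i k * X l j \<le> X i l * X k j"
    using tree_cone_four_point [OF T x D(5,6) ns' [OF kl(2,1) kl(3) [symmetric]]] .
  ultimately show "X i k * X j l = X i l * X j k" unfolding U by simp
qed

text \<open>The forbidden split is km|il. By the cherry property {k, l} or {l, m} is a cherry of the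
  quartet of i, k, l, m, and either one excludes it; then x_km + x_il dominates the two other
  sums.\<close>

lemma order_chain:
  assumes kl: "strictly_below r k l" "strictly_below r l m"
  shows "X i k * X l m \<le> X k m * X i l" "X i m * X k l \<le> X k m * X i l"
proof -
  have G: "is_tree T" and lab: "bij_betw (label T) {1..n} (leaves T)"
    using T by (auto simp: labeled_tree_def)
  have in_L: "k \<in> L" "l \<in> L" "m \<in> L"
    using kl partial_order_onD(4) [OF r] by auto
  have "k \<noteq> m" using kl partial_order_onD(3) [OF r] by (auto dest: antisymD)
  then have D: "{k, m, i, l} \<subseteq> {1..n}" "distinct [k, m, i, l]" "{k, m, l, i} \<subseteq> {1..n}" "distinct [k, m, l, i]"
    using kl ij in_L by auto
  have leaf: "label T ` {i, k, l, m} \<subseteq> leaves T"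
    using lab D(1) by (auto simp: bij_betw_def)
  have inj: "label T u = label T w \<longleftrightarrow> u = w" if "u \<in> {k, m, i, l}" "w \<in> {k, m, i, l}" for u w
    using inj_on_eq_iff [OF bij_betw_imp_inj_on [OF lab]] that D(1) by blast
  have ns: "\<not> splits T e (label T k) (label T m) (label T i) (label T l)" for e
  proof -
    have "cherry (quartet T i k l m) (label T k) (label T l) \<or>
        cherry (quartet T i k l m) (label T l) (label T m)"
      using ch kl unfolding cherry_property_def by blast
    then show ?thesis
    proof
      assume "cherry (quartet T i k l m) (label T k) (label T l)"
      then have "\<not> splits T e (label T k) (label T m) (label T l) (label T i)"
        using D(2) inj unfolding quartet_def
        by (intro cherry_no_split [OF G leaf]) auto
      then show ?thesis
        using splits_swap(3) [of T e "label T k" "label T m" "label T i" "label T l"] by blast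
    next
      assume "cherry (quartet T i k l m) (label T l) (label T m)"
      then have "\<not> splits T e (label T l) (label T i) (label T m) (label T k)"
        using D(2) inj unfolding quartet_def
        by (intro cherry_no_split [OF G leaf]) auto
      then show ?thesis by (auto simp: splits_def)
    qed
  qed
  have ns': "\<not> splits T e (label T k) (label T m) (label T l) (label T i)" for e
    using ns [of e] splits_swap(3) [of T e "label T k" "label T m" "label T l" "label T i"] by blast
  have U: "Upair k i = Upair i k" "Upair m l = Upair l m" "Upair l i = Upair i l" "Upair m i = Upair i m" by auto
  show "X i k * X l m \<le> X k m * X i l"
    using tree_cone_four_point [OF T x D(1,2) ns] unfolding U .
  have "X k l * X m i \<le> X k m * X l i"
    using tree_cone_four_point [OF T x D(3,4) ns'] .
  then show "X i m * X k l \<le> X k m * X i l" unfolding U by (simp add: mult.commute)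
qed

end

section \<open>Homomorphisms out of (Laurent) polynomial rings\<close>

lemma poly_mapping_sum_singles:
  "f = (\<Sum>\<alpha>\<in>Poly_Mapping.keys f. Poly_Mapping.single \<alpha> (Poly_Mapping.lookup f \<alpha>))"
  by (rule poly_mapping_eqI)
    (auto simp: lookup_sum lookup_single when_def not_in_keys_iff_lookup_eq_zero sum.delta)

lemma poly_mapping_mult_singles:
  "f * g = (\<Sum>\<alpha>\<in>Poly_Mapping.keys f. \<Sum>\<beta>\<in>Poly_Mapping.keys g.
     Poly_Mapping.single (\<alpha> + \<beta>) (Poly_Mapping.lookup f \<alpha> * Poly_Mapping.lookup g \<beta>))"
  for f g :: "'a::comm_monoid_add \<Rightarrow>\<^sub>0 'b::comm_ring_1"
proof -
  have "f * g = (\<Sum>\<alpha>\<in>Poly_Mapping.keys f. Poly_Mapping.single \<alpha> (Poly_Mapping.lookup f \<alpha>)) *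
    (\<Sum>\<beta>\<in>Poly_Mapping.keys g. Poly_Mapping.single \<beta> (Poly_Mapping.lookup g \<beta>))"
    by (simp flip: poly_mapping_sum_singles)
  then show ?thesis by (simp add: sum_product mult_single)
qed

lemma single_sum_prod:
  "Poly_Mapping.single (sum h A) (prod g A) = (\<Prod>x\<in>A. Poly_Mapping.single (h x) (g x :: 'b::comm_ring_1))"
  for h :: "'x \<Rightarrow> 'a::comm_monoid_add"
proof (induction A rule: infinite_finite_induct)
  case (insert x A)
  then show ?case by (simp flip: insert.IH add: mult_single)
qed simp_all

text \<open>Evaluation at fractions, setting variables to zero and reduction to the residue field
  all act term by term, but are multiplicative only under a condition on the terms: nonzero bases,
  no negative exponents at the variables set to zero, integral rescaled coefficients.
  \<open>V\<close> records that condition.\<close>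

locale graded_hom =
  fixes V :: "'a::comm_monoid_add \<Rightarrow> 'b::comm_ring_1 \<Rightarrow> bool"
    and h :: "'a \<Rightarrow> 'b \<Rightarrow> 'c::comm_ring_1"
  assumes V_0: "V \<alpha> 0"
    and V_add: "V \<alpha> a \<Longrightarrow> V \<alpha> b \<Longrightarrow> V \<alpha> (a + b)"
    and V_mult: "V \<alpha> a \<Longrightarrow> V \<beta> b \<Longrightarrow> V (\<alpha> + \<beta>) (a * b)"
    and h_add: "V \<alpha> a \<Longrightarrow> V \<alpha> b \<Longrightarrow> h \<alpha> (a + b) = h \<alpha> a + h \<alpha> b"
    and h_mult: "V \<alpha> a \<Longrightarrow> V \<beta> b \<Longrightarrow> h (\<alpha> + \<beta>) (a * b) = h \<alpha> a * h \<beta> b"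
begin

definition valid :: "('a \<Rightarrow>\<^sub>0 'b) \<Rightarrow> bool" where
  "valid f \<longleftrightarrow> (\<forall>\<alpha>. V \<alpha> (Poly_Mapping.lookup f \<alpha>))"

definition ext :: "('a \<Rightarrow>\<^sub>0 'b) \<Rightarrow> 'c" where
  "ext f = (\<Sum>\<alpha>\<in>Poly_Mapping.keys f. h \<alpha> (Poly_Mapping.lookup f \<alpha>))"

lemma h_0: "h \<alpha> 0 = 0"
  using h_add [OF V_0 V_0, of \<alpha>] by simp

lemma ext_superset:
  assumes "finite A" "Poly_Mapping.keys f \<subseteq> A"
  shows "ext f = (\<Sum>\<alpha>\<in>A. h \<alpha> (Poly_Mapping.lookup f \<alpha>))"
  unfolding ext_def using assms
  by (intro sum.mono_neutral_left) (auto simp: not_in_keys_iff_lookup_eq_zero h_0)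

lemma valid_0: "valid 0" and ext_0: "ext 0 = 0"
  by (simp_all add: valid_def V_0 ext_def)

lemma valid_single: "V \<alpha> a \<Longrightarrow> valid (Poly_Mapping.single \<alpha> a)"
  by (simp add: valid_def lookup_single when_def V_0)

lemma ext_single: "ext (Poly_Mapping.single \<alpha> a) = h \<alpha> a"
  by (simp add: ext_def h_0)

lemma valid_add: "valid f \<Longrightarrow> valid g \<Longrightarrow> valid (f + g)"
  by (simp add: valid_def lookup_add V_add)

lemma ext_add:
  assumes "valid f" "valid g"
  shows "ext (f + g) = ext f + ext g"
proof -
  let ?A = "Poly_Mapping.keys f \<union> Poly_Mapping.keys g"
  have "ext (f + g) = (\<Sum>\<alpha>\<in>?A. h \<alpha> (Poly_Mapping.lookup (f + g) \<alpha>))"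
    using Poly_Mapping.keys_add [of f g] by (intro ext_superset) auto
  also have "\<dots> = (\<Sum>\<alpha>\<in>?A. h \<alpha> (Poly_Mapping.lookup f \<alpha>)) + (\<Sum>\<alpha>\<in>?A. h \<alpha> (Poly_Mapping.lookup g \<alpha>))"
    using assms by (simp add: lookup_add h_add valid_def sum.distrib)
  also have "\<dots> = ext f + ext g"
    using ext_superset [of ?A f] ext_superset [of ?A g] by simp
  finally show ?thesis .
qed

lemma valid_ext_sum:
  assumes "\<And>x. x \<in> A \<Longrightarrow> valid (F x)"
  shows "valid (sum F A) \<and> ext (sum F A) = (\<Sum>x\<in>A. ext (F x))"
  using assms
  by (induction A rule: infinite_finite_induct) (auto simp: valid_0 ext_0 valid_add ext_add)

lemma valid_ext_mult:
  assumes "valid f" "valid g"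
  shows "valid (f * g) \<and> ext (f * g) = ext f * ext g"
proof -
  have V: "V (\<alpha> + \<beta>) (Poly_Mapping.lookup f \<alpha> * Poly_Mapping.lookup g \<beta>)" for \<alpha> \<beta>
    using assms by (simp add: valid_def V_mult)
  let ?F = "\<lambda>\<alpha> \<beta>. Poly_Mapping.single (\<alpha> + \<beta>) (Poly_Mapping.lookup f \<alpha> * Poly_Mapping.lookup g \<beta>)"
  have *: "valid (\<Sum>\<beta>\<in>Poly_Mapping.keys g. ?F \<alpha> \<beta>) \<and>
    ext (\<Sum>\<beta>\<in>Poly_Mapping.keys g. ?F \<alpha> \<beta>) = (\<Sum>\<beta>\<in>Poly_Mapping.keys g. ext (?F \<alpha> \<beta>))" for \<alpha>
    by (rule valid_ext_sum) (rule valid_single [OF V])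
  have "valid (f * g) \<and>
    ext (f * g) = (\<Sum>\<alpha>\<in>Poly_Mapping.keys f. ext (\<Sum>\<beta>\<in>Poly_Mapping.keys g. ?F \<alpha> \<beta>))"
    unfolding poly_mapping_mult_singles [of f g] by (rule valid_ext_sum) (use * in blast)
  moreover have "ext (?F \<alpha> \<beta>) = h \<alpha> (Poly_Mapping.lookup f \<alpha>) * h \<beta> (Poly_Mapping.lookup g \<beta>)" for \<alpha> \<beta>
    unfolding ext_single by (rule h_mult) (use assms in \<open>simp_all add: valid_def\<close>)
  ultimately show ?thesis using * by (simp add: ext_def sum_product)
qed

lemma valid_mult: "valid f \<Longrightarrow> valid g \<Longrightarrow> valid (f * g)"
  and ext_mult: "valid f \<Longrightarrow> valid g \<Longrightarrow> ext (f * g) = ext f * ext g"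
  using valid_ext_mult by blast+

lemma ext_uminus: "valid f \<Longrightarrow> valid (- f) \<Longrightarrow> ext (- f) = - ext f"
  using ext_add [of f "- f"] ext_0 by (simp add: eq_neg_iff_add_eq_0 add.commute)

lemma ext_diff: "valid f \<Longrightarrow> valid g \<Longrightarrow> valid (- g) \<Longrightarrow> ext (f - g) = ext f - ext g"
  using ext_add [of f "- g"] ext_uminus [of g] by simp

end

definition const :: "'k \<Rightarrow> ('a::zero \<Rightarrow>\<^sub>0 'k::zero)" where
  "const c = Poly_Mapping.single 0 c"

lemma const_simps:
  "const (a + b) = const a + const b" "const (a * b) = const a * const b" "const 0 = 0" "const 1 = 1"
  "const (- a) = - const a" "const (a - b) = const a - const b"
  for a b :: "'k::comm_ring_1"
  by (simp_all add: const_def single_add mult_single single_uminus single_diff)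

lemma lookup_const_mult: "Poly_Mapping.lookup (const c * f) \<alpha> = c * Poly_Mapping.lookup f \<alpha>"
  for c :: "'k::comm_ring_1"
  by (simp add: const_def Poly_Mapping.map.rep_eq when_def flip: mult_map_scale_conv_mult)

definition linv :: "nat uprod \<Rightarrow> 'k::comm_ring_1 ulaurent" where
  "linv e = Poly_Mapping.single (Poly_Mapping.single e (-1)) 1"

lemma lvar_linv [simp]: "lvar e * linv e = 1" "linv e * lvar e = 1"
  by (simp_all add: lvar_def linv_def mult_single flip: single_add)

lemma lvar_power: "lvar e ^ m = Poly_Mapping.single (Poly_Mapping.single e (int m)) 1"
  by (induction m) (simp_all add: lvar_def mult_single flip: single_add)

lemma linv_power: "linv e ^ m = Poly_Mapping.single (Poly_Mapping.single e (- int m)) 1"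
  by (induction m) (simp_all add: linv_def mult_single flip: single_add)

lemma single_eq_prod:
  "Poly_Mapping.single \<alpha> c = const c * (\<Prod>e\<in>Poly_Mapping.keys \<alpha>.
     if 0 \<le> Poly_Mapping.lookup \<alpha> e then lvar e ^ nat (Poly_Mapping.lookup \<alpha> e)
     else linv e ^ nat (- Poly_Mapping.lookup \<alpha> e))"
  for c :: "'k::comm_ring_1"
proof -
  have "Poly_Mapping.single \<alpha> (1 :: 'k) =
    (\<Prod>e\<in>Poly_Mapping.keys \<alpha>. Poly_Mapping.single (Poly_Mapping.single e (Poly_Mapping.lookup \<alpha> e)) 1)"
    by (subst poly_mapping_sum_singles [of \<alpha>]) (use single_sum_prod [where g = "\<lambda>_. 1"] in simp)
  also have "\<dots> = (\<Prod>e\<in>Poly_Mapping.keys \<alpha>.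
     if 0 \<le> Poly_Mapping.lookup \<alpha> e then lvar e ^ nat (Poly_Mapping.lookup \<alpha> e)
     else linv e ^ nat (- Poly_Mapping.lookup \<alpha> e))"
    by (intro prod.cong) (auto simp: lvar_power linv_power)
  finally have *: "Poly_Mapping.single \<alpha> (1 :: 'k) = \<dots>" .
  show ?thesis by (simp flip: * add: const_def mult_single)
qed

lemma localized_ring_add: "f \<in> localized_ring S D \<Longrightarrow> g \<in> localized_ring S D \<Longrightarrow> f + g \<in> localized_ring S D"
  using Poly_Mapping.keys_add [of f g] unfolding localized_ring_def by blast

lemma localized_ring_const: "const c \<in> localized_ring S D"
  unfolding localized_ring_def const_def by auto

lemma localized_ring_lvar: "e \<in> S \<Longrightarrow> lvar e \<in> localized_ring S D"
  unfolding localized_ring_def lvar_def by (auto simp: lookup_single when_def)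

lemma localized_ring_linv: "e \<in> S \<Longrightarrow> e \<in> D \<Longrightarrow> linv e \<in> localized_ring S D"
  unfolding localized_ring_def linv_def by (auto simp: lookup_single when_def)

lemma localized_ring_mult:
  assumes "f \<in> localized_ring S D" "g \<in> localized_ring S D"
  shows "f * g \<in> localized_ring S D"
proof -
  have "Poly_Mapping.keys \<alpha> \<subseteq> S \<and> (\<forall>e. Poly_Mapping.lookup \<alpha> e < 0 \<longrightarrow> e \<in> D)"
    if \<alpha>: "\<alpha> \<in> Poly_Mapping.keys (f * g)" for \<alpha>
  proof -
    obtain \<beta> \<gamma> where *: "\<beta> \<in> Poly_Mapping.keys f" "\<gamma> \<in> Poly_Mapping.keys g" "\<alpha> = \<beta> + \<gamma>"
      using \<alpha> Poly_Mapping.keys_mult [of f g] by blast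
    have "\<forall>e. Poly_Mapping.lookup \<alpha> e < 0 \<longrightarrow>
      Poly_Mapping.lookup \<beta> e < 0 \<or> Poly_Mapping.lookup \<gamma> e < 0"
      by (auto simp: * lookup_add)
    moreover have "Poly_Mapping.keys \<beta> \<subseteq> S \<and> (\<forall>e. Poly_Mapping.lookup \<beta> e < 0 \<longrightarrow> e \<in> D)"
      "Poly_Mapping.keys \<gamma> \<subseteq> S \<and> (\<forall>e. Poly_Mapping.lookup \<gamma> e < 0 \<longrightarrow> e \<in> D)"
      using assms *(1,2) by (simp_all add: localized_ring_def)
    moreover have "Poly_Mapping.keys \<alpha> \<subseteq> Poly_Mapping.keys \<beta> \<union> Poly_Mapping.keys \<gamma>"
      unfolding *(3) by (rule Poly_Mapping.keys_add)
    ultimately show ?thesis by blast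
  qed
  then show ?thesis unfolding localized_ring_def by blast
qed

lemma localized_ring_mono: "S \<subseteq> S' \<Longrightarrow> D \<subseteq> D' \<Longrightarrow> localized_ring S D \<subseteq> localized_ring S' D'"
  unfolding localized_ring_def by blast

lemma localized_ring_uminus: "f \<in> localized_ring S D \<Longrightarrow> - f \<in> localized_ring S D"
  using localized_ring_mult [OF localized_ring_const [of "-1"]] by (simp add: const_simps)

lemma localized_ring_diff:
  "f \<in> localized_ring S D \<Longrightarrow> g \<in> localized_ring S D \<Longrightarrow> f - g \<in> localized_ring S D"
  using localized_ring_add [OF _ localized_ring_uminus, of f S D g] by simp

text \<open>The localized ring is generated by constants, variables and admissible inverses.
  Membership of summands and factors is carried along because the maps to be studied are additive
  and multiplicative only inside such rings.\<close>

lemma localized_induct [consumes 1, case_names const lvar linv add mult]: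
  assumes f: "f \<in> localized_ring S D"
    and const: "\<And>c. P (const c)"
    and lvar: "\<And>e. e \<in> S \<Longrightarrow> P (lvar e)"
    and linv: "\<And>e. e \<in> S \<Longrightarrow> e \<in> D \<Longrightarrow> P (linv e)"
    and add: "\<And>f g. f \<in> localized_ring S D \<Longrightarrow> g \<in> localized_ring S D \<Longrightarrow> P f \<Longrightarrow> P g \<Longrightarrow> P (f + g)"
    and mult: "\<And>f g. f \<in> localized_ring S D \<Longrightarrow> g \<in> localized_ring S D \<Longrightarrow> P f \<Longrightarrow> P g \<Longrightarrow> P (f * g)"
  shows "P f"
proof -
  let ?Q = "\<lambda>f. f \<in> localized_ring S D \<and> P f"
  note cl = localized_ring_add localized_ring_mult localized_ring_const
  have 1: "?Q 1" using const [of 1] localized_ring_const [of 1 S D] by (simp add: const_simps)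
  have Q_add: "?Q (a + b)" and Q_mult: "?Q (a * b)" if "?Q a" "?Q b" for a b
    using that cl(1) [of a S D b] cl(2) [of a S D b] add [of a b] mult [of a b] by simp_all
  have pow: "?Q (g ^ m)" if "?Q g" for g m
  proof (induction m)
    case (Suc m)
    then show ?case unfolding power_Suc by (rule Q_mult [OF that])
  qed (use 1 in simp)
  have pr: "?Q (prod F A)" if "\<And>x. x \<in> A \<Longrightarrow> ?Q (F x)" for F :: "nat uprod \<Rightarrow> _" and A
    using that
  proof (induction A rule: infinite_finite_induct)
    case (insert x A)
    have "?Q (F x * prod F A)" using insert by (intro Q_mult) auto
    then show ?case using insert.hyps by simp
  qed (use 1 in simp_all)
  have sm: "?Q (sum F A)" if "\<And>x. x \<in> A \<Longrightarrow> ?Q (F x)" for F :: "(nat uprod \<Rightarrow>\<^sub>0 int) \<Rightarrow> _" and A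
    using that
  proof (induction A rule: infinite_finite_induct)
    case (insert x A)
    have "?Q (F x + sum F A)" using insert by (intro Q_add) auto
    then show ?case using insert.hyps by simp
  qed (use const [of 0] localized_ring_const [of 0 S D] in \<open>simp_all add: const_simps\<close>)
  have lv: "?Q (lvar e)" if "e \<in> S" for e using that lvar [of e] localized_ring_lvar [of e S D] by simp
  have li: "?Q (linv e)" if "e \<in> S" "e \<in> D" for e using that linv [of e] localized_ring_linv [of e S D] by simp
  have sg: "?Q (Poly_Mapping.single \<alpha> c)"
    if a: "Poly_Mapping.keys \<alpha> \<subseteq> S" "\<And>e. Poly_Mapping.lookup \<alpha> e < 0 \<Longrightarrow> e \<in> D" for \<alpha> c
  proof -
    have "?Q (\<Prod>e\<in>Poly_Mapping.keys \<alpha>.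
     if 0 \<le> Poly_Mapping.lookup \<alpha> e then lvar e ^ nat (Poly_Mapping.lookup \<alpha> e)
     else linv e ^ nat (- Poly_Mapping.lookup \<alpha> e))"
    proof (rule pr)
      fix e assume "e \<in> Poly_Mapping.keys \<alpha>"
      then have "e \<in> S" using a(1) by blast
      then show "?Q (if 0 \<le> Poly_Mapping.lookup \<alpha> e then lvar e ^ nat (Poly_Mapping.lookup \<alpha> e)
     else linv e ^ nat (- Poly_Mapping.lookup \<alpha> e))"
        using pow [OF lv] pow [OF li] a(2) by (cases "0 \<le> Poly_Mapping.lookup \<alpha> e") auto
    qed
    moreover have "?Q (const c)" using const [of c] localized_ring_const [of c S D] by simp
    ultimately show ?thesis unfolding single_eq_prod [of \<alpha> c] by (intro Q_mult)
  qed
  have "?Q (\<Sum>\<alpha>\<in>Poly_Mapping.keys f. Poly_Mapping.single \<alpha> (Poly_Mapping.lookup f \<alpha>))"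
    by (intro sm sg) (use f in \<open>auto simp: localized_ring_def\<close>)
  then show ?thesis by (simp flip: poly_mapping_sum_singles)
qed

section \<open>Ideals\<close>

lemma ideal_gen_iff_add:
  assumes A: "0 \<in> A" "\<And>a b. a \<in> A \<Longrightarrow> b \<in> A \<Longrightarrow> a + b \<in> A"
    and "f \<in> ideal_gen A G" "g \<in> ideal_gen A G"
  shows "f + g \<in> ideal_gen A G"
proof -
  obtain F c where F: "f = (\<Sum>x\<in>F. c x * x)" "finite F" "F \<subseteq> G" "c ` F \<subseteq> A"
    using assms(3) unfolding ideal_gen_def by blast
  obtain F' c' where F': "g = (\<Sum>x\<in>F'. c' x * x)" "finite F'" "F' \<subseteq> G" "c' ` F' \<subseteq> A"
    using assms(4) unfolding ideal_gen_def by blast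
  let ?d = "\<lambda>x. if x \<in> F then c x else 0" and ?d' = "\<lambda>x. if x \<in> F' then c' x else 0"
  have "f = (\<Sum>x\<in>F \<union> F'. ?d x * x)" unfolding F(1)
    using F(2) F'(2) by (intro sum.mono_neutral_cong_left) auto
  moreover have "g = (\<Sum>x\<in>F \<union> F'. ?d' x * x)" unfolding F'(1)
    using F(2) F'(2) by (intro sum.mono_neutral_cong_left) auto
  ultimately have "f + g = (\<Sum>x\<in>F \<union> F'. (?d x + ?d' x) * x)"
    by (simp only: sum.distrib distrib_right)
  moreover have "(\<lambda>x. ?d x + ?d' x) ` (F \<union> F') \<subseteq> A"
    using F(4) F'(4) A by (auto simp: image_subset_iff)
  ultimately show ?thesis using F(2,3) F'(2,3) unfolding ideal_gen_def
    by (intro CollectI exI [of _ "F \<union> F'"] exI [of _ "\<lambda>x. ?d x + ?d' x"]) auto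
qed

lemma ideal_gen_mult:
  assumes "\<And>a b. a \<in> A \<Longrightarrow> b \<in> A \<Longrightarrow> a * b \<in> A" "a \<in> A" "f \<in> ideal_gen A G"
  shows "a * f \<in> ideal_gen A G"
proof -
  obtain F c where F: "f = (\<Sum>x\<in>F. c x * x)" "finite F" "F \<subseteq> G" "c ` F \<subseteq> A"
    using assms(3) unfolding ideal_gen_def by blast
  have "a * f = (\<Sum>x\<in>F. (a * c x) * x)" by (simp add: F(1) sum_distrib_left mult.assoc)
  moreover have "(\<lambda>x. a * c x) ` F \<subseteq> A" using F(4) assms by auto
  ultimately show ?thesis using F(2,3) unfolding ideal_gen_def
    by (intro CollectI exI [of _ F] exI [of _ "\<lambda>x. a * c x"]) auto
qed

lemma ideal_gen_0: "0 \<in> ideal_gen A G"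
  unfolding ideal_gen_def by (intro CollectI exI [of _ "{}"]) auto

lemma ideal_gen_generator: "1 \<in> A \<Longrightarrow> g \<in> G \<Longrightarrow> g \<in> ideal_gen A G"
  unfolding ideal_gen_def by (intro CollectI exI [of _ "{g}"] exI [of _ "\<lambda>_. 1"]) auto

lemma ideal_gen_minimal:
  assumes "0 \<in> M" "\<And>a b. a \<in> M \<Longrightarrow> b \<in> M \<Longrightarrow> a + b \<in> M"
    and "\<And>a b. a \<in> A \<Longrightarrow> b \<in> M \<Longrightarrow> a * b \<in> M" "G \<subseteq> M"
  shows "ideal_gen A G \<subseteq> M"
proof
  fix f assume "f \<in> ideal_gen A G"
  then obtain F c where F: "f = (\<Sum>x\<in>F. c x * x)" "finite F" "F \<subseteq> G" "c ` F \<subseteq> A"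
    unfolding ideal_gen_def by blast
  have "(\<Sum>x\<in>F. c x * x) \<in> M" using F(2-4)
  proof (induction F rule: finite_induct)
    case (insert x F)
    then show ?case using assms by auto
  qed (use assms in simp)
  then show "f \<in> M" using F by simp
qed

section \<open>Values of Laurent monomials\<close>

definition monomial_at :: "('e \<Rightarrow> 'b::field) \<Rightarrow> ('e \<Rightarrow>\<^sub>0 int) \<Rightarrow> 'b" where
  "monomial_at v \<alpha> = (\<Prod>e\<in>Poly_Mapping.keys \<alpha>. v e powi Poly_Mapping.lookup \<alpha> e)"

lemma monomial_at_superset:
  assumes "finite A" "Poly_Mapping.keys \<alpha> \<subseteq> A"
  shows "monomial_at v \<alpha> = (\<Prod>e\<in>A. v e powi Poly_Mapping.lookup \<alpha> e)"
  unfolding monomial_at_def using assms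
  by (intro prod.mono_neutral_left) (auto simp: not_in_keys_iff_lookup_eq_zero)

lemma monomial_at_add:
  assumes "\<And>e. e \<in> Poly_Mapping.keys \<alpha> \<union> Poly_Mapping.keys \<beta> \<Longrightarrow> v e \<noteq> 0"
  shows "monomial_at v (\<alpha> + \<beta>) = monomial_at v \<alpha> * monomial_at v \<beta>"
proof -
  let ?A = "Poly_Mapping.keys \<alpha> \<union> Poly_Mapping.keys \<beta>"
  have "monomial_at v (\<alpha> + \<beta>) = (\<Prod>e\<in>?A. v e powi Poly_Mapping.lookup (\<alpha> + \<beta>) e)"
    using Poly_Mapping.keys_add [of \<alpha> \<beta>] by (intro monomial_at_superset) auto
  also have "\<dots> = (\<Prod>e\<in>?A. v e powi Poly_Mapping.lookup \<alpha> e) * (\<Prod>e\<in>?A. v e powi Poly_Mapping.lookup \<beta> e)"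
    using assms by (simp add: lookup_add power_int_add prod.distrib)
  also have "\<dots> = monomial_at v \<alpha> * monomial_at v \<beta>"
    using monomial_at_superset [of ?A \<alpha> v] monomial_at_superset [of ?A \<beta> v] by simp
  finally show ?thesis .
qed

lemma monomial_at_0 [simp]: "monomial_at v 0 = 1"
  by (simp add: monomial_at_def)

lemma monomial_at_single [simp]: "monomial_at v (Poly_Mapping.single e m) = v e powi m"
  by (simp add: monomial_at_def)

section \<open>Polynomial substitution\<close>

definition poly_subst :: "('k \<Rightarrow> 'b) \<Rightarrow> (nat uprod \<Rightarrow> 'b) \<Rightarrow> 'k::comm_ring_1 upoly \<Rightarrow> 'b::comm_ring_1" where
  "poly_subst c v f = (\<Sum>\<alpha>\<in>Poly_Mapping.keys f. c (Poly_Mapping.lookup f \<alpha>) *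
     (\<Prod>e\<in>Poly_Mapping.keys \<alpha>. v e ^ Poly_Mapping.lookup \<alpha> e))"

locale upoly_hom =
  fixes \<theta> :: "'k::comm_ring_1 upoly \<Rightarrow> 'b::comm_ring_1"
  assumes hom_add: "\<theta> (f + g) = \<theta> f + \<theta> g"
    and hom_mult: "\<theta> (f * g) = \<theta> f * \<theta> g"
    and hom_1: "\<theta> 1 = 1"
begin

lemma hom_0: "\<theta> 0 = 0"
  using hom_add [of 0 0] by simp

lemma hom_uminus: "\<theta> (- f) = - \<theta> f"
  using hom_add [of f "- f"] hom_0 by (simp add: eq_neg_iff_add_eq_0 add.commute)

lemma hom_diff: "\<theta> (f - g) = \<theta> f - \<theta> g"
  using hom_add [of f "- g"] by (simp add: hom_uminus)

lemma hom_power: "\<theta> (f ^ m) = \<theta> f ^ m"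
  by (induction m) (simp_all add: hom_1 hom_mult)

lemma hom_prod: "\<theta> (prod F A) = (\<Prod>x\<in>A. \<theta> (F x))"
  by (induction A rule: infinite_finite_induct) (simp_all add: hom_1 hom_mult)

lemma hom_pair_sign: "\<theta> (const (pair_sign k l)) = pair_sign k l"
  by (simp add: pair_sign_def const_simps hom_1 hom_uminus)

end

lemma prod_superset_power:
  fixes v :: "'e \<Rightarrow> 'b::comm_ring_1"
  assumes "finite A" "Poly_Mapping.keys \<alpha> \<subseteq> A"
  shows "(\<Prod>e\<in>Poly_Mapping.keys \<alpha>. v e ^ Poly_Mapping.lookup \<alpha> e) = (\<Prod>e\<in>A. v e ^ Poly_Mapping.lookup \<alpha> e)"
  using assms by (intro prod.mono_neutral_left) (auto simp: not_in_keys_iff_lookup_eq_zero)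

context
  fixes c :: "'k::comm_ring_1 \<Rightarrow> 'b::comm_ring_1" and v :: "nat uprod \<Rightarrow> 'b"
  assumes c_add: "\<And>a b. c (a + b) = c a + c b" and c_mult: "\<And>a b. c (a * b) = c a * c b"
    and c_1: "c 1 = 1"
begin

lemma graded_hom_poly_subst:
  "graded_hom (\<lambda>_ _. True) (\<lambda>\<alpha> a. c a * (\<Prod>e\<in>Poly_Mapping.keys \<alpha>. v e ^ Poly_Mapping.lookup \<alpha> e))"
proof
  fix \<alpha> \<beta> :: "nat uprod \<Rightarrow>\<^sub>0 nat" and a b :: 'k
  let ?m = "\<lambda>\<alpha>. \<Prod>e\<in>Poly_Mapping.keys \<alpha>. v e ^ Poly_Mapping.lookup \<alpha> e"
  show "c (a + b) * ?m \<alpha> = c a * ?m \<alpha> + c b * ?m \<alpha>" by (simp add: c_add distrib_right)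
  let ?A = "Poly_Mapping.keys \<alpha> \<union> Poly_Mapping.keys \<beta>"
  have "?m (\<alpha> + \<beta>) = (\<Prod>e\<in>?A. v e ^ Poly_Mapping.lookup (\<alpha> + \<beta>) e)"
    using Poly_Mapping.keys_add [of \<alpha> \<beta>] by (intro prod_superset_power) auto
  also have "\<dots> = (\<Prod>e\<in>?A. v e ^ Poly_Mapping.lookup \<alpha> e) * (\<Prod>e\<in>?A. v e ^ Poly_Mapping.lookup \<beta> e)"
    by (simp add: lookup_add power_add prod.distrib)
  also have "\<dots> = ?m \<alpha> * ?m \<beta>"
    using prod_superset_power [of ?A \<alpha> v] prod_superset_power [of ?A \<beta> v] by simp
  finally show "c (a * b) * ?m (\<alpha> + \<beta>) = c a * ?m \<alpha> * (c b * ?m \<beta>)" by (simp add: c_mult mult_ac)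
qed auto

lemma upoly_hom_poly_subst: "upoly_hom (poly_subst c v)"
proof -
  interpret S: graded_hom "\<lambda>_ _. True"
    "\<lambda>\<alpha> a. c a * (\<Prod>e\<in>Poly_Mapping.keys \<alpha>. v e ^ Poly_Mapping.lookup \<alpha> e)"
    by (rule graded_hom_poly_subst)
  have S: "poly_subst c v f = S.ext f" for f by (simp add: poly_subst_def S.ext_def)
  have V: "S.valid f" for f by (simp add: S.valid_def)
  show ?thesis
  proof
    show "poly_subst c v 1 = 1" by (simp add: poly_subst_def c_1)
  qed (simp_all add: S S.ext_add S.ext_mult V)
qed

lemma c_0: "c 0 = 0"
  using c_add [of 0 0] by simp

lemma poly_subst_const: "poly_subst c v (const a) = c a"
  by (simp add: poly_subst_def const_def c_0)

lemma poly_subst_uvar: "poly_subst c v (uvar e) = v e"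
  by (simp add: poly_subst_def uvar_def c_0 c_1)

end

section \<open>Signed Pluecker coordinates\<close>

lemma pair_sign_swap: "k \<noteq> l \<Longrightarrow> pair_sign l k = - pair_sign k l"
  by (simp add: pair_sign_def)

lemma pair_sign_square [simp]: "pair_sign k l * pair_sign k l = 1" "pair_sign k l * (pair_sign k l * a) = a"
  by (simp_all add: pair_sign_def)

lemma const_pair_sign: "const (pair_sign k l) = pair_sign k l"
  by (simp add: pair_sign_def const_simps)

text \<open>The first row of the 2 x n matrix whose columns \<open>i\<close> and \<open>j\<close>
  are the unit vectors; the sign makes the minor of the columns \<open>j\<close>, \<open>k\<close>
  equal to u_jk instead of its negative.\<close>

definition col_A :: "nat \<Rightarrow> nat \<Rightarrow> nat \<Rightarrow> 'k::comm_ring_1 upoly" where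
  "col_A i j k = (if k = i then 1 else if k = j then 0 else - oriented_var j k)"

definition col_B :: "nat \<Rightarrow> nat \<Rightarrow> nat \<Rightarrow> 'k::comm_ring_1 upoly" where
  "col_B i j k = (if k = i then 0 else if k = j then 1 else oriented_var i k)"

lemma oriented_var_eq: "oriented_var k l = pair_sign k l * uvar (Upair k l)"
  by (simp add: oriented_var_def const_pair_sign flip: const_def)

text \<open>In the chart, the Pluecker coordinates are the minors of the matrix with columns
  \<open>(col_A i j k, col_B i j k)\<close>; all three-term relations follow from this.\<close>

lemma chart_coord_minor:
  assumes "i \<noteq> j" "k \<noteq> l"
  shows "chart_coord i j (Upair k l) =
    pair_sign k l * (col_A i j k * col_B i j l - col_A i j l * col_B i j k)"
proof -
  have *: "chart_coord i j (Upair k l) =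
    pair_sign k l * (col_A i j k * col_B i j l - col_A i j l * col_B i j k)" if "k < l" for k l
  proof -
    have mm: "min k l = k" "max k l = l" "pair_sign k l = 1" using that by (auto simp: pair_sign_def)
    consider "k = i" "l = j" | "k = j" "l = i" | "k = i" "l \<noteq> j" | "k = j" "l \<noteq> i" | "l = i" "k \<noteq> j"
      | "l = j" "k \<noteq> i" | "k \<notin> {i, j}" "l \<notin> {i, j}" by blast
    then show ?thesis
    proof cases
      case 7
      then show ?thesis using that
        by (auto simp: chart_coord_def col_A_def col_B_def mm Let_def algebra_simps)
    qed (use that assms(1) in \<open>auto simp: chart_coord_def col_A_def col_B_def mm oriented_var_eq
      pair_sign_def const_simps simp flip: const_def intro!: arg_cong [where f = uvar]\<close>)
  qed
  show ?thesis
  proof (cases "k < l")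
    case False
    then have lk: "l < k" using assms by simp
    have "chart_coord i j (Upair k l) = chart_coord i j (Upair l k)"
      by (rule arg_cong) simp
    also note * [OF lk]
    finally show ?thesis unfolding pair_sign_swap [OF assms(2)] by (simp add: algebra_simps)
  qed (rule *)
qed

lemma pairsE:
  assumes "e \<in> pairs n"
  obtains k l where "e = Upair k l" "k \<in> {1..n}" "l \<in> {1..n}" "k \<noteq> l"
  using assms unfolding pairs_def by blast

lemma in_pairs_iff [simp]: "Upair k l \<in> pairs n \<longleftrightarrow> k \<in> {1..n} \<and> l \<in> {1..n} \<and> k \<noteq> l"
  unfolding pairs_def by auto

lemma finite_pairs: "finite (pairs n)"
proof -
  have "pairs n \<subseteq> (\<lambda>(k, l). Upair k l) ` ({1..n} \<times> {1..n})" unfolding pairs_def by auto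
  then show ?thesis by (rule finite_subset) simp
qed

text \<open>Nonvanishing is seen at points. For a pair disjoint from {i, j}, the point with u_ik and
  u_jl equal to 1 up to sign and all other variables 0 leaves exactly one of the two products of the
  minor.\<close>

lemma chart_coord_nonzero:
  assumes "i \<noteq> j" "e \<in> pairs n"
  shows "(chart_coord i j e :: 'k::field upoly) \<noteq> 0"
proof -
  obtain k l where e: "e = Upair k l" "k \<noteq> l" using pairsE [OF assms(2)] by metis
  define v :: "nat uprod \<Rightarrow> 'k" where "v = (\<lambda>f. if f = Upair i k \<or> f = Upair j l then 1 else 0)"
  define w :: "nat uprod \<Rightarrow> 'k" where "w = (\<lambda>f. if f = e then 1 else 0)"
  interpret v: upoly_hom "poly_subst id v" by (rule upoly_hom_poly_subst) auto
  have [simp]: "poly_subst id v (uvar f) = v f" and w: "poly_subst id w (uvar f) = w f" for f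
    by (rule poly_subst_uvar; simp)+
  show ?thesis
  proof (cases "k \<in> {i, j} \<or> l \<in> {i, j}")
    case True
    then show ?thesis
    proof (cases "e = Upair i j")
      case False
      have "w e \<noteq> 0" by (simp add: w_def)
      then have "poly_subst id w (uvar e) \<noteq> 0" unfolding w .
      then have "uvar e \<noteq> (0 :: 'k upoly)" by (auto simp: poly_subst_def)
      then show ?thesis using True False by (auto simp: chart_coord_def e)
    qed (simp add: chart_coord_def pair_sign_def single_uminus)
  next
    case False
    have v: "v (Upair i k) = 1" "v (Upair j l) = 1" "v (Upair i l) = 0" "v (Upair j k) = 0"
      using False assms(1) e(2) by (auto simp: v_def)
    have "poly_subst id v (chart_coord i j e) = pair_sign k l * (pair_sign i k * pair_sign j l)"
      unfolding e chart_coord_minor [OF assms(1) e(2)] using False assms(1) e(2)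
      by (auto simp: col_A_def col_B_def v.hom_mult v.hom_diff v.hom_uminus oriented_var_eq
        v.hom_pair_sign [unfolded const_pair_sign] v)
    also have "\<dots> \<noteq> 0" by (simp add: pair_sign_def)
    finally show ?thesis using v.hom_0 by auto
  qed
qed

section \<open>Evaluation in the function field\<close>

lemma fract_simps:
  "Fract (f + g) (1 :: 'a::idom) = Fract f 1 + Fract g 1" "Fract (f * g) (1 :: 'a) = Fract f 1 * Fract g 1"
  "Fract 0 (1 :: 'a) = 0" "Fract 1 (1 :: 'a) = 1" "Fract (- f) (1 :: 'a) = - Fract f 1"
  "Fract (f - g) (1 :: 'a) = Fract f 1 - Fract g 1"
  by (simp_all add: Zero_fract_def One_fract_def)

lemma fract_eq_0_iff: "Fract f (1 :: 'a::idom) = 0 \<longleftrightarrow> f = 0"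
  by (simp add: Zero_fract_def eq_fract)

context
  fixes i j :: nat
begin

abbreviation (input) frac_term :: "(nat uprod \<Rightarrow>\<^sub>0 int) \<Rightarrow> 'k::field \<Rightarrow> 'k upoly fract" where
  "frac_term \<alpha> a \<equiv> Fract (Poly_Mapping.single 0 a) 1 * monomial_at (\<lambda>e. Fract (chart_coord i j e) 1) \<alpha>"

interpretation frac: graded_hom
  "\<lambda>\<alpha> a. a = 0 \<or> (\<forall>e\<in>Poly_Mapping.keys \<alpha>. chart_coord i j e \<noteq> (0 :: 'k::field upoly))"
  "frac_term :: _ \<Rightarrow> 'k \<Rightarrow> _"
proof
  fix \<alpha> \<beta> :: "nat uprod \<Rightarrow>\<^sub>0 int" and a b :: 'k
  show "frac_term \<alpha> (a + b) = frac_term \<alpha> a + frac_term \<alpha> b"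
    by (simp only: single_add fract_simps(1) distrib_right)
  assume 1: "a = 0 \<or> (\<forall>e\<in>Poly_Mapping.keys \<alpha>. chart_coord i j e \<noteq> (0 :: 'k upoly))"
    "b = 0 \<or> (\<forall>e\<in>Poly_Mapping.keys \<beta>. chart_coord i j e \<noteq> (0 :: 'k upoly))"
  then show "a * b = 0 \<or> (\<forall>e\<in>Poly_Mapping.keys (\<alpha> + \<beta>). chart_coord i j e \<noteq> (0 :: 'k upoly))"
    using Poly_Mapping.keys_add [of \<alpha> \<beta>] by auto
  show "frac_term (\<alpha> + \<beta>) (a * b) = frac_term \<alpha> a * frac_term \<beta> b"
  proof (cases "a = 0 \<or> b = 0")
    case True
    then show ?thesis by (auto simp: fract_simps(3))
  next
    case False
    then have "monomial_at (\<lambda>e. Fract (chart_coord i j e :: 'k upoly) 1) (\<alpha> + \<beta>) =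
      monomial_at (\<lambda>e. Fract (chart_coord i j e) 1) \<alpha> * monomial_at (\<lambda>e. Fract (chart_coord i j e) 1) \<beta>"
      using 1 by (intro monomial_at_add) (auto simp: fract_eq_0_iff)
    moreover have "Poly_Mapping.single 0 (a * b) = (Poly_Mapping.single 0 a * Poly_Mapping.single 0 b :: 'k upoly)"
      by (simp add: mult_single)
    ultimately show ?thesis by (simp only: fract_simps(2) mult_ac)
  qed
qed auto

lemma frac_eval_ext: "frac_eval i j f = frac.ext f"
  by (simp add: frac_eval_def frac.ext_def flip: monomial_at_def)

lemma frac_eval_valid:
  fixes f :: "'k::field ulaurent"
  assumes "i \<noteq> j" "f \<in> localized_ring (pairs n) D"
  shows "frac.valid f"
  unfolding frac.valid_def
proof
  fix \<alpha>
  show "Poly_Mapping.lookup f \<alpha> = 0 \<or> (\<forall>e\<in>Poly_Mapping.keys \<alpha>. chart_coord i j e \<noteq> (0 :: 'k upoly))"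
  proof (cases "\<alpha> \<in> Poly_Mapping.keys f")
    case True
    then have "Poly_Mapping.keys \<alpha> \<subseteq> pairs n" using assms(2) by (simp add: localized_ring_def)
    then show ?thesis using chart_coord_nonzero [OF assms(1)] by blast
  qed (simp add: in_keys_iff)
qed

lemma frac_eval_add:
  assumes "i \<noteq> j" "f \<in> localized_ring (pairs n) D" "g \<in> localized_ring (pairs n) D"
  shows "frac_eval i j (f + g) = frac_eval i j f + frac_eval i j g"
  unfolding frac_eval_ext using frac_eval_valid assms by (intro frac.ext_add)

lemma frac_eval_mult:
  assumes "i \<noteq> j" "f \<in> localized_ring (pairs n) D" "g \<in> localized_ring (pairs n) D"
  shows "frac_eval i j (f * g) = frac_eval i j f * frac_eval i j g"
  unfolding frac_eval_ext using frac_eval_valid assms by (intro frac.ext_mult)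

lemma frac_eval_const: "frac_eval i j (const c) = Fract (const c) 1"
  unfolding frac_eval_ext const_def frac.ext_single by (simp add: One_fract_def)

lemma frac_eval_lvar: "frac_eval i j (lvar e) = Fract (chart_coord i j e) 1"
  unfolding frac_eval_ext lvar_def frac.ext_single by (simp add: fract_simps(4))

lemma frac_eval_linv: "frac_eval i j (linv e) = Fract 1 (chart_coord i j e)"
  unfolding frac_eval_ext linv_def frac.ext_single by (simp add: fract_simps(4) power_int_minus)

end

section \<open>Setting variables to zero\<close>

context
  fixes Z :: "nat uprod set"
begin

interpretation sz: graded_hom "\<lambda>(\<alpha> :: nat uprod \<Rightarrow>\<^sub>0 int) (a :: 'k::comm_ring_1). a = 0 \<or> (\<forall>e\<in>Z. 0 \<le> Poly_Mapping.lookup \<alpha> e)"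
  "\<lambda>\<alpha> a. if Poly_Mapping.keys \<alpha> \<inter> Z = {} then Poly_Mapping.single \<alpha> a else 0"
proof
  fix \<alpha> \<beta> :: "nat uprod \<Rightarrow>\<^sub>0 int" and a b :: 'k
  assume 1: "a = 0 \<or> (\<forall>e\<in>Z. 0 \<le> Poly_Mapping.lookup \<alpha> e)" "b = 0 \<or> (\<forall>e\<in>Z. 0 \<le> Poly_Mapping.lookup \<beta> e)"
  then show "a * b = 0 \<or> (\<forall>e\<in>Z. 0 \<le> Poly_Mapping.lookup (\<alpha> + \<beta>) e)"
    by (auto simp: lookup_add)
  show "(if Poly_Mapping.keys (\<alpha> + \<beta>) \<inter> Z = {} then Poly_Mapping.single (\<alpha> + \<beta>) (a * b) else 0) =
    (if Poly_Mapping.keys \<alpha> \<inter> Z = {} then Poly_Mapping.single \<alpha> a else 0) *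
    (if Poly_Mapping.keys \<beta> \<inter> Z = {} then Poly_Mapping.single \<beta> b else 0)"
  proof (cases "a = 0 \<or> b = 0")
    case False
    then have nn: "0 \<le> Poly_Mapping.lookup \<alpha> e" "0 \<le> Poly_Mapping.lookup \<beta> e" if "e \<in> Z" for e
      using 1 that by auto
    have "Poly_Mapping.lookup (\<alpha> + \<beta>) e = 0 \<longleftrightarrow> Poly_Mapping.lookup \<alpha> e = 0 \<and> Poly_Mapping.lookup \<beta> e = 0"
      if "e \<in> Z" for e using nn [OF that] by (simp add: lookup_add add_nonneg_eq_0_iff)
    then have "Poly_Mapping.keys (\<alpha> + \<beta>) \<inter> Z = {} \<longleftrightarrow>
      Poly_Mapping.keys \<alpha> \<inter> Z = {} \<and> Poly_Mapping.keys \<beta> \<inter> Z = {}"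
      by (auto simp: disjoint_iff in_keys_iff)
    then show ?thesis by (auto simp: mult_single)
  qed auto
qed (auto simp: single_add)

lemma set_zero_ext: "set_zero Z f = sz.ext f"
  unfolding set_zero_def sz.ext_def
  by (subst sum.inter_filter) auto

lemma set_zero_valid:
  assumes "f \<in> localized_ring S D" "D \<inter> Z = {}"
  shows "sz.valid f"
  unfolding sz.valid_def
proof
  fix \<alpha>
  show "Poly_Mapping.lookup f \<alpha> = 0 \<or> (\<forall>e\<in>Z. 0 \<le> Poly_Mapping.lookup \<alpha> e)"
  proof (cases "\<alpha> \<in> Poly_Mapping.keys f")
    case True
    then have "\<forall>e. Poly_Mapping.lookup \<alpha> e < 0 \<longrightarrow> e \<in> D" using assms(1) by (simp add: localized_ring_def)
    then show ?thesis using assms(2) by (meson disjoint_iff not_less)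
  qed (simp add: in_keys_iff)
qed

lemma set_zero_add:
  assumes "D \<inter> Z = {}" "f \<in> localized_ring S D" "g \<in> localized_ring S D"
  shows "set_zero Z (f + g) = set_zero Z f + set_zero Z g"
  unfolding set_zero_ext using set_zero_valid assms by (intro sz.ext_add)

lemma set_zero_mult:
  assumes "D \<inter> Z = {}" "f \<in> localized_ring S D" "g \<in> localized_ring S D"
  shows "set_zero Z (f * g) = set_zero Z f * set_zero Z g"
  unfolding set_zero_ext using set_zero_valid assms by (intro sz.ext_mult)

lemma set_zero_const: "set_zero Z (const c) = const c"
  unfolding set_zero_ext const_def sz.ext_single by simp

lemma set_zero_lvar: "set_zero Z (lvar e) = (if e \<in> Z then 0 else lvar e)"
  unfolding set_zero_ext lvar_def sz.ext_single by simp

lemma set_zero_linv: "set_zero Z (linv e) = (if e \<in> Z then 0 else linv e)"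
  unfolding set_zero_ext linv_def sz.ext_single by simp

lemma set_zero_localized: "f \<in> localized_ring S D \<Longrightarrow> set_zero Z f \<in> localized_ring (S - Z) D"
proof -
  assume f: "f \<in> localized_ring S D"
  have "Poly_Mapping.keys (set_zero Z f) \<subseteq> {\<alpha> \<in> Poly_Mapping.keys f. Poly_Mapping.keys \<alpha> \<inter> Z = {}}"
    unfolding set_zero_def by (rule order.trans [OF keys_sum]) (auto split: if_splits)
  then show ?thesis using f unfolding localized_ring_def by fast
qed

end

section \<open>Coordinates of the chart in terms of a compatible index set\<close>

text \<open>Signed variables are antisymmetric like the p_kl, so Pluecker relations need no case
  distinction on the order of the indices.\<close>

definition lv :: "nat \<Rightarrow> nat \<Rightarrow> 'k::comm_ring_1 ulaurent" where
  "lv k l = pair_sign k l * lvar (Upair k l)"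

definition lvi :: "nat \<Rightarrow> nat \<Rightarrow> 'k::comm_ring_1 ulaurent" where
  "lvi k l = pair_sign k l * linv (Upair k l)"

lemma lv_lvi [simp]: "lv k l * lvi k l = 1" "lvi k l * lv k l = 1"
  by (auto simp: lv_def lvi_def pair_sign_def)

lemma lv_swap: "k \<noteq> l \<Longrightarrow> lv l k = - lv k l"
proof -
  assume kl: "k \<noteq> l"
  have U: "Upair l k = Upair k l" by simp
  show ?thesis unfolding lv_def pair_sign_swap [OF kl] U by simp
qed

lemma localized_ring_pair_sign: "pair_sign k l \<in> localized_ring S D"
  using localized_ring_const [of "pair_sign k l" S D] by (simp add: const_pair_sign)

lemma localized_ring_1: "1 \<in> localized_ring S D" and localized_ring_0: "0 \<in> localized_ring S D"
  using localized_ring_const [of 1 S D] localized_ring_const [of 0 S D] by (simp_all add: const_simps)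

lemma localized_ring_lv: "Upair k l \<in> S \<Longrightarrow> lv k l \<in> localized_ring S D"
  unfolding lv_def by (intro localized_ring_mult localized_ring_pair_sign localized_ring_lvar)

lemma localized_ring_lvi: "Upair k l \<in> S \<Longrightarrow> Upair k l \<in> D \<Longrightarrow> lvi k l \<in> localized_ring S D"
  unfolding lvi_def by (intro localized_ring_mult localized_ring_pair_sign localized_ring_linv)

lemmas localized_ring_intros = localized_ring_mult localized_ring_add localized_ring_diff
  localized_ring_uminus localized_ring_1 localized_ring_0 localized_ring_pair_sign

text \<open>The tree and the order enter the algebra only through \<open>pred\<close> and
  \<open>rk\<close>. When ak is missing from \<open>I\<close>, all that is needed to solve the
  relation of i, j, k, \<open>pred k\<close> for u_ak is at hand, with an invertible denominator,
  and the rank makes the recursion end. \<open>I_cases\<close> says that \<open>I\<close> contains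
  no pairs besides those of the chart and those used in these relations.\<close>

locale pluecker_basis =
  fixes n i j :: nat and J I :: "nat uprod set" and pred rk :: "nat \<Rightarrow> nat"
  assumes ij: "i \<in> {1..n}" "j \<in> {1..n}" "i \<noteq> j"
    and J: "J \<subseteq> pairs n" "Upair i j \<notin> J"
    and I: "I \<subseteq> pairs n" "Upair i j \<notin> I"
    and pred: "k \<in> {1..n} - {i, j} \<Longrightarrow> {a, b} = {i, j} \<Longrightarrow> Upair a k \<notin> I \<Longrightarrow>
      pred k \<in> {1..n} - {i, j} \<and> rk (pred k) < rk k \<and> Upair b k \<in> I \<and> Upair b (pred k) \<in> I \<and>
      Upair b (pred k) \<notin> J \<and> Upair k (pred k) \<in> I"
    and I_cases: "e \<in> I \<Longrightarrow> e \<in> chart_pairs n i j \<or>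
      (\<exists>k a b. k \<in> {1..n} - {i, j} \<and> {a, b} = {i, j} \<and> Upair a k \<notin> I \<and> e = Upair k (pred k))"
begin

abbreviation "L \<equiv> {1..n} - {i, j}"
abbreviation "D \<equiv> I \<inter> chart_pairs n i j - J"

definition other :: "nat \<Rightarrow> nat" where
  "other a = (if a = i then j else i)"

lemma other: "a \<in> {i, j} \<Longrightarrow> {a, other a} = {i, j}"
  using ij by (auto simp: other_def)

text \<open>The value of p_ab / p_ij for b = \<open>other a\<close>.\<close>

definition sgn_end :: "nat \<Rightarrow> 'b::comm_ring_1" where
  "sgn_end a = (if a = i then 1 else - 1)"

text \<open>For \<open>ak \<notin> I\<close> this solves the Pluecker relation of \<open>i, j, k, pred k\<close> for \<open>u_ak\<close>.\<close>

function phi :: "nat \<Rightarrow> nat \<Rightarrow> 'k::field ulaurent" where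
  "phi a k = (if Upair a k \<in> I \<or> \<not> rk (pred k) < rk k then lv a k
    else (sgn_end a * lv k (pred k) + phi a (pred k) * lv (other a) k) * lvi (other a) (pred k))"
  by auto
termination
  by (relation "Wellfounded.measure (\<lambda>(a, k). rk k)") auto

declare phi.simps [simp del]

lemma phi_in: "Upair a k \<in> I \<Longrightarrow> phi a k = lv a k"
  by (simp add: phi.simps)

text \<open>The rank test in \<open>phi\<close> serves termination; under the locale assumptions it
  always succeeds when ak is missing from \<open>I\<close>.\<close>

lemma phi_notin:
  assumes "k \<in> L" "a \<in> {i, j}" "Upair a k \<notin> I"
  shows "phi a k = (sgn_end a * lv k (pred k) + phi a (pred k) * lv (other a) k) * lvi (other a) (pred k)"
  using pred [OF assms(1) other [OF assms(2)] assms(3)] assms(3) by (subst phi.simps) simp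

lemma phi_induct [consumes 2, case_names inI notinI]:
  assumes "k \<in> L" "a \<in> {i, j}"
    and "\<And>k a. k \<in> L \<Longrightarrow> a \<in> {i, j} \<Longrightarrow> Upair a k \<in> I \<Longrightarrow> P k a"
    and "\<And>k a. k \<in> L \<Longrightarrow> a \<in> {i, j} \<Longrightarrow> Upair a k \<notin> I \<Longrightarrow> pred k \<in> L \<Longrightarrow>
      Upair (other a) k \<in> I \<Longrightarrow> Upair (other a) (pred k) \<in> I \<Longrightarrow> Upair (other a) (pred k) \<notin> J \<Longrightarrow>
      Upair k (pred k) \<in> I \<Longrightarrow> P (pred k) a \<Longrightarrow> P k a"
  shows "P k a"
  using assms(1,2)
proof (induction "rk k" arbitrary: k rule: less_induct)
  case less
  show ?case
  proof (cases "Upair a k \<in> I")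
    case True
    then show ?thesis using assms(3) less by blast
  next
    case False
    note p = pred [OF less.prems(1) other [OF less.prems(2)] False]
    then have "P (pred k) a" using less by blast
    then show ?thesis using assms(4) [OF less.prems False] p by blast
  qed
qed

lemma chart_pair: "a \<in> {i, j} \<Longrightarrow> k \<in> L \<Longrightarrow> Upair a k \<in> chart_pairs n i j"
  using ij by (auto simp: chart_pairs_def)

text \<open>The denominators that occur are chart coordinates of the form u_b,pred k, which lie in
  \<open>I\<close> and outside \<open>J\<close>.\<close>

lemma phi_localized:
  assumes "k \<in> L" "a \<in> {i, j}"
  shows "phi a k \<in> localized_ring I D"
  using assms
proof (induction rule: phi_induct)
  case (inI k a)
  then show ?case by (simp add: phi_in localized_ring_lv)
next
  case (notinI k a)
  have "other a \<in> {i, j}" by (simp add: other_def)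
  then have "Upair (other a) (pred k) \<in> D" using notinI chart_pair by blast
  moreover have "sgn_end a \<in> localized_ring I D"
    unfolding sgn_end_def by (auto intro: localized_ring_intros)
  ultimately show ?case unfolding phi_notin [OF notinI(1-3)]
    using notinI by (intro localized_ring_intros localized_ring_lv localized_ring_lvi) auto
qed

lemma localized_ring_pairs: "localized_ring I D \<subseteq> localized_ring (pairs n) (pairs n)"
  using I by (intro localized_ring_mono) auto

lemmas ev_add = frac_eval_add [OF ij(3), where n = n and D = "pairs n"]
lemmas ev_mult = frac_eval_mult [OF ij(3), where n = n and D = "pairs n"]

lemma ev_1: "frac_eval i j 1 = 1" and ev_0: "frac_eval i j 0 = 0"
  using frac_eval_const [of i j 1] frac_eval_const [of i j 0] by (simp_all add: const_simps fract_simps(3,4))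

lemma ev_uminus: "f \<in> localized_ring (pairs n) (pairs n) \<Longrightarrow> frac_eval i j (- f) = - frac_eval i j f"
proof -
  assume f: "f \<in> localized_ring (pairs n) (pairs n)"
  have "frac_eval i j (f + - f) = frac_eval i j f + frac_eval i j (- f)"
    using f by (intro ev_add localized_ring_uminus)
  then have "frac_eval i j f + frac_eval i j (- f) = 0" by (simp add: ev_0)
  then show ?thesis by (rule minus_unique [symmetric])
qed

lemma ev_diff:
  assumes "f \<in> localized_ring (pairs n) (pairs n)" "g \<in> localized_ring (pairs n) (pairs n)"
  shows "frac_eval i j (f - g) = frac_eval i j f - frac_eval i j g"
  using ev_add [OF assms(1) localized_ring_uminus [OF assms(2)]] ev_uminus [OF assms(2)] by simp

lemma ev_pair_sign: "frac_eval i j (pair_sign k l) = pair_sign k l"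
  by (simp add: pair_sign_def ev_1 ev_uminus localized_ring_1)

lemma fract_pair_sign: "Fract (pair_sign k l) 1 = pair_sign k l"
  by (simp add: pair_sign_def fract_simps(4,5))

text \<open>The class of \<open>p_kl / p_ij\<close>, with its sign, in the fraction field.\<close>

definition pl :: "nat \<Rightarrow> nat \<Rightarrow> 'k::field upoly fract" where
  "pl k l = Fract (col_A i j k) 1 * Fract (col_B i j l) 1 - Fract (col_A i j l) 1 * Fract (col_B i j k) 1"

lemma pl_pluecker: "pl a b * pl c d = pl a c * pl b d - pl a d * pl b c"
  by (simp add: pl_def algebra_simps)

lemma pl_chart: "k \<noteq> l \<Longrightarrow> Fract (chart_coord i j (Upair k l)) 1 = pair_sign k l * pl k l"
  unfolding chart_coord_minor [OF ij(3)] pl_def by (simp only: fract_simps fract_pair_sign)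

lemma pl_ij: "pl i j = 1" "pl j i = - 1"
  using ij(3) by (simp_all add: pl_def col_A_def col_B_def fract_simps(3,4))

lemma pl_swap: "pl l k = - pl k l" by (simp add: pl_def)

lemma pl_nonzero:
  assumes "k \<in> {1..n}" "l \<in> {1..n}" "k \<noteq> l" shows "pl k l \<noteq> (0 :: 'k::field upoly fract)"
  using pl_chart [OF assms(3), where 'a = 'k] chart_coord_nonzero [OF ij(3), of "Upair k l" n, where 'k = 'k] assms
  by (auto simp: fract_eq_0_iff)

lemma ev_lv:
  assumes "k \<in> {1..n}" "l \<in> {1..n}" "k \<noteq> l" shows "frac_eval i j (lv k l) = pl k l"
  using assms unfolding lv_def
  by (subst ev_mult) (auto intro: localized_ring_lvar localized_ring_pair_sign
    simp: frac_eval_lvar ev_pair_sign pl_chart)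

lemma ev_lvi:
  assumes "k \<in> {1..n}" "l \<in> {1..n}" "k \<noteq> l" shows "frac_eval i j (lvi k l) = (inverse (pl k l) :: 'k::field upoly fract)"
proof -
  have "frac_eval i j (lv k l * lvi k l :: 'k ulaurent) = frac_eval i j (lv k l) * frac_eval i j (lvi k l)"
    using assms by (intro ev_mult localized_ring_lv localized_ring_lvi) auto
  then have "pl k l * frac_eval i j (lvi k l :: 'k ulaurent) = 1" by (simp add: ev_1 ev_lv [OF assms])
  then show ?thesis by (rule inverse_unique [symmetric])
qed

text \<open>With b = \<open>other a\<close> and t = \<open>pred k\<close>, the recursion is the
  relation p_ak p_bt = p_ab p_kt + p_at p_bk divided by the nonzero p_bt.\<close>

lemma ev_phi:
  assumes "k \<in> L" "a \<in> {i, j}"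
  shows "frac_eval i j (phi a k) = (pl a k :: 'k::field upoly fract)"
  using assms
proof (induction rule: phi_induct)
  case (inI k a)
  then show ?case using ij by (auto simp: phi_in ev_lv)
next
  case (notinI k a)
  let ?b = "other a" and ?t = "pred k"
  have b: "?b \<in> {1..n}" "?b \<notin> L" "a \<in> {1..n}" "?b \<noteq> a" using ij notinI(2) by (auto simp: other_def)
  have kt: "k \<noteq> ?t" using notinI(8) I by auto
  note lr = localized_ring_intros localized_ring_lv localized_ring_lvi subsetD [OF localized_ring_pairs phi_localized]
  have s: "(sgn_end a :: 'k ulaurent) \<in> localized_ring (pairs n) (pairs n)" "frac_eval i j (sgn_end a :: 'k ulaurent) = pl a ?b"
    using notinI(2) ij(3)
    by (auto simp: sgn_end_def other_def pl_ij ev_1 ev_uminus localized_ring_1 intro: localized_ring_intros)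
  have in_n: "k \<in> {1..n}" "?t \<in> {1..n}" "?b \<noteq> k" "?b \<noteq> ?t" using notinI b by auto
  let ?R = "localized_ring (pairs n) (pairs n) :: 'k ulaurent set"
  have X: "lv k ?t \<in> ?R" and Y: "lv ?b k \<in> ?R" and Z: "lvi ?b ?t \<in> ?R"
    using b in_n kt by (auto intro: localized_ring_lv localized_ring_lvi)
  have P: "phi a ?t \<in> ?R"
    using subsetD [OF localized_ring_pairs phi_localized [OF notinI(4,2)]] .
  have "frac_eval i j (phi a k :: 'k ulaurent) = (pl a ?b * pl k ?t + pl a ?t * pl ?b k) * inverse (pl ?b ?t)"
    unfolding phi_notin [OF notinI(1-3)]
      ev_mult [OF localized_ring_add [OF localized_ring_mult [OF s(1) X] localized_ring_mult [OF P Y]] Z]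
      ev_add [OF localized_ring_mult [OF s(1) X] localized_ring_mult [OF P Y]] ev_mult [OF s(1) X]
      ev_mult [OF P Y] s(2) notinI(9) ev_lv [OF in_n(1,2) kt] ev_lv [OF b(1) in_n(1,3)]
      ev_lvi [OF b(1) in_n(2,4)] ..
  also have "pl a ?b * pl k ?t + pl a ?t * pl ?b k = (pl a k * pl ?b ?t :: 'k upoly fract)"
    by (simp add: pl_pluecker [of a ?b k ?t])
  finally show ?case
    by (simp only: mult.assoc right_inverse [OF pl_nonzero [OF b(1) in_n(2,4)]] mult_1_right)
qed

end

text \<open>A product of variables from \<open>D\<close> suffices as multiplier. Its inverse is
  recorded so that it can be cancelled by multiplication.\<close>

lemma clear_denominators:
  assumes "f \<in> localized_ring S D"
  shows "\<exists>u v. u * v = 1 \<and> u \<in> localized_ring (S \<inter> D) {} \<and> v \<in> localized_ring (S \<inter> D) D \<and>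
    u * f \<in> localized_ring S {}"
  using assms
proof (induction rule: localized_induct)
  case (const c)
  show ?case
    by (intro exI [of _ 1]) (simp add: localized_ring_1 localized_ring_const)
next
  case (lvar e)
  then show ?case
    by (intro exI [of _ 1]) (simp add: localized_ring_1 localized_ring_lvar)
next
  case (linv e)
  then show ?case
    by (intro exI [of _ "lvar e"] exI [of _ "linv e"])
      (simp add: localized_ring_1 localized_ring_lvar localized_ring_linv)
next
  case (add f g)
  obtain u v where u: "u * v = 1" "u \<in> localized_ring (S \<inter> D) {}" "v \<in> localized_ring (S \<inter> D) D"
    "u * f \<in> localized_ring S {}" using add.IH by blast
  obtain u' v' where u': "u' * v' = 1" "u' \<in> localized_ring (S \<inter> D) {}" "v' \<in> localized_ring (S \<inter> D) D"
    "u' * g \<in> localized_ring S {}" using add.IH by blast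
  have uS: "u \<in> localized_ring S {}" "u' \<in> localized_ring S {}"
    using u(2) u'(2) localized_ring_mono [of "S \<inter> D" S "{}" "{}"] by auto
  have 1: "u * u' * (f + g) = u' * (u * f) + u * (u' * g)" by (simp add: algebra_simps)
  have 2: "u * u' * (v * v') = (u * v) * (u' * v')" by (simp only: mult_ac)
  show ?case
  proof (intro exI conjI)
    show "u * u' * (v * v') = 1" using 2 u(1) u'(1) by simp
    show "u * u' \<in> localized_ring (S \<inter> D) {}" "v * v' \<in> localized_ring (S \<inter> D) D"
      using u(2,3) u'(2,3) by (auto intro: localized_ring_mult)
    show "u * u' * (f + g) \<in> localized_ring S {}"
      unfolding 1 using localized_ring_add [OF localized_ring_mult [OF uS(2) u(4)] localized_ring_mult [OF uS(1) u'(4)]] .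
  qed
next
  case (mult f g)
  obtain u v where u: "u * v = 1" "u \<in> localized_ring (S \<inter> D) {}" "v \<in> localized_ring (S \<inter> D) D"
    "u * f \<in> localized_ring S {}" using mult.IH by blast
  obtain u' v' where u': "u' * v' = 1" "u' \<in> localized_ring (S \<inter> D) {}" "v' \<in> localized_ring (S \<inter> D) D"
    "u' * g \<in> localized_ring S {}" using mult.IH by blast
  have 1: "u * u' * (f * g) = (u * f) * (u' * g)" by (simp only: mult_ac)
  have 2: "u * u' * (v * v') = (u * v) * (u' * v')" by (simp only: mult_ac)
  show ?case
  proof (intro exI conjI)
    show "u * u' * (v * v') = 1" using 2 u(1) u'(1) by simp
    show "u * u' \<in> localized_ring (S \<inter> D) {}" "v * v' \<in> localized_ring (S \<inter> D) D"
      using u(2,3) u'(2,3) by (auto intro: localized_ring_mult)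
    show "u * u' * (f * g) \<in> localized_ring S {}"
      unfolding 1 using localized_ring_mult [OF u(4) u'(4)] .
  qed
qed

section \<open>The inclusion \<open>mu\<close> in explicit form\<close>

locale pluecker_field = pluecker_basis n i j J I pred rk
  for n i j :: nat and J I :: "nat uprod set" and pred rk :: "nat \<Rightarrow> nat" +
  fixes K :: "'k::field itself"
begin

definition sub :: "nat uprod \<Rightarrow> 'k ulaurent" where
  "sub e = (if i \<in> set_uprod e then pair_sign i (THE k. e = Upair i k) * phi i (THE k. e = Upair i k)
    else pair_sign j (THE k. e = Upair j k) * phi j (THE k. e = Upair j k))"

lemma sub_pair:
  assumes "a \<in> {i, j}" "k \<in> L" shows "sub (Upair a k) = pair_sign a k * phi a k"
proof -
  have "(THE k'. Upair a k = Upair a k') = k" by (rule the_equality) auto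
  then show ?thesis using assms ij by (auto simp: sub_def)
qed

text \<open>The ring homomorphism behind \<open>mu\<close>: chart variables are replaced by their
  expressions in the variables of \<open>I\<close>. The values at variables outside the chart are
  irrelevant.\<close>

definition sigma :: "'k upoly \<Rightarrow> 'k ulaurent" where
  "sigma = poly_subst const sub"

lemma upoly_hom_sigma: "upoly_hom sigma"
  unfolding sigma_def by (rule upoly_hom_poly_subst) (simp_all add: const_simps)

sublocale sigma: upoly_hom sigma by (rule upoly_hom_sigma)

lemma sigma_const: "sigma (const c) = const c"
  unfolding sigma_def by (rule poly_subst_const) (simp_all add: const_simps)

lemma sigma_uvar: "sigma (uvar e) = sub e"
  unfolding sigma_def by (rule poly_subst_uvar) (simp_all add: const_simps)

lemma sigma_oriented_var: "a \<in> {i, j} \<Longrightarrow> k \<in> L \<Longrightarrow> sigma (oriented_var a k) = phi a k"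
  by (simp add: oriented_var_eq sigma.hom_mult sigma_uvar sub_pair sigma.hom_pair_sign [unfolded const_pair_sign])

text \<open>Minors of the 2 x n matrix with unit columns at \<open>i\<close> and \<open>j\<close>
  and chart coordinates \<open>u\<close>. The ring is arbitrary because \<open>u\<close> is taken to
  be \<open>phi\<close>, its restriction to the stratum, or the image of the chart under another
  homomorphism.\<close>

definition minor :: "(nat \<Rightarrow> nat \<Rightarrow> 'b) \<Rightarrow> nat \<Rightarrow> nat \<Rightarrow> 'b::comm_ring_1" where
  "minor u k l =
    (let A = (\<lambda>k. if k = i then 1 else if k = j then 0 else - u j k);
         B = (\<lambda>k. if k = i then 0 else if k = j then 1 else u i k)
     in A k * B l - A l * B k)"

lemma minor_pluecker: "minor u a b * minor u c d = minor u a c * minor u b d - minor u a d * minor u b c"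
  unfolding minor_def Let_def by (simp only: algebra_simps)

lemma minor_swap: "minor u l k = - minor u k l"
  unfolding minor_def Let_def by simp

lemma minor_chart: "a \<in> {i, j} \<Longrightarrow> k \<in> L \<Longrightarrow> minor u a k = u a k"
  and minor_ij: "minor u i j = 1" "minor u j i = - 1"
  and minor_inner: "k \<in> L \<Longrightarrow> l \<in> L \<Longrightarrow> minor u k l = u i k * u j l - u i l * u j k"
  using ij(3) by (auto simp: minor_def)

abbreviation mn :: "nat \<Rightarrow> nat \<Rightarrow> 'k ulaurent" where
  "mn \<equiv> minor phi"

lemma hom_chart_coord:
  assumes \<theta>: "upoly_hom \<theta>" and u: "\<And>a k. a \<in> {i, j} \<Longrightarrow> k \<in> L \<Longrightarrow> \<theta> (oriented_var a k) = u a k"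
    and kl: "k \<in> {1..n}" "l \<in> {1..n}" "k \<noteq> l"
  shows "\<theta> (chart_coord i j (Upair k l)) = pair_sign k l * minor u k l"
proof -
  interpret upoly_hom \<theta> by (rule \<theta>)
  have A: "\<theta> (col_A i j k) = (if k = i then 1 else if k = j then 0 else - u j k)"
    and B: "\<theta> (col_B i j k) = (if k = i then 0 else if k = j then 1 else u i k)"
    if "k \<in> {1..n}" for k
    using that by (auto simp: col_A_def col_B_def hom_1 hom_0 hom_uminus u)
  show ?thesis
    unfolding chart_coord_minor [OF ij(3) kl(3)] minor_def Let_def
    by (simp only: hom_mult hom_diff A [OF kl(1)] A [OF kl(2)] B [OF kl(1)]
      B [OF kl(2)] hom_pair_sign [unfolded const_pair_sign])
qed

lemma sigma_chart_coord:
  assumes "k \<in> {1..n}" "l \<in> {1..n}" "k \<noteq> l"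
  shows "sigma (chart_coord i j (Upair k l)) = pair_sign k l * mn k l"
  by (rule hom_chart_coord [OF upoly_hom_sigma _ assms]) (rule sigma_oriented_var)

lemma chart_or_inner:
  assumes "k \<in> {1..n}" "l \<in> {1..n}" "k \<noteq> l" "\<And>k l. P k l \<Longrightarrow> P l k"
    and "P i j" "\<And>a k. a \<in> {i, j} \<Longrightarrow> k \<in> L \<Longrightarrow> P a k" "k \<in> L \<Longrightarrow> l \<in> L \<Longrightarrow> P k l"
  shows "P k l"
proof -
  consider "k = i \<and> l = j \<or> k = j \<and> l = i" | "k \<in> {i, j}" "l \<in> L" | "l \<in> {i, j}" "k \<in> L" | "k \<in> L" "l \<in> L"
    using assms(1-3) by blast
  then show ?thesis by cases (use assms in blast)+
qed

text \<open>For a chart pair this is how \<open>phi\<close> starts. For {k, pred k} it is the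
  relation that was solved for u_ak, read backwards. Hence substitution fixes every variable of
  \<open>I\<close>, which makes it a left inverse of evaluation.\<close>

lemma mn_in_I:
  assumes "Upair k l \<in> I" shows "mn k l = lv k l"
proof -
  have kl: "k \<in> {1..n}" "l \<in> {1..n}" "k \<noteq> l" using assms I by auto
  have swap: "mn l' k' = lv l' k'" if "mn k' l' = lv k' l'" "k' \<noteq> l'" for k' l'
    using that by (metis minor_swap lv_swap)
  have chart: "mn a k = lv a k" if "a \<in> {i, j}" "k \<in> L" "Upair a k \<in> I" for a k
    using that by (simp add: minor_chart phi_in)
  show ?thesis
  proof (cases "Upair k l \<in> chart_pairs n i j")
    case True
    then have "k \<in> {i, j} \<and> l \<in> L \<or> l \<in> {i, j} \<and> k \<in> L"
      using kl by (auto simp: chart_pairs_def)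
    moreover have "Upair l k = Upair k l" by simp
    ultimately show ?thesis using chart [of k l] chart [of l k] swap [of l k] assms kl by metis
  next
    case False
    then obtain k' a b where k': "k' \<in> L" "{a, b} = {i, j}" "Upair a k' \<notin> I" "Upair k l = Upair k' (pred k')"
      using I_cases [OF assms] by blast
    have a: "a \<in> {i, j}" and b: "b = other a" using k'(2) ij(3) by (auto simp: other_def doubleton_eq_iff)
    note p = pred [OF k'(1-3)]
    have kt: "k' \<noteq> pred k'" using p by auto
    have lvb: "(phi b k' :: 'k ulaurent) = lv b k'" "(phi b (pred k') :: 'k ulaurent) = lv b (pred k')" using p by (simp_all add: phi_in)
    have "(phi a k' * lv b (pred k') :: 'k ulaurent) = (sgn_end a * lv k' (pred k') + phi a (pred k') * lv b k')"
      unfolding phi_notin [OF k'(1) a k'(3)] b by (simp add: mult.assoc)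
    moreover have "mn k' (pred k') = phi i k' * phi j (pred k') - phi i (pred k') * phi j k'"
      using p k'(1) by (simp add: minor_inner)
    ultimately have "mn k' (pred k') = lv k' (pred k')"
      using a b lvb ij(3) by (auto simp: other_def sgn_end_def mult.commute)
    then show ?thesis using swap [OF _ kt] k'(4) by auto
  qed
qed

lemma mn_localized_ev:
  assumes "k \<in> {1..n}" "l \<in> {1..n}" "k \<noteq> l"
  shows "mn k l \<in> localized_ring I D \<and> frac_eval i j (mn k l) = pl k l"
proof (rule chart_or_inner [OF assms])
  note R = subsetD [OF localized_ring_pairs]
  show "mn l k \<in> localized_ring I D \<and> frac_eval i j (mn l k) = pl l k"
    if "mn k l \<in> localized_ring I D \<and> frac_eval i j (mn k l) = pl k l" for k l
  proof -
    have kl: "mn k l \<in> localized_ring I D" using that by simp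
    then have "mn l k \<in> localized_ring I D"
      unfolding minor_swap [of phi l k] by (rule localized_ring_uminus)
    moreover have "frac_eval i j (mn l k) = pl l k"
      unfolding minor_swap [of phi l k] ev_uminus [OF R [OF kl]] pl_swap [of l k] using that by simp
    ultimately show ?thesis ..
  qed
  show "mn i j \<in> localized_ring I D \<and> frac_eval i j (mn i j) = pl i j"
    by (simp add: minor_ij pl_ij ev_1 localized_ring_1)
  show "mn a k \<in> localized_ring I D \<and> frac_eval i j (mn a k) = pl a k" if "a \<in> {i, j}" "k \<in> L" for a k
    using phi_localized [OF that(2,1)] ev_phi [OF that(2,1)] by (simp add: minor_chart [OF that])
  show "mn k l \<in> localized_ring I D \<and> frac_eval i j (mn k l) = pl k l" if "k \<in> L" "l \<in> L"
  proof
    have ab: "i \<in> {i, j}" "j \<in> {i, j}" by auto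
    note P = phi_localized [OF that(1) ab(1)] phi_localized [OF that(2) ab(1)]
      phi_localized [OF that(1) ab(2)] phi_localized [OF that(2) ab(2)]
    show "mn k l \<in> localized_ring I D"
      unfolding minor_inner [OF that] using P by (intro localized_ring_intros)
    have "frac_eval i j (mn k l) = pl i k * pl j l - pl i l * pl j k"
      unfolding minor_inner [OF that]
        ev_diff [OF localized_ring_mult [OF R [OF P(1)] R [OF P(4)]] localized_ring_mult [OF R [OF P(2)] R [OF P(3)]]]
        ev_mult [OF R [OF P(1)] R [OF P(4)]] ev_mult [OF R [OF P(2)] R [OF P(3)]]
      using that by (simp add: ev_phi)
    then show "frac_eval i j (mn k l) = pl k l"
      using pl_pluecker [of i j k l, where 'a = 'k] by (simp add: pl_ij)
  qed
qed

lemmas mn_localized = conjunct1 [OF mn_localized_ev] and ev_mn = conjunct2 [OF mn_localized_ev]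

lemma sigma_lvar:
  assumes "e \<in> I" shows "sigma (chart_coord i j e) = lvar e"
proof -
  have "e \<in> pairs n" using I assms by blast
  then obtain k l where kl: "e = Upair k l" "k \<in> {1..n}" "l \<in> {1..n}" "k \<noteq> l" by (rule pairsE)
  then show ?thesis
    using sigma_chart_coord [OF kl(2-4)] mn_in_I [of k l] assms by (simp add: lv_def)
qed

text \<open>A homomorphism fixing the variables of \<open>S\<close> recovers a polynomial in them
  from its value in the fraction field. It is applied to \<open>sigma\<close> with \<open>S\<close>
  = \<open>I\<close> and to its restriction to the stratum with \<open>S\<close> =
  \<open>I - J\<close>.\<close>

lemma polynomial_lift:
  assumes \<theta>: "upoly_hom \<theta>" "\<And>c. \<theta> (const c) = const c"
    and S: "S \<subseteq> pairs n" "\<And>e. e \<in> S \<Longrightarrow> \<theta> (chart_coord i j e) = lvar e"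
    and g: "g \<in> (localized_ring S {} :: 'k ulaurent set)"
  shows "\<exists>a. frac_eval i j g = Fract a 1 \<and> \<theta> a = g"
  using g
proof (induction rule: localized_induct)
  case (const c)
  then show ?case using frac_eval_const \<theta>(2) by blast
next
  case (lvar e)
  then show ?case using frac_eval_lvar S(2) by blast
next
  case (linv e)
  then show ?case by simp
next
  case (add f g)
  then obtain a b where "frac_eval i j f = Fract a 1" "\<theta> a = f" "frac_eval i j g = Fract b 1" "\<theta> b = g"
    by blast
  moreover have "frac_eval i j (f + g) = frac_eval i j f + frac_eval i j g"
    using add.hyps localized_ring_mono [of S "pairs n" "{}" "pairs n"] S(1) by (intro ev_add) auto
  ultimately have "frac_eval i j (f + g) = Fract (a + b) 1 \<and> \<theta> (a + b) = f + g"
    by (simp only: fract_simps upoly_hom.hom_add [OF \<theta>(1)] simp_thms)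
  then show ?case by blast
next
  case (mult f g)
  then obtain a b where "frac_eval i j f = Fract a 1" "\<theta> a = f" "frac_eval i j g = Fract b 1" "\<theta> b = g"
    by blast
  moreover have "frac_eval i j (f * g) = frac_eval i j f * frac_eval i j g"
    using mult.hyps localized_ring_mono [of S "pairs n" "{}" "pairs n"] S(1) by (intro ev_mult) auto
  ultimately have "frac_eval i j (f * g) = Fract (a * b) 1 \<and> \<theta> (a * b) = f * g"
    by (simp only: fract_simps upoly_hom.hom_mult [OF \<theta>(1)] simp_thms)
  then show ?case by blast
qed

text \<open>Algebraic independence of the u_kl, kl \<in> \<open>I\<close>: after clearing
  denominators, \<open>sigma\<close> recovers the polynomial from its value 0.\<close>

lemma ev_injective:
  assumes "g \<in> localized_ring I I" "frac_eval i j g = (0 :: 'k upoly fract)"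
  shows "g = 0"
proof -
  obtain u v where u: "u * v = 1" "u \<in> localized_ring (I \<inter> I) {}" "v \<in> localized_ring (I \<inter> I) I"
    "u * g \<in> localized_ring I {}" using clear_denominators [OF assms(1)] by blast
  obtain a where a: "frac_eval i j (u * g) = Fract a 1" "sigma a = u * g"
    using polynomial_lift [OF upoly_hom_sigma sigma_const I(1) sigma_lvar u(4)] by blast
  have mono: "localized_ring I {} \<subseteq> localized_ring (pairs n) (pairs n)"
    "localized_ring I I \<subseteq> localized_ring (pairs n) (pairs n)"
    by (rule localized_ring_mono; use I in auto)+
  have "frac_eval i j (u * g) = frac_eval i j u * frac_eval i j g"
    using u(2) assms(1) mono by (intro ev_mult) auto
  then have "a = 0" using assms(2) a(1) by (simp add: fract_eq_0_iff)
  then have 0: "u * g = 0" using a(2) sigma.hom_0 by simp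
  have "(u * v) * g = v * (u * g)" by (simp only: mult_ac)
  then show ?thesis unfolding u(1) 0 by simp
qed

lemma signed_mn:
  assumes "k \<in> {1..n}" "l \<in> {1..n}" "k \<noteq> l"
  shows "pair_sign k l * mn k l \<in> localized_ring I D"
    and "frac_eval i j (pair_sign k l * mn k l) = Fract (chart_coord i j (Upair k l)) 1"
proof -
  show "pair_sign k l * mn k l \<in> localized_ring I D"
    using mn_localized [OF assms] by (intro localized_ring_mult localized_ring_pair_sign)
  show "frac_eval i j (pair_sign k l * mn k l) = Fract (chart_coord i j (Upair k l)) 1"
    unfolding pl_chart [OF assms(3)] ev_mn [OF assms] ev_pair_sign
      ev_mult [OF localized_ring_pair_sign subsetD [OF localized_ring_pairs mn_localized [OF assms]]] ..
qed

text \<open>The minor satisfies both conditions in the definition of \<open>mu\<close>, and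
  \<open>ev_injective\<close> makes it the only such element.\<close>

lemma mu_chart_coord:
  assumes "k \<in> {1..n}" "l \<in> {1..n}" "k \<noteq> l"
  shows "mu n i j J I (chart_coord i j (Upair k l)) = pair_sign k l * mn k l"
  unfolding mu_def
proof (rule the_equality)
  note R = subsetD [OF localized_ring_pairs]
  note mem = signed_mn(1) [OF assms] and ev = signed_mn(2) [OF assms]
  show "pair_sign k l * mn k l \<in> localized_ring I D \<and>
    frac_eval i j (pair_sign k l * mn k l) = Fract (chart_coord i j (Upair k l)) 1"
    using mem ev by blast
  fix g :: "'k ulaurent"
  assume g: "g \<in> localized_ring I D \<and> frac_eval i j g = Fract (chart_coord i j (Upair k l)) 1"
  then have gD: "g \<in> localized_ring I D" by blast
  have "frac_eval i j (g - pair_sign k l * mn k l) = 0"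
    unfolding ev_diff [OF R [OF gD] R [OF mem]] ev using g by simp
  moreover have "g - pair_sign k l * mn k l \<in> localized_ring I I"
    using localized_ring_diff [OF gD mem] localized_ring_mono [of I I D I] by blast
  ultimately show "g = pair_sign k l * mn k l" using ev_injective by fastforce
qed

section \<open>The restriction to the stratum\<close>

abbreviation sz :: "'k ulaurent \<Rightarrow> 'k ulaurent" where
  "sz \<equiv> set_zero (I \<inter> J)"

lemma sz_mult: "f \<in> localized_ring I D \<Longrightarrow> g \<in> localized_ring I D \<Longrightarrow> sz (f * g) = sz f * sz g"
  and sz_add: "f \<in> localized_ring I D \<Longrightarrow> g \<in> localized_ring I D \<Longrightarrow> sz (f + g) = sz f + sz g"
  using set_zero_mult [of D "I \<inter> J"] set_zero_add [of D "I \<inter> J"] by blast+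

lemma sz_0: "sz 0 = 0" and sz_1: "sz 1 = 1"
  using set_zero_const [of "I \<inter> J" 0] set_zero_const [of "I \<inter> J" 1] by (simp_all add: const_simps)

lemma sz_uminus: "f \<in> localized_ring I D \<Longrightarrow> sz (- f) = - sz f"
proof -
  assume f: "f \<in> localized_ring I D"
  have "sz f + sz (- f) = 0"
    unfolding sz_add [OF f localized_ring_uminus [OF f], symmetric] by (simp add: sz_0)
  then show ?thesis by (rule minus_unique [symmetric])
qed

lemma sz_diff: "f \<in> localized_ring I D \<Longrightarrow> g \<in> localized_ring I D \<Longrightarrow> sz (f - g) = sz f - sz g"
  using sz_add [OF _ localized_ring_uminus, of f g] by (simp add: sz_uminus)

lemma sz_pair_sign: "sz (pair_sign k l) = pair_sign k l"
  by (simp add: pair_sign_def sz_uminus sz_1 localized_ring_1)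

text \<open>The oriented form of f_kl, defined also for pairs in \<open>J\<close>. It inherits
  antisymmetry and the three-term relations, since setting variables to zero is compatible with
  products as long as no variable of \<open>J\<close> is inverted.\<close>

definition Fm :: "nat \<Rightarrow> nat \<Rightarrow> 'k ulaurent" where
  "Fm k l = sz (mn k l)"

lemma Fm_localized:
  "k \<in> {1..n} \<Longrightarrow> l \<in> {1..n} \<Longrightarrow> k \<noteq> l \<Longrightarrow> Fm k l \<in> localized_ring (I - J) (I - J)"
proof -
  assume "k \<in> {1..n}" "l \<in> {1..n}" "k \<noteq> l"
  then have "Fm k l \<in> localized_ring (I - I \<inter> J) D"
    unfolding Fm_def by (intro set_zero_localized mn_localized)
  moreover have "localized_ring (I - I \<inter> J) D \<subseteq> localized_ring (I - J) (I - J)"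
    by (rule localized_ring_mono) auto
  ultimately show ?thesis by blast
qed

lemma f_coord_eq:
  assumes "k \<in> {1..n}" "l \<in> {1..n}" "k \<noteq> l"
  shows "f_coord n i j J I (Upair k l) = pair_sign k l * Fm k l"
  unfolding f_coord_def mu_chart_coord [OF assms] Fm_def
    sz_mult [OF localized_ring_pair_sign mn_localized [OF assms]] sz_pair_sign ..

lemma Fm_pluecker:
  assumes "a \<in> {1..n}" "b \<in> {1..n}" "c \<in> {1..n}" "d \<in> {1..n}" "distinct [a, b, c, d]"
  shows "Fm a b * Fm c d = Fm a c * Fm b d - Fm a d * Fm b c"
proof -
  have m: "mn k l \<in> localized_ring I D" if "k \<in> {a, b, c, d}" "l \<in> {a, b, c, d}" "k \<noteq> l" for k l
    using that assms by (intro mn_localized) auto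
  have "sz (mn a b * mn c d) = sz (mn a c * mn b d - mn a d * mn b c)"
    by (rule arg_cong [OF minor_pluecker])
  moreover have "sz (mn a b * mn c d) = Fm a b * Fm c d"
    unfolding Fm_def using assms(5) by (intro sz_mult m) auto
  moreover have "sz (mn a c * mn b d - mn a d * mn b c) = sz (mn a c * mn b d) - sz (mn a d * mn b c)"
    using assms(5) by (intro sz_diff localized_ring_mult m) auto
  moreover have "sz (mn a c * mn b d) = Fm a c * Fm b d" "sz (mn a d * mn b c) = Fm a d * Fm b c"
    unfolding Fm_def using assms(5) by (intro sz_mult m; simp; fail)+
  ultimately show ?thesis by simp
qed

lemma Fm_swap: "k \<in> {1..n} \<Longrightarrow> l \<in> {1..n} \<Longrightarrow> k \<noteq> l \<Longrightarrow> Fm l k = - Fm k l"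
  unfolding Fm_def minor_swap [of phi l k] by (intro sz_uminus mn_localized)

lemma Fm_in_I: "Upair k l \<in> I \<Longrightarrow> Fm k l = (if Upair k l \<in> J then 0 else lv k l)"
  unfolding Fm_def mn_in_I lv_def
  by (subst sz_mult) (auto simp: sz_pair_sign set_zero_lvar intro: localized_ring_pair_sign localized_ring_lvar)

lemma Fm_ij: "Fm i j = 1"
  by (simp add: Fm_def minor_ij sz_1)

end

section \<open>Localizations of the chart\<close>

lemma chart_ring_add: "f \<in> chart_ring n i j \<Longrightarrow> g \<in> chart_ring n i j \<Longrightarrow> f + g \<in> chart_ring n i j"
  using Poly_Mapping.keys_add [of f g] unfolding chart_ring_def by blast

lemma chart_ring_mult:
  assumes "f \<in> chart_ring n i j" "g \<in> chart_ring n i j"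
  shows "f * g \<in> chart_ring n i j"
proof -
  have "Poly_Mapping.keys \<alpha> \<subseteq> chart_pairs n i j" if \<alpha>: "\<alpha> \<in> Poly_Mapping.keys (f * g)" for \<alpha>
  proof -
    obtain \<beta> \<gamma> where *: "\<beta> \<in> Poly_Mapping.keys f" "\<gamma> \<in> Poly_Mapping.keys g" "\<alpha> = \<beta> + \<gamma>"
      using \<alpha> Poly_Mapping.keys_mult [of f g] by blast
    then have "Poly_Mapping.keys \<beta> \<subseteq> chart_pairs n i j" "Poly_Mapping.keys \<gamma> \<subseteq> chart_pairs n i j"
      using assms by (simp_all add: chart_ring_def)
    then show ?thesis using Poly_Mapping.keys_add [of \<beta> \<gamma>] *(3) by blast
  qed
  then show ?thesis unfolding chart_ring_def by blast
qed

lemma chart_ring_const: "const c \<in> chart_ring n i j"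
  by (simp add: chart_ring_def const_def)

lemma chart_ring_1: "1 \<in> chart_ring n i j" and chart_ring_pair_sign: "pair_sign k l \<in> chart_ring n i j"
  using chart_ring_const [of 1 n i j] chart_ring_const [of "pair_sign k l" n i j]
  by (simp_all add: const_simps const_pair_sign)

lemma chart_ring_uminus: "f \<in> chart_ring n i j \<Longrightarrow> - f \<in> chart_ring n i j"
  using chart_ring_mult [OF chart_ring_const [of "-1"]] by (simp add: const_simps)

lemma chart_ring_diff: "f \<in> chart_ring n i j \<Longrightarrow> g \<in> chart_ring n i j \<Longrightarrow> f - g \<in> chart_ring n i j"
  using chart_ring_add [OF _ chart_ring_uminus, of f n i j g] by simp

lemma chart_ring_chart_coord:
  assumes "i \<in> {1..n}" "j \<in> {1..n}" "i \<noteq> j" "e \<in> pairs n"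
  shows "chart_coord i j e \<in> chart_ring n i j"
proof -
  have ov: "oriented_var a k \<in> chart_ring n i j" if "a \<in> {i, j}" "k \<in> {1..n} - {i, j}" for a k
  proof -
    have "Upair a k \<in> chart_pairs n i j" using that assms by (auto simp: chart_pairs_def)
    then have "uvar (Upair a k) \<in> chart_ring n i j" by (simp add: chart_ring_def uvar_def)
    then show ?thesis unfolding oriented_var_eq by (intro chart_ring_mult chart_ring_pair_sign)
  qed
  obtain k l where e: "e = Upair k l" "k \<in> {1..n}" "l \<in> {1..n}" "k \<noteq> l" using assms(4) by (rule pairsE)
  have 0: "0 \<in> chart_ring n i j" by (simp add: chart_ring_def)
  have "col_A i j m \<in> chart_ring n i j" "col_B i j m \<in> chart_ring n i j" if "m \<in> {1..n}" for m
    using that ov [of j m] ov [of i m] 0 by (auto simp: col_A_def col_B_def chart_ring_1 intro: chart_ring_uminus)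
  then show ?thesis unfolding e chart_coord_minor [OF assms(3) e(4)]
    using e by (intro chart_ring_mult chart_ring_pair_sign chart_ring_diff) auto
qed

text \<open>With the prime ideal ker \<theta>, the regular fractions below form the local ring at
  that prime, and these are its maximal ideal.\<close>

definition vanishing_fractions :: "('k::field upoly \<Rightarrow> 'b::idom) \<Rightarrow> 'k upoly fract set" where
  "vanishing_fractions \<theta> = {Fract a b | a b. \<theta> a = 0 \<and> \<theta> b \<noteq> 0}"

definition regular_fractions :: "('k::field upoly \<Rightarrow> 'b::idom) \<Rightarrow> 'k upoly fract set" where
  "regular_fractions \<theta> = {Fract a b | a b. \<theta> b \<noteq> 0}"

locale upoly_hom_field = upoly_hom \<theta> for \<theta> :: "'k::field upoly \<Rightarrow> 'b::idom"
begin

lemma nonzero: "\<theta> a \<noteq> 0 \<Longrightarrow> a \<noteq> 0"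
  using hom_0 by auto

lemma vanishing_add:
  assumes "p \<in> vanishing_fractions \<theta>" "q \<in> vanishing_fractions \<theta>"
  shows "p + q \<in> vanishing_fractions \<theta>"
proof -
  obtain a b c d where *: "p = Fract a b" "\<theta> a = 0" "\<theta> b \<noteq> 0" "q = Fract c d" "\<theta> c = 0" "\<theta> d \<noteq> 0"
    using assms unfolding vanishing_fractions_def by blast
  have "p + q = Fract (a * d + c * b) (b * d)" using * nonzero by simp
  moreover have "\<theta> (a * d + c * b) = 0" "\<theta> (b * d) \<noteq> 0" using * by (simp_all add: hom_add hom_mult)
  ultimately show ?thesis unfolding vanishing_fractions_def by blast
qed

lemma vanishing_mult:
  assumes "p \<in> regular_fractions \<theta>" "q \<in> vanishing_fractions \<theta>"
  shows "p * q \<in> vanishing_fractions \<theta>"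
proof -
  obtain a b c d where *: "p = Fract a b" "\<theta> b \<noteq> 0" "q = Fract c d" "\<theta> c = 0" "\<theta> d \<noteq> 0"
    using assms unfolding vanishing_fractions_def regular_fractions_def by blast
  have "p * q = Fract (a * c) (b * d)" using * by simp
  moreover have "\<theta> (a * c) = 0" "\<theta> (b * d) \<noteq> 0" using * by (simp_all add: hom_mult)
  ultimately show ?thesis unfolding vanishing_fractions_def by blast
qed

lemma regular_Fract_1: "Fract a 1 \<in> regular_fractions \<theta>"
  unfolding regular_fractions_def using hom_1 by force

text \<open>Independence of the chosen fraction: cross multiplication survives \<theta>, and the
  target is a domain.\<close>

lemma Fract_vanishing_iff:
  assumes b: "\<theta> b \<noteq> 0"
  shows "Fract a b \<in> vanishing_fractions \<theta> \<longleftrightarrow> \<theta> a = 0"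
proof
  assume "Fract a b \<in> vanishing_fractions \<theta>"
  then obtain c d where *: "Fract a b = Fract c d" "\<theta> c = 0" "\<theta> d \<noteq> 0"
    unfolding vanishing_fractions_def by blast
  then have "a * d = c * b" using b nonzero by (simp add: eq_fract)
  then have "\<theta> a * \<theta> d = \<theta> c * \<theta> b" by (simp flip: hom_mult)
  then show "\<theta> a = 0" using * by simp
qed (use b in \<open>auto simp: vanishing_fractions_def\<close>)

lemma vanishing_power:
  assumes "q \<in> regular_fractions \<theta>" "q ^ N \<in> vanishing_fractions \<theta>"
  shows "q \<in> vanishing_fractions \<theta>"
proof -
  obtain a b where q: "q = Fract a b" "\<theta> b \<noteq> 0" using assms(1) unfolding regular_fractions_def by blast
  have "q ^ N = Fract (a ^ N) (b ^ N)"
    unfolding q by (induction N) (simp_all add: One_fract_def)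
  then have "\<theta> (a ^ N) = 0"
    using assms(2) Fract_vanishing_iff [of "b ^ N" "a ^ N"] q by (simp add: hom_power)
  then show ?thesis using q Fract_vanishing_iff [OF q(2)] by (simp add: hom_power)
qed

lemma localized_chart_regular:
  assumes "\<And>e. e \<in> pairs n - J \<Longrightarrow> \<theta> (chart_coord i j e) \<noteq> 0"
  shows "localized_chart n i j J \<subseteq> regular_fractions \<theta>"
proof -
  have "\<theta> (\<Prod>e\<in>pairs n - J. chart_coord i j e ^ m e) \<noteq> 0" for m
    using assms finite_pairs by (simp add: hom_prod hom_power)
  then show ?thesis unfolding localized_chart_def regular_fractions_def by blast
qed

text \<open>The localization maps into the local ring at ker \<theta>, the generators land in its
  maximal ideal, and this ideal is prime, so the radical follows. Two kinds of \<theta> are used: a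
  point over K and the restriction to the stratum.\<close>

lemma radical_vanishing:
  assumes nz: "\<And>e. e \<in> pairs n - J \<Longrightarrow> \<theta> (chart_coord i j e) \<noteq> 0"
    and z: "\<And>e. e \<in> J \<Longrightarrow> \<theta> (chart_coord i j e) = 0"
  shows "radical_in (localized_chart n i j J)
       (ideal_gen (localized_chart n i j J) ((\<lambda>e. Fract (chart_coord i j e) 1) ` J)) \<subseteq> vanishing_fractions \<theta>"
proof -
  have "ideal_gen (localized_chart n i j J) ((\<lambda>e. Fract (chart_coord i j e) 1) ` J) \<subseteq> vanishing_fractions \<theta>"
  proof (rule ideal_gen_minimal)
    show "0 \<in> vanishing_fractions \<theta>"
      using Fract_vanishing_iff [of 1 0] hom_0 hom_1 by (simp add: Zero_fract_def)
    show "(\<lambda>e. Fract (chart_coord i j e) 1) ` J \<subseteq> vanishing_fractions \<theta>"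
      using z Fract_vanishing_iff [of 1] hom_1 by auto
    show "a * b \<in> vanishing_fractions \<theta>"
      if "a \<in> localized_chart n i j J" "b \<in> vanishing_fractions \<theta>" for a b
      using vanishing_mult [OF subsetD [OF localized_chart_regular [OF nz] that(1)] that(2)] by blast
  qed (use vanishing_add in auto)
  then show ?thesis
    using vanishing_power localized_chart_regular [OF nz] unfolding radical_in_def by blast
qed

end

lemma localized_chart_mem: "a \<in> chart_ring n i j \<Longrightarrow> Fract a (\<Prod>e\<in>pairs n - J. chart_coord i j e ^ m e) \<in> localized_chart n i j J"
  unfolding localized_chart_def by blast

lemma localized_chartE:
  assumes "p \<in> localized_chart n i j J" "i \<noteq> j"
  obtains a m where "a \<in> chart_ring n i j" "p = Fract a (\<Prod>e\<in>pairs n - J. chart_coord i j e ^ m e)"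
    "(\<Prod>e\<in>pairs n - J. chart_coord i j e ^ m e) \<noteq> (0 :: 'k::field upoly)"
proof -
  have "(\<Prod>e\<in>pairs n - J. chart_coord i j e ^ m e) \<noteq> (0 :: 'k::field upoly)" for m
    by (auto simp: finite_pairs chart_coord_nonzero [OF assms(2), of _ n])
  then show ?thesis using assms(1) that unfolding localized_chart_def by blast
qed

lemma localized_chart_Fract_1: "a \<in> chart_ring n i j \<Longrightarrow> Fract a 1 \<in> localized_chart n i j J"
  using localized_chart_mem [where m = "\<lambda>_. 0"] by fastforce

lemma localized_chart_inverse:
  assumes "e \<in> pairs n - J"
  shows "Fract 1 (chart_coord i j e :: 'k::field upoly) \<in> localized_chart n i j J"
proof -
  have *: "(\<Prod>f\<in>pairs n - J. chart_coord i j f ^ (if f = e then 1 else 0)) = (chart_coord i j e :: 'k upoly)"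
    using assms finite_pairs by (simp add: if_distrib cong: if_cong)
  show ?thesis by (subst * [symmetric]) (rule localized_chart_mem [OF chart_ring_1])
qed

context
  fixes n i j :: nat and J :: "nat uprod set"
  assumes ij: "i \<in> {1..n}" "j \<in> {1..n}" "i \<noteq> j"
begin

lemma chart_denominators:
  "(\<Prod>e\<in>pairs n - J. chart_coord i j e ^ m e) * (\<Prod>e\<in>pairs n - J. chart_coord i j e ^ m' e) =
   (\<Prod>e\<in>pairs n - J. chart_coord i j e ^ (m e + m' e))"
  by (simp add: power_add prod.distrib)

lemma chart_denominator_in_ring:
  "(\<Prod>e\<in>pairs n - J. chart_coord i j e ^ m e :: 'k::field upoly) \<in> chart_ring n i j"
proof -
  have pw: "f ^ N \<in> chart_ring n i j" if "f \<in> chart_ring n i j" for f :: "'k upoly" and N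
    by (induction N) (auto intro: chart_ring_1 chart_ring_mult that)
  have pr: "prod F A \<in> chart_ring n i j" if "\<And>e. e \<in> A \<Longrightarrow> F e \<in> chart_ring n i j"
    for F :: "nat uprod \<Rightarrow> 'k upoly" and A
    using that by (induction A rule: infinite_finite_induct) (auto intro: chart_ring_1 chart_ring_mult)
  show ?thesis
    by (rule pr, rule pw, rule chart_ring_chart_coord [OF ij]) simp
qed

lemma localized_chart_add:
  assumes "p \<in> localized_chart n i j J" "q \<in> localized_chart n i j J"
  shows "p + q \<in> (localized_chart n i j J :: 'k::field upoly fract set)"
proof -
  let ?P = "\<lambda>m. \<Prod>e\<in>pairs n - J. chart_coord i j e ^ m e :: 'k upoly"
  obtain a m where p: "a \<in> chart_ring n i j" "p = Fract a (?P m)" "?P m \<noteq> 0"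
    using localized_chartE [OF assms(1) ij(3)] .
  obtain b m' where q: "b \<in> chart_ring n i j" "q = Fract b (?P m')" "?P m' \<noteq> 0"
    using localized_chartE [OF assms(2) ij(3)] .
  have "p + q = Fract (a * ?P m' + b * ?P m) (?P (\<lambda>e. m e + m' e))"
    unfolding p(2) q(2) add_fract [OF p(3) q(3)] chart_denominators ..
  moreover have "a * ?P m' + b * ?P m \<in> chart_ring n i j"
    using p(1) q(1) by (intro chart_ring_add chart_ring_mult chart_denominator_in_ring)
  ultimately show ?thesis using localized_chart_mem by (simp only:)
qed

lemma localized_chart_mult:
  assumes "p \<in> localized_chart n i j J" "q \<in> localized_chart n i j J"
  shows "p * q \<in> (localized_chart n i j J :: 'k::field upoly fract set)"
proof -
  let ?P = "\<lambda>m. \<Prod>e\<in>pairs n - J. chart_coord i j e ^ m e :: 'k upoly"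
  obtain a m where p: "a \<in> chart_ring n i j" "p = Fract a (?P m)" "?P m \<noteq> 0"
    using localized_chartE [OF assms(1) ij(3)] .
  obtain b m' where q: "b \<in> chart_ring n i j" "q = Fract b (?P m')" "?P m' \<noteq> 0"
    using localized_chartE [OF assms(2) ij(3)] .
  have "p * q = Fract (a * b) (?P (\<lambda>e. m e + m' e))"
    unfolding p(2) q(2) mult_fract chart_denominators ..
  then show ?thesis using localized_chart_mem [OF chart_ring_mult [OF p(1) q(1)]] by (simp only:)
qed

lemma frac_eval_localized_chart:
  assumes "f \<in> localized_ring (pairs n) (pairs n - J)"
  shows "frac_eval i j f \<in> (localized_chart n i j J :: 'k::field upoly fract set)"
  using assms
proof (induction rule: localized_induct)
  case (const c)
  then show ?case unfolding frac_eval_const by (intro localized_chart_Fract_1 chart_ring_const)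
next
  case (lvar e)
  then show ?case unfolding frac_eval_lvar by (intro localized_chart_Fract_1 chart_ring_chart_coord ij)
next
  case (linv e)
  then show ?case unfolding frac_eval_linv by (intro localized_chart_inverse)
next
  case (add f g)
  then show ?case unfolding frac_eval_add [OF ij(3) add.hyps] by (intro localized_chart_add)
next
  case (mult f g)
  then show ?case unfolding frac_eval_mult [OF ij(3) mult.hyps] by (intro localized_chart_mult)
qed

end

section \<open>The ideal of the stratum\<close>

text \<open>The point \<open>pt\<close> of the stratum guarantees that no coordinate outside
  \<open>J\<close> is forced to vanish on it.\<close>

locale pluecker_stratum = pluecker_field n i j J I pred rk K
  for n i j :: nat and J I :: "nat uprod set" and pred rk :: "nat \<Rightarrow> nat" and K :: "'k::field itself" +
  fixes pt :: "'k upoly \<Rightarrow> 'k"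
  assumes upoly_hom_pt: "upoly_hom pt"
    and pt_zero_iff: "e \<in> pairs n \<Longrightarrow> pt (chart_coord i j e) = 0 \<longleftrightarrow> e \<in> J"
begin

abbreviation LC :: "'k upoly fract set" where
  "LC \<equiv> localized_chart n i j J"

abbreviation Q :: "'k upoly fract set" where
  "Q \<equiv> ideal_gen LC ((\<lambda>e. Fract (chart_coord i j e) 1) ` J)"

lemma LC_1: "1 \<in> LC" and LC_0: "0 \<in> LC"
  using localized_chart_Fract_1 [OF chart_ring_1, where J = J]
    localized_chart_Fract_1 [OF chart_ring_const [of 0], where J = J]
  by (auto simp: const_simps fract_simps(3,4))

lemma Q_add: "p \<in> Q \<Longrightarrow> q \<in> Q \<Longrightarrow> p + q \<in> Q"
  by (rule ideal_gen_iff_add [OF LC_0 localized_chart_add [OF ij]])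

lemma Q_mult: "p \<in> LC \<Longrightarrow> q \<in> Q \<Longrightarrow> p * q \<in> Q"
  by (rule ideal_gen_mult [OF localized_chart_mult [OF ij]])

lemma ev_LC: "f \<in> localized_ring I D \<Longrightarrow> frac_eval i j f \<in> LC"
proof -
  assume "f \<in> localized_ring I D"
  moreover have "localized_ring I D \<subseteq> localized_ring (pairs n) (pairs n - J)"
    by (rule localized_ring_mono) (use I in auto)
  ultimately show ?thesis using frac_eval_localized_chart [OF ij] by blast
qed

lemma sz_localized: "f \<in> localized_ring I D \<Longrightarrow> sz f \<in> localized_ring I D"
  using set_zero_localized [of f I D "I \<inter> J"] localized_ring_mono [of "I - I \<inter> J" I D D] by blast

text \<open>Restricting a variable changes its value by 0 or by a generator of \<open>Q\<close>;
  products follow from fg - f'g' = f(g - g') + g'(f - f'). Applied to minors, it says that u_kl and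
  f_kl agree on the stratum.\<close>

lemma sz_congruent: "h \<in> localized_ring I D \<Longrightarrow> frac_eval i j (h - sz h) \<in> Q"
proof (induction rule: localized_induct)
  case (const c)
  then show ?case by (simp add: set_zero_const ev_0 ideal_gen_0)
next
  case (lvar e)
  then show ?case
    by (auto simp: set_zero_lvar ev_0 ideal_gen_0 frac_eval_lvar intro: ideal_gen_generator LC_1)
next
  case (linv e)
  then show ?case by (simp add: set_zero_linv ev_0 ideal_gen_0)
next
  case (add f g)
  note R = subsetD [OF localized_ring_pairs]
  have "frac_eval i j (f + g - sz (f + g)) = frac_eval i j ((f - sz f) + (g - sz g))"
    unfolding sz_add [OF add.hyps] by (simp add: algebra_simps)
  also have "\<dots> = frac_eval i j (f - sz f) + frac_eval i j (g - sz g)"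
    using add.hyps by (intro ev_add R localized_ring_diff sz_localized)
  finally show ?case using Q_add [OF add.IH] by simp
next
  case (mult f g)
  note R = subsetD [OF localized_ring_pairs]
  have "frac_eval i j (f * g - sz (f * g)) = frac_eval i j (f * (g - sz g) + sz g * (f - sz f))"
    unfolding sz_mult [OF mult.hyps] by (simp add: algebra_simps)
  also have "\<dots> = frac_eval i j (f * (g - sz g)) + frac_eval i j (sz g * (f - sz f))"
    using mult.hyps by (intro ev_add R localized_ring_diff localized_ring_mult sz_localized)
  also have "frac_eval i j (f * (g - sz g)) = frac_eval i j f * frac_eval i j (g - sz g)"
    using mult.hyps by (intro ev_mult R localized_ring_diff sz_localized)
  also have "frac_eval i j (sz g * (f - sz f)) = frac_eval i j (sz g) * frac_eval i j (f - sz f)"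
    using mult.hyps by (intro ev_mult R localized_ring_diff sz_localized)
  finally show ?case
    using Q_add [OF Q_mult [OF ev_LC [OF mult.hyps(1)] mult.IH(2)]
      Q_mult [OF ev_LC [OF sz_localized [OF mult.hyps(2)]] mult.IH(1)]] by (simp only:)
qed

lemma signed_congruent:
  assumes "k \<in> {1..n}" "l \<in> {1..n}" "k \<noteq> l"
  shows "frac_eval i j (lvar (Upair k l) - pair_sign k l * Fm k l) \<in> Q"
proof -
  note R = subsetD [OF localized_ring_pairs]
  let ?h = "pair_sign k l * mn k l"
  have h: "?h \<in> localized_ring I D" using signed_mn(1) [OF assms] .
  have sz: "sz ?h = pair_sign k l * Fm k l"
    unfolding Fm_def sz_mult [OF localized_ring_pair_sign mn_localized [OF assms]] sz_pair_sign ..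
  have sR: "sz ?h \<in> localized_ring (pairs n) (pairs n)" using R [OF sz_localized [OF h]] .
  have l: "lvar (Upair k l) \<in> localized_ring (pairs n) (pairs n)"
    using assms by (intro localized_ring_lvar) simp
  have "frac_eval i j (lvar (Upair k l) - sz ?h) = frac_eval i j (?h - sz ?h)"
    unfolding ev_diff [OF l sR] ev_diff [OF R [OF h] sR] frac_eval_lvar signed_mn(2) [OF assms] ..
  then show ?thesis using sz_congruent [OF h] unfolding sz by simp
qed

lemma radical_contains: "q \<in> Q \<Longrightarrow> q \<in> LC \<Longrightarrow> q \<in> radical_in LC Q"
  unfolding radical_in_def by (auto intro: exI [of _ 1])

sublocale pt: upoly_hom_field pt
  using upoly_hom_pt by (simp add: upoly_hom_field_def)

lemma Q_LC: "Q \<subseteq> LC"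
proof (rule ideal_gen_minimal)
  show "(\<lambda>e. Fract (chart_coord i j e) 1) ` J \<subseteq> LC"
    using J chart_ring_chart_coord [OF ij] by (auto intro!: localized_chart_Fract_1)
qed (use LC_0 localized_chart_add [OF ij] localized_chart_mult [OF ij] in auto)

text \<open>If the restricted minor were 0, then u_kl itself would lie in \<open>Q\<close> and
  vanish at the point \<open>pt\<close>.\<close>

lemma Fm_nonzero:
  assumes "k \<in> {1..n}" "l \<in> {1..n}" "k \<noteq> l" "Upair k l \<notin> J"
  shows "Fm k l \<noteq> 0"
proof
  assume "Fm k l = 0"
  then have "Fract (chart_coord i j (Upair k l)) 1 \<in> Q"
    using signed_congruent [OF assms(1-3)] by (simp add: frac_eval_lvar)
  then have "Fract (chart_coord i j (Upair k l)) 1 \<in> radical_in LC Q"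
    using radical_contains Q_LC by blast
  moreover have "radical_in LC Q \<subseteq> vanishing_fractions pt"
    using J by (intro pt.radical_vanishing) (auto simp: pt_zero_iff)
  ultimately have "pt (chart_coord i j (Upair k l)) = 0"
    using pt.Fract_vanishing_iff [of 1] pt.hom_1 by auto
  then show False using pt_zero_iff [of "Upair k l"] assms by simp
qed

text \<open>\<open>sigma\<close> followed by the restriction to the stratum. It is defined as a
  substitution of its own because \<open>sz\<close> is multiplicative only on the localized
  ring.\<close>

definition rho :: "'k upoly \<Rightarrow> 'k ulaurent" where
  "rho = poly_subst const (\<lambda>e. sz (sub e))"

lemma upoly_hom_rho: "upoly_hom rho"
  unfolding rho_def by (rule upoly_hom_poly_subst) (simp_all add: const_simps)

lemma rho_const: "rho (const c) = const c"
  unfolding rho_def by (rule poly_subst_const) (simp_all add: const_simps)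

lemma rho_uvar: "rho (uvar e) = sz (sub e)"
  unfolding rho_def by (rule poly_subst_uvar) (simp_all add: const_simps)

sublocale rho: upoly_hom_field rho
  using upoly_hom_rho by (simp add: upoly_hom_field_def)

lemma rho_oriented_var:
  assumes "a \<in> {i, j}" "k \<in> L" shows "rho (oriented_var a k) = sz (phi a k)"
  unfolding oriented_var_eq rho.hom_mult rho_uvar sub_pair [OF assms]
    sz_mult [OF localized_ring_pair_sign phi_localized [OF assms(2,1)]] sz_pair_sign
    rho.hom_pair_sign [unfolded const_pair_sign] by simp

lemma Fm_minor:
  assumes "k \<in> {1..n}" "l \<in> {1..n}" "k \<noteq> l"
  shows "Fm k l = minor (\<lambda>a k. sz (phi a k)) k l"
proof -
  let ?u = "\<lambda>a k. sz (phi a k)"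
  have "k \<in> {1..n} \<longrightarrow> l \<in> {1..n} \<longrightarrow> k \<noteq> l \<longrightarrow> Fm k l = minor ?u k l"
  proof (rule chart_or_inner [OF assms])
    show "k \<in> {1..n} \<longrightarrow> l \<in> {1..n} \<longrightarrow> k \<noteq> l \<longrightarrow> Fm k l = minor ?u k l" if "k \<in> L" "l \<in> L"
    proof (intro impI)
      have ab: "i \<in> {i, j}" "j \<in> {i, j}" by auto
      note P = phi_localized [OF that(1) ab(1)] phi_localized [OF that(2) ab(1)]
        phi_localized [OF that(1) ab(2)] phi_localized [OF that(2) ab(2)]
      show "Fm k l = minor ?u k l"
        unfolding minor_inner [OF that] Fm_def
          sz_diff [OF localized_ring_mult [OF P(1) P(4)] localized_ring_mult [OF P(2) P(3)]]
          sz_mult [OF P(1) P(4)] sz_mult [OF P(2) P(3)] ..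
    qed
    show "l \<in> {1..n} \<longrightarrow> k \<in> {1..n} \<longrightarrow> l \<noteq> k \<longrightarrow> Fm l k = minor ?u l k"
      if "k \<in> {1..n} \<longrightarrow> l \<in> {1..n} \<longrightarrow> k \<noteq> l \<longrightarrow> Fm k l = minor ?u k l" for k l
      using that Fm_swap [of k l] minor_swap [of ?u l k] by simp
  qed (simp_all add: minor_ij Fm_def minor_chart sz_1)
  then show ?thesis using assms by blast
qed

lemma rho_chart_coord:
  assumes "k \<in> {1..n}" "l \<in> {1..n}" "k \<noteq> l"
  shows "rho (chart_coord i j (Upair k l)) = pair_sign k l * Fm k l"
  unfolding Fm_minor [OF assms] by (rule hom_chart_coord [OF upoly_hom_rho _ assms]) (rule rho_oriented_var)

lemma rho_lvar:
  assumes "e \<in> I - J" shows "rho (chart_coord i j e) = lvar e"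
proof -
  have "e \<in> pairs n" using I assms by blast
  then obtain k l where kl: "e = Upair k l" "k \<in> {1..n}" "l \<in> {1..n}" "k \<noteq> l" by (rule pairsE)
  then show ?thesis using rho_chart_coord [OF kl(2-4)] Fm_in_I [of k l] assms by (simp add: lv_def)
qed

text \<open>An ideal containing \<open>grass_ideal n i j J\<close> (in fact equal to it) in which membership can be tested.\<close>

definition stratum_ideal :: "'k ulaurent set" where
  "stratum_ideal = {f \<in> laurent_ring (torus_pairs n i j J). frac_eval i j f \<in> vanishing_fractions rho}"

text \<open>This hypothesis is later supplied by the Gauss norm: for a pair in \<open>J\<close> the
  bound on the minor is 0.\<close>

context
  assumes Fm_J: "\<And>k l. k \<in> {1..n} \<Longrightarrow> l \<in> {1..n} \<Longrightarrow> k \<noteq> l \<Longrightarrow> Upair k l \<in> J \<Longrightarrow> Fm k l = 0"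
begin

lemma rho_zero_iff:
  assumes "e \<in> pairs n" shows "rho (chart_coord i j e) = 0 \<longleftrightarrow> e \<in> J"
proof -
  obtain k l where kl: "e = Upair k l" "k \<in> {1..n}" "l \<in> {1..n}" "k \<noteq> l" using assms by (rule pairsE)
  have "pair_sign k l * Fm k l = 0 \<longleftrightarrow> Fm k l = 0" by (simp add: pair_sign_def)
  then show ?thesis using rho_chart_coord [OF kl(2-4)] Fm_J [OF kl(2-4)] Fm_nonzero [OF kl(2-4)] kl(1) by metis
qed

lemma grass_ideal_subset: "grass_ideal n i j J \<subseteq> stratum_ideal"
proof -
  have "radical_in LC Q \<subseteq> vanishing_fractions rho"
    using J by (intro rho.radical_vanishing) (auto simp: rho_zero_iff)
  then show ?thesis unfolding grass_ideal_def stratum_ideal_def by blast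
qed

lemma LC_regular: "LC \<subseteq> regular_fractions rho"
  by (rule rho.localized_chart_regular) (simp add: rho_zero_iff)

lemma laurent_ring_sub:
  "laurent_ring (torus_pairs n i j J) \<subseteq> localized_ring (pairs n) (pairs n - J)"
  "laurent_ring (torus_pairs n i j J) \<subseteq> localized_ring (pairs n) (pairs n)"
  unfolding laurent_ring_def by (rule localized_ring_mono; auto simp: torus_pairs_def)+

lemma stratum_ideal_add: "f \<in> stratum_ideal \<Longrightarrow> g \<in> stratum_ideal \<Longrightarrow> f + g \<in> stratum_ideal"
proof -
  assume f: "f \<in> stratum_ideal" and g: "g \<in> stratum_ideal"
  have "frac_eval i j (f + g) = frac_eval i j f + frac_eval i j g"
    using f g laurent_ring_sub(2) unfolding stratum_ideal_def by (intro ev_add) auto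
  moreover have "f + g \<in> laurent_ring (torus_pairs n i j J)"
    using f g unfolding stratum_ideal_def laurent_ring_def by (auto intro: localized_ring_add)
  ultimately show ?thesis using f g rho.vanishing_add unfolding stratum_ideal_def by simp
qed

lemma stratum_ideal_mult:
  "h \<in> laurent_ring (torus_pairs n i j J) \<Longrightarrow> f \<in> stratum_ideal \<Longrightarrow> h * f \<in> stratum_ideal"
proof -
  assume h: "h \<in> laurent_ring (torus_pairs n i j J)" and f: "f \<in> stratum_ideal"
  have "frac_eval i j (h * f) = frac_eval i j h * frac_eval i j f"
    using f h laurent_ring_sub(2) unfolding stratum_ideal_def by (intro ev_mult) auto
  moreover have "frac_eval i j h \<in> regular_fractions rho"
    using frac_eval_localized_chart [OF ij] laurent_ring_sub(1) h LC_regular by blast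
  moreover have "h * f \<in> laurent_ring (torus_pairs n i j J)"
    using f h unfolding stratum_ideal_def laurent_ring_def by (auto intro: localized_ring_mult)
  ultimately show ?thesis using f rho.vanishing_mult unfolding stratum_ideal_def by simp
qed

text \<open>Algebraic independence on the stratum: \<open>rho\<close> fixes the variables of
  \<open>I - J\<close>, so it recovers a polynomial in them from its value, and it kills the values
  of the stratum ideal.\<close>

lemma stratum_ideal_trivial:
  assumes g: "g \<in> localized_ring (I - J) (I - J)" "g \<in> stratum_ideal"
  shows "g = 0"
proof -
  obtain u v where u: "u * v = 1" "u \<in> localized_ring ((I - J) \<inter> (I - J)) {}"
    "u * g \<in> localized_ring (I - J) {}" using clear_denominators [OF g(1)] by blast
  have u2: "u \<in> localized_ring (I - J) {}" using u(2) by simp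
  have sub: "I - J \<subseteq> pairs n" using I by blast
  have lift: "\<exists>a. frac_eval i j g = Fract a 1 \<and> rho a = g" if "g \<in> localized_ring (I - J) {}" for g
    by (rule polynomial_lift [OF upoly_hom_rho _ sub _ that]) (auto intro: rho_const rho_lvar)
  obtain a where a: "frac_eval i j (u * g) = Fract a 1" "rho a = u * g" using lift [OF u(3)] by blast
  obtain b where b: "frac_eval i j u = Fract b 1" using lift [OF u2] by blast
  have "frac_eval i j (u * g) = frac_eval i j u * frac_eval i j g"
  proof (rule ev_mult)
    show "u \<in> localized_ring (pairs n) (pairs n)"
      using u2 localized_ring_mono [OF sub, of "{}" "pairs n"] by blast
    show "g \<in> localized_ring (pairs n) (pairs n)"
      using g(1) localized_ring_mono [OF sub sub] by blast
  qed
  then have "Fract a 1 \<in> vanishing_fractions rho"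
    using rho.vanishing_mult [OF rho.regular_Fract_1, of _ b] g(2) a(1) b unfolding stratum_ideal_def by simp
  then have "rho a = 0" using rho.Fract_vanishing_iff [of 1 a] rho.hom_1 by simp
  then have 0: "u * g = 0" using a(2) by simp
  have "(u * v) * g = v * (u * g)" by (simp only: mult_ac)
  then show ?thesis unfolding u(1) 0 by simp
qed

text \<open>The value already lies in the ideal generated by the coordinates in \<open>J\<close>, so
  exponent 1 shows membership in the radical.\<close>

lemma relation_in_grass_ideal:
  assumes "e \<in> torus_pairs n i j J"
  shows "(lvar e - f_coord n i j J I e :: 'k ulaurent) \<in> grass_ideal n i j J"
proof -
  have e: "e \<in> pairs n" using assms by (simp add: torus_pairs_def)
  obtain k l where kl: "e = Upair k l" "k \<in> {1..n}" "l \<in> {1..n}" "k \<noteq> l" using e by (rule pairsE)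
  have f: "(f_coord n i j J I e :: 'k ulaurent) = pair_sign k l * Fm k l" unfolding kl(1) by (rule f_coord_eq [OF kl(2-4)])
  have "frac_eval i j (lvar e - f_coord n i j J I e :: 'k ulaurent) \<in> Q"
    using signed_congruent [OF kl(2-4)] unfolding f unfolding kl(1) .
  then have "frac_eval i j (lvar e - f_coord n i j J I e :: 'k ulaurent) \<in> radical_in LC Q"
    using radical_contains Q_LC by blast
  moreover have "(lvar e - f_coord n i j J I e :: 'k ulaurent) \<in> laurent_ring (torus_pairs n i j J)"
  proof -
    have "localized_ring (I - J) (I - J) \<subseteq> laurent_ring (torus_pairs n i j J)"
      unfolding laurent_ring_def using I by (intro localized_ring_mono) (auto simp: torus_pairs_def)
    then have "Fm k l \<in> laurent_ring (torus_pairs n i j J)" using Fm_localized [OF kl(2-4)] by blast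
    then show ?thesis unfolding f laurent_ring_def
      using assms by (intro localized_ring_diff localized_ring_mult localized_ring_pair_sign localized_ring_lvar)
  qed
  ultimately show ?thesis unfolding grass_ideal_def by blast
qed

end

end

section \<open>Gauss norms and initial forms\<close>

lemma residue_class_add: "absv a \<le> 1 \<Longrightarrow> absv b \<le> 1 \<Longrightarrow> residue_class (a + b) = residue_class a + residue_class b"
  using absv_add [of a b]
  by (simp add: residue_class_def plus_residue_field.abs_eq residue_rel_def eq_onp_def)

lemma residue_class_mult: "absv a \<le> 1 \<Longrightarrow> absv b \<le> 1 \<Longrightarrow> residue_class (a * b) = residue_class a * residue_class b"
  by (simp add: residue_class_def times_residue_field.abs_eq residue_rel_def absv_mult mult_le_one absv_nonneg)

lemma residue_class_1: "residue_class 1 = 1"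
  by (simp add: residue_class_def one_residue_field.abs_eq)

lemma absv_eq_0_iff [simp]: "absv a = 0 \<longleftrightarrow> a = 0"
  by (simp add: absv_def)

lemma absv_power_int: "absv (a powi m) = absv a powi m"
proof -
  have pw: "absv (b ^ k) = absv b ^ k" for b :: 'a and k
    by (induction k) (simp_all add: absv_mult)
  show ?thesis by (simp add: power_int_def pw absv_inverse)
qed

lemma absv_prod: "absv (prod F A) = (\<Prod>x\<in>A. absv (F x))"
  by (induction A rule: infinite_finite_induct) (simp_all add: absv_mult)

lemma single_single_power:
  "Poly_Mapping.single (Poly_Mapping.single e z) b ^ m =
    Poly_Mapping.single (Poly_Mapping.single e (int m * z)) (b ^ m :: 'b::comm_ring_1)"
  by (induction m) (simp_all add: mult_single distrib_right flip: single_add)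

locale weights =
  fixes \<tau> :: "nat uprod \<Rightarrow> 'k::valued_field"
  assumes \<tau>: "\<And>e. \<tau> e \<noteq> 0"
begin

text \<open>The ball of radius \<rho> for the Gauss norm in which u_e has norm |\<tau>_e|. Only
  upper bounds are ever compared, so the balls stand in for the norm.\<close>

definition bounded_by :: "real \<Rightarrow> 'k ulaurent set" where
  "bounded_by \<rho> = {f. \<forall>\<alpha>. absv (Poly_Mapping.lookup f \<alpha> * monomial_at \<tau> \<alpha>) \<le> \<rho>}"

lemma monomial_nonzero: "monomial_at \<tau> \<alpha> \<noteq> 0"
  by (simp add: monomial_at_def \<tau>)

lemma monomial_add: "monomial_at \<tau> (\<alpha> + \<beta>) = monomial_at \<tau> \<alpha> * monomial_at \<tau> \<beta>"
  by (rule monomial_at_add) (simp add: \<tau>)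

lemma bounded_add:
  assumes "f \<in> bounded_by \<rho>" "g \<in> bounded_by \<rho>"
  shows "f + g \<in> bounded_by \<rho>"
proof -
  have "absv (Poly_Mapping.lookup (f + g) \<alpha> * monomial_at \<tau> \<alpha>) \<le> \<rho>" for \<alpha>
  proof -
    have "absv (Poly_Mapping.lookup (f + g) \<alpha> * monomial_at \<tau> \<alpha>) \<le>
      max (absv (Poly_Mapping.lookup f \<alpha> * monomial_at \<tau> \<alpha>)) (absv (Poly_Mapping.lookup g \<alpha> * monomial_at \<tau> \<alpha>))"
      unfolding lookup_add distrib_right by (rule absv_add)
    also have "\<dots> \<le> \<rho>" using assms by (simp add: bounded_by_def)
    finally show ?thesis .
  qed
  then show ?thesis by (simp add: bounded_by_def)
qed

lemma bounded_single: "0 \<le> \<rho> \<Longrightarrow> absv (a * monomial_at \<tau> \<alpha>) \<le> \<rho> \<Longrightarrow> Poly_Mapping.single \<alpha> a \<in> bounded_by \<rho>"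
  by (auto simp: bounded_by_def lookup_single when_def)

lemma bounded_0: "0 \<le> \<rho> \<Longrightarrow> 0 \<in> bounded_by \<rho>"
  by (simp add: bounded_by_def)

lemma bounded_const: "absv c \<le> \<rho> \<Longrightarrow> const c \<in> bounded_by \<rho>"
  using absv_nonneg [of c] unfolding const_def by (intro bounded_single) auto

lemma bounded_sum: "0 \<le> \<rho> \<Longrightarrow> (\<And>x. x \<in> A \<Longrightarrow> F x \<in> bounded_by \<rho>) \<Longrightarrow> sum F A \<in> bounded_by \<rho>"
  by (induction A rule: infinite_finite_induct) (auto simp: bounded_0 bounded_add)

lemma bounded_mult:
  assumes f: "f \<in> bounded_by \<rho>" and g: "g \<in> bounded_by \<sigma>" and nn: "0 \<le> \<rho>" "0 \<le> \<sigma>"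
  shows "f * g \<in> bounded_by (\<rho> * \<sigma>)"
proof -
  have "absv (Poly_Mapping.lookup f \<alpha> * Poly_Mapping.lookup g \<beta> * monomial_at \<tau> (\<alpha> + \<beta>)) \<le> \<rho> * \<sigma>" for \<alpha> \<beta>
  proof -
    have "Poly_Mapping.lookup f \<alpha> * Poly_Mapping.lookup g \<beta> * monomial_at \<tau> (\<alpha> + \<beta>) =
      (Poly_Mapping.lookup f \<alpha> * monomial_at \<tau> \<alpha>) * (Poly_Mapping.lookup g \<beta> * monomial_at \<tau> \<beta>)"
      by (simp add: monomial_add mult_ac)
    also have "absv \<dots> = absv (Poly_Mapping.lookup f \<alpha> * monomial_at \<tau> \<alpha>) *
      absv (Poly_Mapping.lookup g \<beta> * monomial_at \<tau> \<beta>)"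
      by (rule absv_mult)
    also have "\<dots> \<le> \<rho> * \<sigma>"
      using f g nn unfolding bounded_by_def by (intro mult_mono absv_nonneg) auto
    finally show ?thesis .
  qed
  then show ?thesis unfolding poly_mapping_mult_singles [of f g]
    using nn by (intro bounded_sum bounded_single) auto
qed

lemma bounded_mult_1: "f \<in> bounded_by 1 \<Longrightarrow> g \<in> bounded_by 1 \<Longrightarrow> f * g \<in> bounded_by 1"
  using bounded_mult [of f 1 g 1] by simp

lemma bounded_mono: "f \<in> bounded_by \<rho> \<Longrightarrow> \<rho> \<le> \<sigma> \<Longrightarrow> f \<in> bounded_by \<sigma>"
  unfolding bounded_by_def by (auto intro: order_trans)

lemma bounded_uminus: "f \<in> bounded_by \<rho> \<Longrightarrow> - f \<in> bounded_by \<rho>"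
  by (simp add: bounded_by_def)

lemma bounded_diff: "f \<in> bounded_by \<rho> \<Longrightarrow> g \<in> bounded_by \<rho> \<Longrightarrow> f - g \<in> bounded_by \<rho>"
  using bounded_add [of f \<rho> "- g"] bounded_uminus by simp

lemma bounded_lvar: "lvar e \<in> bounded_by (absv (\<tau> e))"
  unfolding lvar_def by (rule bounded_single) (simp_all add: absv_nonneg)

lemma bounded_linv: "linv e \<in> bounded_by (inverse (absv (\<tau> e)))"
  unfolding linv_def by (rule bounded_single) (simp_all add: absv_nonneg power_int_minus absv_inverse)

lemma bounded_zero_iff: "f \<in> bounded_by 0 \<longleftrightarrow> f = 0"
  using monomial_nonzero
  by (auto simp: bounded_by_def absv_nonneg order_antisym_conv poly_mapping_eq_iff fun_eq_iff)

text \<open>The initial form without normalization: a ring homomorphism on the unit ball, which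
  sends elements of norm below 1 to 0.\<close>

definition red :: "'k ulaurent \<Rightarrow> 'k residue_field ulaurent" where
  "red f = init_form \<tau> 1 f"

sublocale red: graded_hom "\<lambda>\<alpha> a. absv (a * monomial_at \<tau> \<alpha>) \<le> 1"
  "\<lambda>\<alpha> a. Poly_Mapping.single \<alpha> (residue_class (a * monomial_at \<tau> \<alpha>))"
proof
  fix \<alpha> \<beta> a b
  show "absv (0 * monomial_at \<tau> \<alpha>) \<le> 1" by simp
  {
    assume ab: "absv (a * monomial_at \<tau> \<alpha>) \<le> 1" "absv (b * monomial_at \<tau> \<alpha>) \<le> 1"
    then show "absv ((a + b) * monomial_at \<tau> \<alpha>) \<le> 1"
      using absv_add [of "a * monomial_at \<tau> \<alpha>" "b * monomial_at \<tau> \<alpha>"] by (simp add: distrib_right)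
    show "Poly_Mapping.single \<alpha> (residue_class ((a + b) * monomial_at \<tau> \<alpha>)) =
      Poly_Mapping.single \<alpha> (residue_class (a * monomial_at \<tau> \<alpha>)) +
      Poly_Mapping.single \<alpha> (residue_class (b * monomial_at \<tau> \<alpha>))"
      using ab by (simp add: distrib_right residue_class_add single_add)
  }
  have eq: "a * b * monomial_at \<tau> (\<alpha> + \<beta>) = (a * monomial_at \<tau> \<alpha>) * (b * monomial_at \<tau> \<beta>)"
    by (simp add: monomial_add mult_ac)
  assume ab: "absv (a * monomial_at \<tau> \<alpha>) \<le> 1" "absv (b * monomial_at \<tau> \<beta>) \<le> 1"
  then show "absv (a * b * monomial_at \<tau> (\<alpha> + \<beta>)) \<le> 1"
    unfolding eq absv_mult [of "a * monomial_at \<tau> \<alpha>"] by (intro mult_le_one absv_nonneg)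
  show "Poly_Mapping.single (\<alpha> + \<beta>) (residue_class (a * b * monomial_at \<tau> (\<alpha> + \<beta>))) =
      Poly_Mapping.single \<alpha> (residue_class (a * monomial_at \<tau> \<alpha>)) *
      Poly_Mapping.single \<beta> (residue_class (b * monomial_at \<tau> \<beta>))"
    unfolding eq using ab by (simp add: residue_class_mult mult_single)
qed

lemma red_ext: "red f = red.ext f"
  by (simp add: red_def init_form_def red.ext_def flip: monomial_at_def)

lemma red_valid: "red.valid f \<longleftrightarrow> f \<in> bounded_by 1"
  by (simp add: red.valid_def bounded_by_def)

lemma red_add: "f \<in> bounded_by 1 \<Longrightarrow> g \<in> bounded_by 1 \<Longrightarrow> red (f + g) = red f + red g"
  by (simp add: red_ext red.ext_add red_valid)

lemma red_mult: "f \<in> bounded_by 1 \<Longrightarrow> g \<in> bounded_by 1 \<Longrightarrow> red (f * g) = red f * red g"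
  by (simp add: red_ext red.ext_mult red_valid)

lemma red_diff: "f \<in> bounded_by 1 \<Longrightarrow> g \<in> bounded_by 1 \<Longrightarrow> red (f - g) = red f - red g"
  by (simp add: red_ext red.ext_diff red_valid bounded_uminus)

lemma init_form_eq_red:
  assumes "c \<noteq> 0" shows "init_form \<tau> c f = red (const c * f)"
proof -
  have "Poly_Mapping.keys (const c * f) = Poly_Mapping.keys f"
    using assms by (auto simp: in_keys_iff lookup_const_mult)
  then show ?thesis by (simp add: red_def init_form_def lookup_const_mult)
qed

lemma keys_red: "Poly_Mapping.keys (red f) \<subseteq> Poly_Mapping.keys f"
  unfolding red_def init_form_def
  by (rule order.trans [OF keys_sum]) (auto split: if_splits)

lemma red_laurent: "f \<in> laurent_ring S \<Longrightarrow> red f \<in> laurent_ring S"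
  using keys_red [of f] unfolding laurent_ring_def localized_ring_def by blast

text \<open>The rescaled variable u_e / \<tau>_e: its norm is one, so it is a unit of the unit ball,
  and it reduces to u_e.\<close>

definition nvar :: "nat uprod \<Rightarrow> 'k ulaurent" where
  "nvar e = const (inverse (\<tau> e)) * lvar e"

definition ninv :: "nat uprod \<Rightarrow> 'k ulaurent" where
  "ninv e = const (\<tau> e) * linv e"

lemma nvar_bounded: "nvar e \<in> bounded_by 1" and ninv_bounded: "ninv e \<in> bounded_by 1"
  using bounded_mult [OF bounded_const [OF order_refl] bounded_lvar, of "inverse (\<tau> e)" e]
    bounded_mult [OF bounded_const [OF order_refl] bounded_linv, of "\<tau> e" e]
  by (simp_all add: nvar_def ninv_def absv_nonneg absv_inverse \<tau>)

lemma nvar_ninv: "nvar e * ninv e = 1"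
proof -
  have "nvar e * ninv e = const (inverse (\<tau> e) * \<tau> e) * (lvar e * linv e)"
    unfolding nvar_def ninv_def const_simps by (simp only: mult_ac)
  then show ?thesis using \<tau> by (simp add: const_simps)
qed

lemma red_nvar: "red (nvar e) = lvar e"
proof -
  have "nvar e = Poly_Mapping.single (Poly_Mapping.single e 1) (inverse (\<tau> e))"
    by (simp add: nvar_def const_def lvar_def mult_single)
  then show ?thesis by (simp add: red_ext red.ext_single \<tau> residue_class_1 lvar_def)
qed

lemma single_normalized:
  "Poly_Mapping.single \<alpha> a = const (a * monomial_at \<tau> \<alpha>) * (\<Prod>e\<in>Poly_Mapping.keys \<alpha>.
     if 0 \<le> Poly_Mapping.lookup \<alpha> e then nvar e ^ nat (Poly_Mapping.lookup \<alpha> e)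
     else ninv e ^ nat (- Poly_Mapping.lookup \<alpha> e))"
proof -
  have n: "nvar e = Poly_Mapping.single (Poly_Mapping.single e 1) (inverse (\<tau> e))"
    "ninv e = Poly_Mapping.single (Poly_Mapping.single e (- 1)) (\<tau> e)" for e
    by (simp_all add: nvar_def ninv_def const_def lvar_def linv_def mult_single)
  have "(\<Prod>e\<in>Poly_Mapping.keys \<alpha>.
     if 0 \<le> Poly_Mapping.lookup \<alpha> e then nvar e ^ nat (Poly_Mapping.lookup \<alpha> e)
     else ninv e ^ nat (- Poly_Mapping.lookup \<alpha> e)) =
    (\<Prod>e\<in>Poly_Mapping.keys \<alpha>. Poly_Mapping.single (Poly_Mapping.single e (Poly_Mapping.lookup \<alpha> e))
      (inverse (\<tau> e powi Poly_Mapping.lookup \<alpha> e)))"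
    by (intro prod.cong) (auto simp: n single_single_power power_int_def power_inverse)
  also have "\<dots> = Poly_Mapping.single \<alpha> (inverse (monomial_at \<tau> \<alpha>))"
    by (simp add: monomial_at_def prod_inversef [symmetric] flip: single_sum_prod poly_mapping_sum_singles)
  finally show ?thesis using monomial_nonzero by (simp add: const_def mult_single mult.assoc)
qed

lemma absv_monomial:
  "absv (monomial_at \<tau> \<alpha>) = exp (\<Sum>e\<in>Poly_Mapping.keys \<alpha>. of_int (Poly_Mapping.lookup \<alpha> e) * ln (absv (\<tau> e)))"
proof -
  have "absv (\<tau> e) > 0" for e using \<tau> [of e] absv_nonneg [of "\<tau> e"] by (simp add: less_le)
  then have "absv (\<tau> e) powi m = exp (of_int m * ln (absv (\<tau> e)))" for e m
    by (simp add: exp_power_int [symmetric] mult.commute)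
  then show ?thesis by (simp add: monomial_at_def absv_prod absv_power_int exp_sum)
qed

lemma absv_term:
  assumes "a \<noteq> 0"
  shows "absv (a * monomial_at \<tau> \<alpha>) =
    exp (- val a + (\<Sum>e\<in>Poly_Mapping.keys \<alpha>. of_int (Poly_Mapping.lookup \<alpha> e) * ln (absv (\<tau> e))))"
proof -
  have "absv a = exp (- val a)" using assms by (simp add: absv_def)
  then show ?thesis by (simp only: absv_mult absv_monomial exp_add)
qed

end

lemma laurent_ring_closed:
  "f \<in> laurent_ring S \<Longrightarrow> g \<in> laurent_ring S \<Longrightarrow> f + g \<in> laurent_ring S"
  "f \<in> laurent_ring S \<Longrightarrow> g \<in> laurent_ring S \<Longrightarrow> f * g \<in> laurent_ring S"
  "f \<in> laurent_ring S \<Longrightarrow> g \<in> laurent_ring S \<Longrightarrow> f - g \<in> laurent_ring S"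
  "const c \<in> laurent_ring S" "1 \<in> laurent_ring S" "0 \<in> laurent_ring S"
  unfolding laurent_ring_def
  by (intro localized_ring_add localized_ring_mult localized_ring_diff localized_ring_const
    localized_ring_1 localized_ring_0; assumption)+

lemma laurent_ring_var: "e \<in> S \<Longrightarrow> lvar e \<in> laurent_ring S" "e \<in> S \<Longrightarrow> linv e \<in> laurent_ring S"
  unfolding laurent_ring_def by (simp_all add: localized_ring_lvar localized_ring_linv)

lemma laurent_ring_mono: "S \<subseteq> S' \<Longrightarrow> laurent_ring S \<subseteq> laurent_ring S'"
  unfolding laurent_ring_def by (rule localized_ring_mono)

section \<open>Division by the relations over the valuation ring\<close>

context weights
begin

lemma nvar_laurent: "e \<in> S \<Longrightarrow> nvar e \<in> laurent_ring S" and ninv_laurent: "e \<in> S \<Longrightarrow> ninv e \<in> laurent_ring S"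
  unfolding nvar_def ninv_def by (simp_all add: laurent_ring_closed laurent_ring_var)

lemma bounded_one: "1 \<in> bounded_by 1"
  using bounded_const [of 1 1] by (simp add: const_simps)

text \<open>The multiplier is a product of rescaled variables. It and its inverse have norm at most
  1, so passing to the product and back preserves the unit ball.\<close>

lemma clear_denominators_bounded:
  assumes "f \<in> localized_ring S S"
  shows "\<exists>w w'. w * w' = 1 \<and> w \<in> bounded_by 1 \<and> w' \<in> bounded_by 1 \<and> w \<in> laurent_ring S \<and>
    w' \<in> laurent_ring S \<and> w \<in> localized_ring S S' \<and> w * f \<in> localized_ring S S'"
  using assms
proof (induction rule: localized_induct)
  case (const c)
  show ?case by (intro exI [of _ 1])
    (simp add: bounded_one laurent_ring_closed localized_ring_const localized_ring_1)
next
  case (lvar e)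
  then show ?case by (intro exI [of _ 1])
    (simp add: bounded_one laurent_ring_closed localized_ring_lvar localized_ring_1)
next
  case (linv e)
  have "nvar e * linv e = const (inverse (\<tau> e))" by (simp add: nvar_def mult.assoc)
  moreover have "nvar e \<in> localized_ring S S'"
    unfolding nvar_def using linv by (simp add: localized_ring_const localized_ring_lvar localized_ring_mult)
  ultimately show ?case using linv
    by (intro exI [of _ "nvar e"] exI [of _ "ninv e"])
      (simp add: nvar_ninv nvar_bounded ninv_bounded nvar_laurent ninv_laurent localized_ring_const)
next
  case (add f g)
  obtain u u' where u: "u * u' = 1" "u \<in> bounded_by 1" "u' \<in> bounded_by 1" "u \<in> laurent_ring S"
    "u' \<in> laurent_ring S" "u \<in> localized_ring S S'" "u * f \<in> localized_ring S S'" using add.IH by blast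
  obtain v v' where v: "v * v' = 1" "v \<in> bounded_by 1" "v' \<in> bounded_by 1" "v \<in> laurent_ring S"
    "v' \<in> laurent_ring S" "v \<in> localized_ring S S'" "v * g \<in> localized_ring S S'" using add.IH by blast
  have 1: "u * v * (f + g) = v * (u * f) + u * (v * g)" by (simp add: algebra_simps)
  have 2: "u * v * (u' * v') = (u * u') * (v * v')" by (simp only: mult_ac)
  show ?case
  proof (intro exI conjI)
    show "u * v * (u' * v') = 1" using 2 u(1) v(1) by simp
    show "u * v * (f + g) \<in> localized_ring S S'"
      unfolding 1 using localized_ring_add [OF localized_ring_mult [OF v(6) u(7)] localized_ring_mult [OF u(6) v(7)]] .
  qed (use u v in \<open>simp_all add: bounded_mult_1 laurent_ring_closed localized_ring_mult\<close>)
next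
  case (mult f g)
  obtain u u' where u: "u * u' = 1" "u \<in> bounded_by 1" "u' \<in> bounded_by 1" "u \<in> laurent_ring S"
    "u' \<in> laurent_ring S" "u \<in> localized_ring S S'" "u * f \<in> localized_ring S S'" using mult.IH by blast
  obtain v v' where v: "v * v' = 1" "v \<in> bounded_by 1" "v' \<in> bounded_by 1" "v \<in> laurent_ring S"
    "v' \<in> laurent_ring S" "v \<in> localized_ring S S'" "v * g \<in> localized_ring S S'" using mult.IH by blast
  have 1: "u * v * (f * g) = (u * f) * (v * g)" by (simp only: mult_ac)
  have 2: "u * v * (u' * v') = (u * u') * (v * v')" by (simp only: mult_ac)
  show ?case
  proof (intro exI conjI)
    show "u * v * (u' * v') = 1" using 2 u(1) v(1) by simp
    show "u * v * (f * g) \<in> localized_ring S S'"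
      unfolding 1 using localized_ring_mult [OF u(7) v(7)] .
  qed (use u v in \<open>simp_all add: bounded_mult_1 laurent_ring_closed localized_ring_mult\<close>)
qed

text \<open>In the application \<open>S\<close> is the set of torus coordinates, \<open>S'\<close>
  is \<open>I - J\<close>, \<open>M\<close> is the ideal of the stratum and \<open>N\<close> the
  kernel ideal containing it. Reductions of integral elements of \<open>N\<close> are shown to lie
  in the ideal of reduced relations, while the relations themselves lie in \<open>M\<close>, so the
  inclusion of \<open>M\<close> in \<open>N\<close> is enough.\<close>

context
  fixes S S' :: "nat uprod set" and y :: "nat uprod \<Rightarrow> real" and M N :: "'k ulaurent set"
    and f :: "nat uprod \<Rightarrow> 'k ulaurent"
  assumes S': "S' \<subseteq> S"
    and y: "\<And>e. e \<in> S \<Longrightarrow> y e = ln (absv (\<tau> e))"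
    and M: "M \<subseteq> N"
    and N: "N \<subseteq> laurent_ring S" "\<And>g h. g \<in> N \<Longrightarrow> h \<in> N \<Longrightarrow> g + h \<in> N"
      "\<And>g h. g \<in> laurent_ring S \<Longrightarrow> h \<in> N \<Longrightarrow> g * h \<in> N"
    and trivial: "\<And>g. g \<in> localized_ring S' S' \<Longrightarrow> g \<in> N \<Longrightarrow> g = 0"
    and f: "\<And>e. e \<in> S - S' \<Longrightarrow> f e \<in> localized_ring S' S'"
      "\<And>e. e \<in> S - S' \<Longrightarrow> f e \<in> bounded_by (absv (\<tau> e))"
      "\<And>e. e \<in> S - S' \<Longrightarrow> lvar e - f e \<in> M"
begin

abbreviation (input) RI :: "'k residue_field ulaurent set" where
  "RI \<equiv> ideal_gen (laurent_ring S) {lvar e - init_form \<tau> (inverse (\<tau> e)) (f e) | e. e \<in> S - S'}"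

text \<open>What has to be remembered of an integral combination of the relations: it lies in
  \<open>N\<close>, is integral, and reduces into the expected ideal. These properties survive sums
  and integral multiples, so no coefficients need to be tracked.\<close>

definition small :: "'k ulaurent set" where
  "small = {h \<in> bounded_by 1 \<inter> N. red h \<in> RI}"

definition reducible :: "'k ulaurent set" where
  "reducible = {g \<in> bounded_by 1 \<inter> laurent_ring S. \<exists>g0 \<in> bounded_by 1 \<inter> localized_ring S' S'. g - g0 \<in> small}"

lemma RI_add: "a \<in> RI \<Longrightarrow> b \<in> RI \<Longrightarrow> a + b \<in> RI"
  by (rule ideal_gen_iff_add) (auto intro: laurent_ring_closed)

lemma RI_mult: "a \<in> laurent_ring S \<Longrightarrow> b \<in> RI \<Longrightarrow> a * b \<in> RI"
  by (rule ideal_gen_mult) (auto intro: laurent_ring_closed)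

lemma small_0: "0 \<in> small" if "N \<noteq> {}"
proof -
  obtain h where "h \<in> N" using \<open>N \<noteq> {}\<close> by blast
  then have "0 * h \<in> N" using N(3) laurent_ring_closed(6) by blast
  then show ?thesis unfolding small_def by (simp add: bounded_0 red_ext red.ext_0 ideal_gen_0)
qed

lemma small_add: "a \<in> small \<Longrightarrow> b \<in> small \<Longrightarrow> a + b \<in> small"
  using N(2) RI_add unfolding small_def by (simp add: bounded_add red_add)

lemma small_mult: "a \<in> bounded_by 1 \<Longrightarrow> a \<in> laurent_ring S \<Longrightarrow> b \<in> small \<Longrightarrow> a * b \<in> small"
  using N(3) RI_mult red_laurent [of a S] unfolding small_def by (simp add: bounded_mult_1 red_mult)

lemma S'_sub: "localized_ring S' S' \<subseteq> laurent_ring S"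
  unfolding laurent_ring_def using S' by (intro localized_ring_mono)

lemma relation_small: "e \<in> S - S' \<Longrightarrow> nvar e - const (inverse (\<tau> e)) * f e \<in> small"
proof -
  assume e: "e \<in> S - S'"
  have "const (inverse (\<tau> e)) * (lvar e - f e) \<in> N"
    using N(3) laurent_ring_closed(4) f(3) [OF e] M by blast
  moreover have eq: "const (inverse (\<tau> e)) * (lvar e - f e) = nvar e - const (inverse (\<tau> e)) * f e"
    by (simp add: nvar_def right_diff_distrib)
  moreover have b: "const (inverse (\<tau> e)) * f e \<in> bounded_by 1"
    using bounded_mult [OF bounded_const [OF order_refl] f(2) [OF e], of "inverse (\<tau> e)"] \<tau> [of e]
    by (simp add: absv_nonneg absv_inverse)
  moreover have "red (nvar e - const (inverse (\<tau> e)) * f e) = lvar e - init_form \<tau> (inverse (\<tau> e)) (f e)"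
    using \<tau> [of e] by (simp add: red_diff nvar_bounded b red_nvar init_form_eq_red)
  moreover have "lvar e - init_form \<tau> (inverse (\<tau> e)) (f e) \<in> RI"
    using e laurent_ring_closed(5) by (intro ideal_gen_generator) blast+
  ultimately show ?thesis unfolding small_def by (simp add: bounded_diff nvar_bounded)
qed

lemma reducible_self:
  assumes "N \<noteq> {}" "g \<in> bounded_by 1" "g \<in> localized_ring S' S'" shows "g \<in> reducible"
  unfolding reducible_def using assms S'_sub small_0 [OF assms(1)] by (auto intro: bexI [of _ g])

lemma reducible_add:
  assumes "a \<in> reducible" "b \<in> reducible" shows "a + b \<in> reducible"
proof -
  obtain a0 where a: "a \<in> bounded_by 1" "a \<in> laurent_ring S" "a0 \<in> bounded_by 1"
    "a0 \<in> localized_ring S' S'" "a - a0 \<in> small" using assms(1) unfolding reducible_def by blast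
  obtain b0 where b: "b \<in> bounded_by 1" "b \<in> laurent_ring S" "b0 \<in> bounded_by 1"
    "b0 \<in> localized_ring S' S'" "b - b0 \<in> small" using assms(2) unfolding reducible_def by blast
  have eq: "a + b - (a0 + b0) = (a - a0) + (b - b0)" by simp
  have "a + b - (a0 + b0) \<in> small" unfolding eq by (rule small_add [OF a(5) b(5)])
  then show ?thesis using a b unfolding reducible_def
    by (auto intro!: bexI [of _ "a0 + b0"] bounded_add laurent_ring_closed localized_ring_add)
qed

lemma reducible_mult:
  assumes "a \<in> reducible" "b \<in> reducible" shows "a * b \<in> reducible"
proof -
  obtain a0 where a: "a \<in> bounded_by 1" "a \<in> laurent_ring S" "a0 \<in> bounded_by 1"
    "a0 \<in> localized_ring S' S'" "a - a0 \<in> small" using assms(1) unfolding reducible_def by blast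
  obtain b0 where b: "b \<in> bounded_by 1" "b \<in> laurent_ring S" "b0 \<in> bounded_by 1"
    "b0 \<in> localized_ring S' S'" "b - b0 \<in> small" using assms(2) unfolding reducible_def by blast
  have b0S: "b0 \<in> laurent_ring S" using b(4) S'_sub by blast
  have eq: "a * b - a0 * b0 = a * (b - b0) + b0 * (a - a0)" by (simp add: algebra_simps)
  have "a * b - a0 * b0 \<in> small"
    unfolding eq by (rule small_add [OF small_mult [OF a(1,2) b(5)] small_mult [OF b(3) b0S a(5)]])
  then show ?thesis using a b unfolding reducible_def
    by (auto intro!: bexI [of _ "a0 * b0"] bounded_mult_1 laurent_ring_closed localized_ring_mult)
qed

text \<open>The reducible elements are closed under sums and products and contain the integral
  constants and the rescaled variables, those outside \<open>S'\<close> by the relations. Inverses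
  are available only inside \<open>S'\<close>, since f_e need not be invertible; this is why other
  denominators are cleared beforehand.\<close>

lemma all_reducible:
  assumes ne: "N \<noteq> {}" and g: "g \<in> bounded_by 1" "g \<in> localized_ring S S'"
  shows "g \<in> reducible"
proof -
  have cst: "const c \<in> reducible" if "absv c \<le> 1" for c
    using that by (intro reducible_self [OF ne] bounded_const localized_ring_const)
  have one: "1 \<in> reducible" using cst [of 1] by (simp add: const_simps)
  have var: "nvar e \<in> reducible" if "e \<in> S" for e
  proof (cases "e \<in> S'")
    case True
    then show ?thesis unfolding nvar_def
      by (intro reducible_self [OF ne] nvar_bounded [unfolded nvar_def] localized_ring_mult
        localized_ring_const localized_ring_lvar)
  next
    case False
    then have e: "e \<in> S - S'" using that by blast
    let ?g = "const (inverse (\<tau> e)) * f e"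
    have "?g \<in> bounded_by 1"
      using bounded_mult [OF bounded_const [OF order_refl] f(2) [OF e], of "inverse (\<tau> e)"] \<tau> [of e]
      by (simp add: absv_nonneg absv_inverse)
    moreover have "?g \<in> localized_ring S' S'"
      using f(1) [OF e] by (intro localized_ring_mult localized_ring_const)
    ultimately show ?thesis
      unfolding reducible_def using relation_small [OF e] nvar_bounded nvar_laurent [OF that] by blast
  qed
  have inv: "ninv e \<in> reducible" if "e \<in> S'" for e
    unfolding ninv_def using that
    by (intro reducible_self [OF ne] ninv_bounded [unfolded ninv_def] localized_ring_mult
        localized_ring_const localized_ring_linv)
  have pow: "a ^ m \<in> reducible" if "a \<in> reducible" for a m
    by (induction m) (use one that reducible_mult in auto)
  have pr: "prod F A \<in> reducible" if "\<And>x. x \<in> A \<Longrightarrow> F x \<in> reducible" for F :: "nat uprod \<Rightarrow> 'k ulaurent" and A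
    using that by (induction A rule: infinite_finite_induct) (use one reducible_mult in auto)
  have zero: "0 \<in> reducible" using cst [of 0] by (simp add: const_simps)
  have sm: "sum F A \<in> reducible" if "\<And>x. x \<in> A \<Longrightarrow> F x \<in> reducible"
    for F :: "(nat uprod \<Rightarrow>\<^sub>0 int) \<Rightarrow> 'k ulaurent" and A
    using that by (induction A rule: infinite_finite_induct) (use zero reducible_add in auto)
  have "(\<Sum>\<alpha>\<in>Poly_Mapping.keys g. Poly_Mapping.single \<alpha> (Poly_Mapping.lookup g \<alpha>)) \<in> reducible"
  proof (rule sm)
    fix \<alpha> assume \<alpha>: "\<alpha> \<in> Poly_Mapping.keys g"
    then have k: "Poly_Mapping.keys \<alpha> \<subseteq> S" "\<And>e. Poly_Mapping.lookup \<alpha> e < 0 \<Longrightarrow> e \<in> S'"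
      using g(2) by (auto simp: localized_ring_def)
    have "(\<Prod>e\<in>Poly_Mapping.keys \<alpha>. if 0 \<le> Poly_Mapping.lookup \<alpha> e
        then nvar e ^ nat (Poly_Mapping.lookup \<alpha> e) else ninv e ^ nat (- Poly_Mapping.lookup \<alpha> e)) \<in> reducible"
    proof (rule pr)
      fix e assume "e \<in> Poly_Mapping.keys \<alpha>"
      then have "e \<in> S" using k(1) by blast
      then show "(if 0 \<le> Poly_Mapping.lookup \<alpha> e then nvar e ^ nat (Poly_Mapping.lookup \<alpha> e)
          else ninv e ^ nat (- Poly_Mapping.lookup \<alpha> e)) \<in> reducible"
        using pow [OF var] pow [OF inv] k(2) [of e] by simp
    qed
    moreover have "const (Poly_Mapping.lookup g \<alpha> * monomial_at \<tau> \<alpha>) \<in> reducible"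
      using g(1) by (intro cst) (simp add: bounded_by_def)
    ultimately show "Poly_Mapping.single \<alpha> (Poly_Mapping.lookup g \<alpha>) \<in> reducible"
      unfolding single_normalized [of \<alpha> "Poly_Mapping.lookup g \<alpha>"] by (intro reducible_mult)
  qed
  then show ?thesis by (simp flip: poly_mapping_sum_singles)
qed

lemma red_in_RI:
  assumes g: "g \<in> N" "g \<in> bounded_by 1"
  shows "red g \<in> RI"
proof -
  have ne: "N \<noteq> {}" using g by blast
  have gS: "g \<in> localized_ring S S" using g(1) N(1) by (auto simp: laurent_ring_def)
  obtain w w' where w: "w * w' = 1" "w \<in> bounded_by 1" "w' \<in> bounded_by 1" "w \<in> laurent_ring S"
    "w' \<in> laurent_ring S" "w * g \<in> localized_ring S S'"
    using clear_denominators_bounded [OF gS, of S'] by blast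
  have "w * g \<in> reducible" by (rule all_reducible [OF ne bounded_mult_1 [OF w(2) g(2)] w(6)])
  then obtain g0 where g0: "g0 \<in> localized_ring S' S'" "w * g - g0 \<in> small"
    unfolding reducible_def by blast
  have wgN: "w * g \<in> N" using N(3) [OF w(4) g(1)] .
  \<comment> \<open>The remainder \<open>g0\<close> is the difference of \<open>w * g\<close> and
    \<open>w * g - g0\<close>, both in \<open>N\<close>; having only variables of \<open>S'\<close>,
    it is zero.\<close>
  have "const (- 1) * (w * g - g0) \<in> N"
    using N(3) [OF laurent_ring_closed(4)] g0(2) unfolding small_def by blast
  then have "w * g + const (- 1) * (w * g - g0) \<in> N" using N(2) wgN by blast
  then have "g0 \<in> N" by (simp add: const_simps)
  then have "g0 = 0" using trivial g0(1) by blast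
  then have "red (w * g) \<in> RI" using g0(2) unfolding small_def by simp
  then have "red w' * red (w * g) \<in> RI" using RI_mult red_laurent [OF w(5)] by blast
  moreover have "red w' * red (w * g) = red (w' * (w * g))"
    using w g by (simp add: red_mult bounded_mult_1)
  moreover have "w' * (w * g) = (w * w') * g" by (simp only: mult_ac)
  ultimately show ?thesis using w(1) by simp
qed

lemma trop_max_term:
  assumes g: "g \<in> laurent_ring S" and \<alpha>: "\<alpha> \<in> Poly_Mapping.keys g"
  shows "- val (Poly_Mapping.lookup g \<alpha>) + (\<Sum>e\<in>Poly_Mapping.keys \<alpha>. of_int (Poly_Mapping.lookup \<alpha> e) * y e) =
    ln (absv (Poly_Mapping.lookup g \<alpha> * monomial_at \<tau> \<alpha>))"
proof -
  have "Poly_Mapping.keys \<alpha> \<subseteq> S" using g \<alpha> by (simp add: laurent_ring_def localized_ring_def)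
  then have "(\<Sum>e\<in>Poly_Mapping.keys \<alpha>. of_int (Poly_Mapping.lookup \<alpha> e) * y e) =
    (\<Sum>e\<in>Poly_Mapping.keys \<alpha>. of_int (Poly_Mapping.lookup \<alpha> e) * ln (absv (\<tau> e)))"
    using y by (intro sum.cong) auto
  moreover have nz: "Poly_Mapping.lookup g \<alpha> \<noteq> 0" using \<alpha> by (simp add: in_keys_iff)
  ultimately show ?thesis unfolding absv_term [OF nz] ln_exp by simp
qed

lemma init_ideal_eq: "init_ideal S y \<tau> M = RI"
proof
  show "init_ideal S y \<tau> M \<subseteq> RI"
    unfolding init_ideal_def
  proof (rule ideal_gen_minimal)
    show "{init_form \<tau> c f |c f. f \<in> M \<and> f \<noteq> 0 \<and> c \<noteq> 0 \<and> val c = trop_max y f} \<subseteq> RI"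
    proof clarify
      fix c :: 'k and g :: "'k ulaurent"
      assume g: "g \<in> M" "g \<noteq> 0" and c: "c \<noteq> 0" "val c = trop_max y g"
      have gS: "g \<in> laurent_ring S" using g(1) M N(1) by blast
      have "const c * g \<in> bounded_by 1"
        unfolding bounded_by_def
      proof (intro CollectI allI)
        fix \<alpha>
        show "absv (Poly_Mapping.lookup (const c * g) \<alpha> * monomial_at \<tau> \<alpha>) \<le> 1"
        proof (cases "\<alpha> \<in> Poly_Mapping.keys g")
          case True
          \<comment> \<open>Every term of \<open>g\<close> has norm at most exp of the tropical
            maximum, which is the valuation of \<open>c\<close>; hence scaling by \<open>c\<close>
            brings it to norm at most 1.\<close>
          let ?t = "absv (Poly_Mapping.lookup g \<alpha> * monomial_at \<tau> \<alpha>)"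
          have "ln ?t \<le> val c"
            unfolding c(2) trop_max_def trop_max_term [OF gS True, symmetric]
            using True by (intro Max_ge imageI) auto
          moreover have "?t > 0" using True monomial_nonzero [of \<alpha>] absv_nonneg
            by (simp add: less_le in_keys_iff)
          ultimately have "?t \<le> exp (val c)" by (metis exp_le_cancel_iff exp_ln)
          moreover have "absv c = exp (- val c)" using c(1) by (simp add: absv_def)
          ultimately have "absv c * ?t \<le> exp (- val c) * exp (val c)" by simp
          then show ?thesis by (simp add: lookup_const_mult mult.assoc absv_mult flip: exp_add)
        qed (simp add: lookup_const_mult in_keys_iff)
      qed
      moreover have "const c * g \<in> N" using N(3) laurent_ring_closed(4) g(1) M by blast
      ultimately show "init_form \<tau> c g \<in> RI" using red_in_RI c(1) by (simp add: init_form_eq_red)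
    qed
  qed (use RI_add RI_mult ideal_gen_0 in auto)
next
  have "lvar e - init_form \<tau> (inverse (\<tau> e)) (f e) \<in> init_ideal S y \<tau> M" if e: "e \<in> S - S'" for e
  proof -
    let ?g = "lvar e - f e" and ?\<epsilon> = "Poly_Mapping.single e (1 :: int)"
    have gM: "?g \<in> M" using f(3) [OF e] .
    have gS: "?g \<in> laurent_ring S" using gM M N(1) by blast
    \<comment> \<open>\<open>f e\<close> has only variables of \<open>S'\<close>, so it cannot
      cancel the term u_e. That term attains the tropical maximum, so the inverse of \<tau>_e is a
      correct normalizing scalar for the relation.\<close>
    have "Poly_Mapping.lookup (f e) ?\<epsilon> = 0"
    proof (rule ccontr)
      assume "Poly_Mapping.lookup (f e) ?\<epsilon> \<noteq> 0"
      then have "?\<epsilon> \<in> Poly_Mapping.keys (f e)" by (simp add: in_keys_iff)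
      then have "Poly_Mapping.keys ?\<epsilon> \<subseteq> S'" using f(1) [OF e] unfolding localized_ring_def by blast
      then show False using e by simp
    qed
    then have lk: "Poly_Mapping.lookup ?g ?\<epsilon> = 1" by (simp add: lookup_minus lvar_def)
    then have key: "?\<epsilon> \<in> Poly_Mapping.keys ?g" by (simp add: in_keys_iff)
    have val: "val (inverse (\<tau> e)) = ln (absv (\<tau> e))"
    proof -
      have "val (inverse (\<tau> e)) + val (\<tau> e) = 0"
        using val_mult [of "inverse (\<tau> e)" "\<tau> e"] \<tau> [of e] by (simp add: val_1)
      then show ?thesis using \<tau> [of e] by (simp add: absv_def)
    qed
    have b: "?g \<in> bounded_by (absv (\<tau> e))" using bounded_diff [OF bounded_lvar f(2) [OF e]] .
    have "trop_max y ?g = ln (absv (\<tau> e))"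
      unfolding trop_max_def
    proof (rule Max_eqI)
      show "ln (absv (\<tau> e)) \<in> (\<lambda>\<alpha>. - val (Poly_Mapping.lookup ?g \<alpha>) +
        (\<Sum>e\<in>Poly_Mapping.keys \<alpha>. of_int (Poly_Mapping.lookup \<alpha> e) * y e)) ` Poly_Mapping.keys ?g"
        using trop_max_term [OF gS key] key by (intro image_eqI [of _ _ ?\<epsilon>]) (simp_all add: lk)
      fix z assume "z \<in> (\<lambda>\<alpha>. - val (Poly_Mapping.lookup ?g \<alpha>) +
        (\<Sum>e\<in>Poly_Mapping.keys \<alpha>. of_int (Poly_Mapping.lookup \<alpha> e) * y e)) ` Poly_Mapping.keys ?g"
      then obtain \<alpha> where \<alpha>: "\<alpha> \<in> Poly_Mapping.keys ?g"
        "z = ln (absv (Poly_Mapping.lookup ?g \<alpha> * monomial_at \<tau> \<alpha>))"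
        using trop_max_term [OF gS] by auto
      have "absv (Poly_Mapping.lookup ?g \<alpha> * monomial_at \<tau> \<alpha>) > 0"
        using \<alpha>(1) monomial_nonzero [of \<alpha>] absv_nonneg by (simp add: less_le in_keys_iff)
      moreover have "absv (Poly_Mapping.lookup ?g \<alpha> * monomial_at \<tau> \<alpha>) \<le> absv (\<tau> e)"
        using b by (simp add: bounded_by_def)
      ultimately show "z \<le> ln (absv (\<tau> e))" unfolding \<alpha>(2) by simp
    qed simp
    then have "init_form \<tau> (inverse (\<tau> e)) ?g \<in> init_ideal S y \<tau> M"
      unfolding init_ideal_def using gM key val \<tau> [of e] laurent_ring_closed(5)
      by (intro ideal_gen_generator) force+
    moreover have "init_form \<tau> (inverse (\<tau> e)) ?g = lvar e - init_form \<tau> (inverse (\<tau> e)) (f e)"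
    proof -
      have "const (inverse (\<tau> e)) * f e \<in> bounded_by 1"
        using bounded_mult [OF bounded_const [OF order_refl] f(2) [OF e], of "inverse (\<tau> e)"] \<tau> [of e]
        by (simp add: absv_nonneg absv_inverse)
      then have "red (nvar e - const (inverse (\<tau> e)) * f e) = lvar e - red (const (inverse (\<tau> e)) * f e)"
        by (simp add: red_diff nvar_bounded red_nvar)
      then show ?thesis using \<tau> [of e] by (simp add: init_form_eq_red right_diff_distrib nvar_def)
    qed
    ultimately show ?thesis by simp
  qed
  then show "RI \<subseteq> init_ideal S y \<tau> M"
    unfolding init_ideal_def
    by (intro ideal_gen_minimal ideal_gen_0 ideal_gen_iff_add ideal_gen_mult) (auto intro: laurent_ring_closed)
qed

end

end

section \<open>Bounds for the restricted coordinates\<close>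

text \<open>X k l stands for exp(x_kl - x_ij), the bound to be proved for the Gauss norm of f_kl.
  The inequalities are those of the closed tree cone divided by the value at ij, and
  \<open>below\<close> is the strict order on the leaves.\<close>

locale tropical_basis = pluecker_field n i j J I pred rk K + weights \<tau>
  for n i j :: nat and J I :: "nat uprod set" and pred rk :: "nat \<Rightarrow> nat"
    and K :: "'k::valued_field itself" and \<tau> :: "nat uprod \<Rightarrow> 'k" +
  fixes X :: "nat \<Rightarrow> nat \<Rightarrow> real" and below :: "nat \<Rightarrow> nat \<Rightarrow> bool" and \<beta> :: "nat \<Rightarrow> 'v"
  assumes X_sym: "X k l = X l k" and X_ij: "X i j = 1"
    and X_J: "k \<in> {1..n} \<Longrightarrow> l \<in> {1..n} \<Longrightarrow> k \<noteq> l \<Longrightarrow> Upair k l \<in> J \<Longrightarrow> X k l = 0"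
    and X_\<tau>: "k \<in> {1..n} \<Longrightarrow> l \<in> {1..n} \<Longrightarrow> k \<noteq> l \<Longrightarrow> Upair k l \<notin> J \<Longrightarrow> Upair k l \<noteq> Upair i j \<Longrightarrow>
      X k l = absv (\<tau> (Upair k l))"
    and diff_branch: "k \<in> L \<Longrightarrow> l \<in> L \<Longrightarrow> \<beta> k \<noteq> \<beta> l \<Longrightarrow> X i k * X j l \<le> X k l"
    and same_branch: "k \<in> L \<Longrightarrow> l \<in> L \<Longrightarrow> \<beta> k = \<beta> l \<Longrightarrow> k \<noteq> l \<Longrightarrow>
      X k l \<le> X i k * X j l \<and> X i k * X j l = X i l * X j k"
    and chain: "below k l \<Longrightarrow> below l m \<Longrightarrow> X i k * X l m \<le> X k m * X i l \<and> X i m * X k l \<le> X k m * X i l"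
    and below: "below k l \<Longrightarrow> k \<in> L \<and> l \<in> L \<and> k \<noteq> l \<and> \<beta> k = \<beta> l"
    and total: "k \<in> L \<Longrightarrow> l \<in> L \<Longrightarrow> \<beta> k = \<beta> l \<Longrightarrow> k \<noteq> l \<Longrightarrow> below k l \<or> below l k"
    and pred_below: "k \<in> L \<Longrightarrow> a \<in> {i, j} \<Longrightarrow> Upair a k \<notin> I \<Longrightarrow> below (pred k) k"
    and pred_nondeg: "k \<in> L \<Longrightarrow> a \<in> {i, j} \<Longrightarrow> Upair a k \<notin> I \<Longrightarrow> X i (pred k) \<noteq> 0 \<and> X j (pred k) \<noteq> 0"
    and pred_max: "k \<in> L \<Longrightarrow> a \<in> {i, j} \<Longrightarrow> Upair a k \<notin> I \<Longrightarrow> below l k \<Longrightarrow> X i l \<noteq> 0 \<Longrightarrow> X j l \<noteq> 0 \<Longrightarrow>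
      l = pred k \<or> below l (pred k)"
    and below_both: "k \<in> L \<Longrightarrow> Upair i k \<in> I \<Longrightarrow> Upair j k \<in> I \<Longrightarrow> below l k \<Longrightarrow> X i l = 0 \<or> X j l = 0"
begin

lemma X_nonneg:
  assumes "k \<in> {1..n}" "l \<in> {1..n}" "k \<noteq> l" shows "0 \<le> X k l"
proof -
  consider "Upair k l \<in> J" | "Upair k l = Upair i j" | "Upair k l \<notin> J" "Upair k l \<noteq> Upair i j" by blast
  then show ?thesis
  proof cases
    case 2
    then have "X k l = X i j" using X_sym by auto
    then show ?thesis by (simp add: X_ij)
  qed (use X_J X_\<tau> assms absv_nonneg in simp_all)
qed

lemma bounded_pair_sign: "pair_sign k l \<in> bounded_by 1"
  using bounded_const [of "pair_sign k l" 1] by (simp add: const_pair_sign) (simp add: pair_sign_def)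

lemma bounded_lv:
  assumes "Upair k l \<in> I - J"
  shows "lv k l \<in> bounded_by (X k l)" "lvi k l \<in> bounded_by (inverse (X k l))" "X k l > 0"
proof -
  have kl: "k \<in> {1..n}" "l \<in> {1..n}" "k \<noteq> l" using assms I by auto
  have "Upair k l \<notin> J" using assms by simp
  moreover have "Upair k l \<noteq> Upair i j" using assms I(2) by (metis DiffD1)
  ultimately have X: "X k l = absv (\<tau> (Upair k l))" by (rule X_\<tau> [OF kl])
  then show pos: "X k l > 0" using \<tau> absv_nonneg by (simp add: less_le)
  show "lv k l \<in> bounded_by (X k l)"
    using bounded_mult [OF bounded_pair_sign bounded_lvar] pos unfolding lv_def X
    by (simp add: absv_nonneg)
  show "lvi k l \<in> bounded_by (inverse (X k l))"
    using bounded_mult [OF bounded_pair_sign bounded_linv] pos unfolding lvi_def X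
    by (simp add: absv_nonneg)
qed

lemma Fm_bounded_I:
  assumes "Upair k l \<in> I" shows "Fm k l \<in> bounded_by (X k l)"
proof -
  have kl: "k \<in> {1..n}" "l \<in> {1..n}" "k \<noteq> l" using assms I by auto
  show ?thesis
    using assms bounded_lv [of k l] X_nonneg [OF kl] by (simp add: Fm_in_I bounded_0)
qed

text \<open>For bt in \<open>I - J\<close> the restricted minor is a signed variable, hence
  invertible, and dividing by it divides the bound by X b t exactly.\<close>

lemma divide_bounded:
  assumes "f * Fm b t = g" "g \<in> bounded_by \<rho>" "0 \<le> \<rho>" "Upair b t \<in> I - J" "\<rho> \<le> \<sigma> * X b t"
  shows "f \<in> bounded_by \<sigma>"
proof -
  have "f = g * lvi b t"
    using assms(1,4) by (simp add: Fm_in_I mult.assoc flip: assms(1))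
  moreover have "g * lvi b t \<in> bounded_by (\<rho> * inverse (X b t))"
    using bounded_lv [OF assms(4)] by (intro bounded_mult assms) auto
  moreover have "\<rho> * inverse (X b t) \<le> \<sigma>"
    using bounded_lv(3) [OF assms(4)] assms(5) by (simp add: field_simps)
  ultimately show ?thesis using bounded_mono by blast
qed

lemma X_same_other:
  assumes "k \<in> L" "l \<in> L" "\<beta> k = \<beta> l" "k \<noteq> l" "a \<in> {i, j}"
  shows "X k l \<le> X a k * X (other a) l" "X a k * X (other a) l = X a l * X (other a) k"
  using same_branch [OF assms(1-4)] same_branch [OF assms(2,1)] assms(3-5) ij(3) X_sym [of k l]
  by (auto simp: other_def mult.commute)

lemma mult_bounded:
  "f \<in> bounded_by \<rho> \<Longrightarrow> g \<in> bounded_by \<sigma> \<Longrightarrow> 0 \<le> \<rho> \<Longrightarrow> 0 \<le> \<sigma> \<Longrightarrow> \<rho> * \<sigma> \<le> \<kappa> \<Longrightarrow> f * g \<in> bounded_by \<kappa>"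
  using bounded_mult bounded_mono by blast

text \<open>Since \<open>k\<close> and t = \<open>pred k\<close> share a branch, the relation
  expressing u_ak u_bt has both terms bounded by X a k * X b t: one by the inequality of the branch,
  the other by its equality.\<close>

lemma Fm_bounded_chart:
  assumes "k \<in> L" "a \<in> {i, j}" shows "Fm a k \<in> bounded_by (X a k)"
  using assms
proof (induction rule: phi_induct)
  case (inI k a)
  then show ?case by (intro Fm_bounded_I)
next
  case (notinI k a)
  let ?b = "other a" and ?t = "pred k"
  have b: "?b \<in> {i, j}" "a \<noteq> ?b" using ij(3) notinI(2) by (auto simp: other_def)
  have below: "\<beta> ?t = \<beta> k" "?t \<noteq> k" using below [OF pred_below [OF notinI(1-3)]] by auto
  have in_n: "a \<in> {1..n}" "?b \<in> {1..n}" "k \<in> {1..n}" "?t \<in> {1..n}" "distinct [a, ?b, k, ?t]"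
    using notinI b below ij by auto
  have eq: "Fm a k * Fm ?b ?t = Fm a ?b * Fm k ?t + Fm a ?t * Fm ?b k"
    using Fm_pluecker [OF in_n] by simp
  have bd: "Fm a ?b * Fm k ?t + Fm a ?t * Fm ?b k \<in> bounded_by (X a k * X ?b ?t)"
  proof (rule bounded_add)
    have ab: "Fm a ?b \<in> bounded_by 1"
      using notinI(2) ij Fm_ij Fm_swap [of i j] bounded_one bounded_uminus [OF bounded_one]
      by (auto simp: other_def)
    show "Fm a ?b * Fm k ?t \<in> bounded_by (X a k * X ?b ?t)"
      using X_same_other(1) [OF notinI(1,4) below(1) [symmetric] not_sym [OF below(2)] notinI(2)]
        X_nonneg [OF in_n(3,4)] below
      by (intro mult_bounded [OF ab Fm_bounded_I [OF notinI(8)]]) auto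
    show "Fm a ?t * Fm ?b k \<in> bounded_by (X a k * X ?b ?t)"
      using X_same_other(2) [OF notinI(1,4) below(1) [symmetric] not_sym [OF below(2)] notinI(2)]
        X_nonneg [OF in_n(1,4)] X_nonneg [OF in_n(2,3)] in_n(5)
      by (intro mult_bounded [OF notinI(9) Fm_bounded_I [OF notinI(5)]]) auto
  qed
  have "0 \<le> X a k" "0 \<le> X ?b ?t"
    using in_n(5) by (auto intro!: X_nonneg [OF in_n(1,3)] X_nonneg [OF in_n(2,4)])
  then show ?case
    using notinI(6,7) by (intro divide_bounded [OF eq bd _ _ order_refl]) auto
qed

lemma Fm_inner:
  assumes "k \<in> L" "l \<in> L" "k \<noteq> l" shows "Fm k l = Fm i k * Fm j l - Fm i l * Fm j k"
proof -
  have "Fm i j * Fm k l = Fm i k * Fm j l - Fm i l * Fm j k"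
    using assms ij by (intro Fm_pluecker) auto
  then show ?thesis by (simp add: Fm_ij)
qed

lemma Fm_inner_bounded:
  assumes kl: "k \<in> L" "l \<in> L" "k \<noteq> l" and le: "X i k * X j l \<le> \<rho>" "X i l * X j k \<le> \<rho>"
  shows "Fm k l \<in> bounded_by \<rho>"
proof -
  have nn: "0 \<le> X i k" "0 \<le> X j l" "0 \<le> X i l" "0 \<le> X j k"
    using kl ij by (auto intro!: X_nonneg)
  show ?thesis unfolding Fm_inner [OF kl]
    using kl(1,2) le nn by (intro bounded_diff mult_bounded [OF Fm_bounded_chart Fm_bounded_chart]) auto
qed

text \<open>The cherry property yields the inequalities at \<open>i\<close>. On one branch the ratio
  of X i and X j is constant, so they transfer to \<open>j\<close> after cancelling the nonzero X i
  t.\<close>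

lemma chain_end:
  assumes l: "below l t" "below t k" and t: "X i t \<noteq> 0" "X j t \<noteq> 0" and b: "b \<in> {i, j}"
  shows "X b k * X t l \<le> X k l * X b t" "X b l * X t k \<le> X k l * X b t"
proof -
  have tl: "t \<in> L" "l \<in> L" "\<beta> t = \<beta> l" "t \<noteq> l" and tk: "t \<in> L" "k \<in> L" "\<beta> t = \<beta> k" "t \<noteq> k"
    using below [OF l(1)] below [OF l(2)] by auto
  have i1: "X i k * X t l \<le> X k l * X i t" and i2: "X i l * X t k \<le> X k l * X i t"
    using chain [OF l] X_sym [of l k] X_sym [of l t] by (simp_all add: mult_ac)
  have pos: "X i t > 0" "X j t > 0"
    using X_nonneg [of i t] X_nonneg [of j t] t tl(1) ij by auto
  have e1: "X i t * X j k = X i k * X j t" and e2: "X i t * X j l = X i l * X j t"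
    using same_branch [OF tk] same_branch [OF tl] by auto
  have "X i t * (X j k * X t l) = (X i k * X t l) * X j t" using e1 by (simp add: mult_ac) 
  also have "\<dots> \<le> X k l * X i t * X j t" using i1 pos by (intro mult_right_mono) auto
  finally have "X i t * (X j k * X t l) \<le> X i t * (X k l * X j t)" by (simp add: mult_ac)
  then have j1: "X j k * X t l \<le> X k l * X j t" using pos by simp
  have "X i t * (X j l * X t k) = (X i l * X t k) * X j t" using e2 by (simp add: mult_ac)
  also have "\<dots> \<le> X k l * X i t * X j t" using i2 pos by (intro mult_right_mono) auto
  finally have "X i t * (X j l * X t k) \<le> X i t * (X k l * X j t)" by (simp add: mult_ac)
  then have j2: "X j l * X t k \<le> X k l * X j t" using pos by simp
  show "X b k * X t l \<le> X k l * X b t" "X b l * X t k \<le> X k l * X b t"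
    using b i1 i2 j1 j2 by auto
qed

lemma Fm_bounded_below:
  assumes "below l k" shows "Fm k l \<in> bounded_by (X k l)"
  using assms
proof (induction "rk k" arbitrary: k rule: less_induct)
  case less
  have kl: "k \<in> L" "l \<in> L" "k \<noteq> l" "\<beta> k = \<beta> l" using below [OF less.prems] by auto
  have in_n: "k \<in> {1..n}" "l \<in> {1..n}" using kl by auto
  show ?case
  proof (cases "X i k = 0 \<or> X j k = 0 \<or> X i l = 0 \<or> X j l = 0")
    case True
    \<comment> \<open>On a branch the two products of the minor have equal bounds, so a single
      vanishing factor makes both zero.\<close>
    then have "X i k * X j l = 0" "X i l * X j k = 0" using same_branch [OF kl(1,2,4,3)] by auto
    then show ?thesis using kl X_nonneg [OF in_n kl(3)] by (intro Fm_inner_bounded) auto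
  next
    case False
    \<comment> \<open>If both chart pairs of \<open>k\<close> were in \<open>I\<close>, condition
      (i) would make \<open>l\<close> below it degenerate, contrary to the present case.\<close>
    then obtain a where a: "a \<in> {i, j}" "Upair a k \<notin> I"
      using below_both [OF kl(1) _ _ less.prems] by blast
    note p = pred [OF kl(1) other [OF a(1)] a(2)]
    let ?t = "pred k" and ?b = "other a"
    show ?thesis
    proof (cases "l = ?t")
      case True
      then show ?thesis using p by (intro Fm_bounded_I) simp
    next
      case False
      then have lt: "below l ?t" using pred_max [OF kl(1) a less.prems] \<open>\<not> (X i k = 0 \<or> _)\<close> by blast
      have tk: "below ?t k" using pred_below [OF kl(1) a] .
      have b: "?b \<in> {i, j}" by (simp add: other_def)
      have "?t \<in> L" "?t \<noteq> k" "l \<noteq> ?t" using below [OF tk] below [OF lt] by blast+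
      moreover have "?b \<notin> L" using b by blast
      ultimately have tn: "?t \<in> {1..n}" "?b \<in> {1..n}" "distinct [?b, ?t, k, l]"
        using ij(1,2) kl(1-3) unfolding other_def distinct.simps list.set by (blast, simp, metis insertE empty_iff)
      have "Fm ?b ?t * Fm k l = Fm ?b k * Fm ?t l - Fm ?b l * Fm ?t k"
        by (rule Fm_pluecker [OF tn(2,1) in_n tn(3)])
      then have "Fm k l * Fm ?b ?t = Fm ?b k * Fm ?t l - Fm ?b l * Fm ?t k" by (simp add: mult.commute)
      then have eq: "Fm k l * Fm ?b ?t = Fm ?b k * Fm ?t l - Fm ?b l * Fm ?t k" .
      have bd: "Fm ?b k * Fm ?t l - Fm ?b l * Fm ?t k \<in> bounded_by (X k l * X ?b ?t)"
      proof (rule bounded_diff)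
        note ce = chain_end [OF lt tk _ _ b]
        have nd: "X i ?t \<noteq> 0" "X j ?t \<noteq> 0" using pred_nondeg [OF kl(1) a] by auto
        have U: "Upair ?t k = Upair k ?t" by simp
        have Utk: "Upair ?t k \<in> I" unfolding U using p by blast
        show "Fm ?b k * Fm ?t l \<in> bounded_by (X k l * X ?b ?t)"
          using X_nonneg [OF tn(2) in_n(1)] X_nonneg [OF tn(1) in_n(2)] tn(3) ce(1) [OF nd] p lt
          by (intro mult_bounded [OF Fm_bounded_chart [OF kl(1) b] less.hyps]) auto
        show "Fm ?b l * Fm ?t k \<in> bounded_by (X k l * X ?b ?t)"
          using X_nonneg [OF tn(2) in_n(2)] X_nonneg [OF tn(1) in_n(1)] tn(3) ce(2) [OF nd]
          by (intro mult_bounded [OF Fm_bounded_chart [OF kl(2) b] Fm_bounded_I [OF Utk]]) auto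
      qed
      have "0 \<le> X k l" "0 \<le> X ?b ?t"
        using tn(3) by (auto intro!: X_nonneg [OF in_n kl(3)] X_nonneg [OF tn(2,1)])
      then show ?thesis using p by (intro divide_bounded [OF eq bd _ _ order_refl]) auto
    qed
  qed
qed

text \<open>For leaves of different branches each product in the 2 x 2 minor is already bounded by X
  k l; within a branch the order decides which of the two leaves to induct on.\<close>

lemma Fm_bounded:
  assumes "k \<in> {1..n}" "l \<in> {1..n}" "k \<noteq> l"
  shows "Fm k l \<in> bounded_by (X k l)"
proof -
  have "k \<in> {1..n} \<longrightarrow> l \<in> {1..n} \<longrightarrow> k \<noteq> l \<longrightarrow> Fm k l \<in> bounded_by (X k l)"
  proof (rule chart_or_inner [OF assms])
    show "l \<in> {1..n} \<longrightarrow> k \<in> {1..n} \<longrightarrow> l \<noteq> k \<longrightarrow> Fm l k \<in> bounded_by (X l k)"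
      if "k \<in> {1..n} \<longrightarrow> l \<in> {1..n} \<longrightarrow> k \<noteq> l \<longrightarrow> Fm k l \<in> bounded_by (X k l)" for k l
      using that Fm_swap [of k l] X_sym [of k l] bounded_uminus by auto
    show "k \<in> {1..n} \<longrightarrow> l \<in> {1..n} \<longrightarrow> k \<noteq> l \<longrightarrow> Fm k l \<in> bounded_by (X k l)"
      if kl: "k \<in> L" "l \<in> L"
    proof (intro impI)
      assume ne: "k \<noteq> l"
      show "Fm k l \<in> bounded_by (X k l)"
      proof (cases "\<beta> k = \<beta> l")
        case True
        then consider "below l k" | "below k l" using total [OF kl True ne] by blast
        then show ?thesis
        proof cases
          case 2
          then show ?thesis
            using Fm_bounded_below [OF 2] Fm_swap [of l k] ne kl X_sym [of k l] bounded_uminus by auto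
        qed (rule Fm_bounded_below)
      next
        case False
        then show ?thesis
          using diff_branch [OF kl False] diff_branch [OF kl(2,1)] X_sym [of k l] kl ne
          by (intro Fm_inner_bounded) auto
      qed
    qed
    show "i \<in> {1..n} \<longrightarrow> j \<in> {1..n} \<longrightarrow> i \<noteq> j \<longrightarrow> Fm i j \<in> bounded_by (X i j)"
      by (simp add: Fm_ij X_ij bounded_one)
  qed (use Fm_bounded_chart in blast)
  then show ?thesis using assms by blast
qed

end

section \<open>A rational point of the stratum\<close>

text \<open>Elements of valuation 0, 1, 2, ... are distinct.\<close>

lemma infinite_valued_field:
  assumes "val ` (UNIV - {0 :: 'k::valued_field}) = UNIV"
  shows "\<exists>\<iota> :: nat \<Rightarrow> 'k. inj \<iota>"
proof -
  have "\<forall>m::nat. \<exists>a::'k. val a = real m"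
  proof
    fix m :: nat
    have "real m \<in> val ` (UNIV - {0 :: 'k})" unfolding assms by simp
    then show "\<exists>a::'k. val a = real m" by auto
  qed
  then obtain \<iota> :: "nat \<Rightarrow> 'k" where "\<And>m. val (\<iota> m) = real m" by metis
  then have "inj \<iota>" by (metis injI of_nat_eq_iff)
  then show ?thesis by blast
qed

definition det2 :: "(nat \<Rightarrow> 'b) \<Rightarrow> (nat \<Rightarrow> 'b) \<Rightarrow> nat \<Rightarrow> nat \<Rightarrow> 'b::comm_ring_1" where
  "det2 a b k l = a k * b l - a l * b k"

lemma det2_pluecker: "det2 a b p q * det2 a b k l = det2 a b p k * det2 a b q l - det2 a b p l * det2 a b q k"
  by (simp add: det2_def algebra_simps)

context
  fixes \<gamma> :: "'k::valued_field upoly \<Rightarrow> real" and n i j :: nat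
  assumes \<gamma>: "\<gamma> \<in> berkovich_chart n i j" and ij: "i \<in> {1..n}" "j \<in> {1..n}" "i \<noteq> j"
begin

lemma seminorm:
  assumes "f \<in> chart_ring n i j" "g \<in> chart_ring n i j"
  shows "0 \<le> \<gamma> f" "\<gamma> (f * g) = \<gamma> f * \<gamma> g" "\<gamma> (f + g) \<le> max (\<gamma> f) (\<gamma> g)" "\<gamma> (const c) = absv c"
  using \<gamma> assms unfolding berkovich_chart_def const_def by blast+

lemma seminorm_uminus: "f \<in> chart_ring n i j \<Longrightarrow> \<gamma> (- f) = \<gamma> f"
  using seminorm(2) [OF chart_ring_const, of f "-1"] seminorm(4) [of 0 0 "-1"]
  by (simp add: const_simps chart_ring_def)

lemma seminorm_pair_sign: "f \<in> chart_ring n i j \<Longrightarrow> \<gamma> (pair_sign k l * f) = \<gamma> f"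
  by (simp add: pair_sign_def seminorm_uminus)

abbreviation (input) "dt \<equiv> det2 (col_A i j) (col_B i j)"

lemma dt_chart_ring:
  assumes "k \<in> {1..n}" "l \<in> {1..n}" shows "dt k l \<in> (chart_ring n i j :: 'k upoly set)"
proof (cases "k = l")
  case True
  then show ?thesis by (simp add: det2_def chart_ring_def)
next
  case False
  then have e: "Upair k l \<in> pairs n" using assms by simp
  have "(dt k l :: 'k upoly) = pair_sign k l * chart_coord i j (Upair k l)"
    by (simp add: chart_coord_minor [OF ij(3) False] det2_def)
  then show ?thesis using chart_ring_mult [OF chart_ring_pair_sign chart_ring_chart_coord [OF ij e]] by simp
qed

lemma seminorm_chart_coord:
  assumes "k \<in> {1..n}" "l \<in> {1..n}" "k \<noteq> l"
  shows "\<gamma> (chart_coord i j (Upair k l)) = \<gamma> (dt k l)"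
  unfolding chart_coord_minor [OF ij(3) assms(3)] det2_def [symmetric]
  using dt_chart_ring [OF assms(1,2)] by (rule seminorm_pair_sign)

text \<open>Parallelism to a nonloop \<open>p\<close> is transitive in the rank-two matroid of the
  seminorm: the relation of p, q, k, l together with the ultrametric inequality forces the product
  with the nonzero value at pq to vanish.\<close>

lemma parallel_trans:
  assumes "p \<in> {1..n}" "q \<in> {1..n}" "k \<in> {1..n}" "l \<in> {1..n}"
    and "\<gamma> (dt p q) \<noteq> 0" "\<gamma> (dt p k) = 0" "\<gamma> (dt p l) = 0"
  shows "\<gamma> (dt k l) = 0"
proof -
  note R = dt_chart_ring [OF assms(1,2)] dt_chart_ring [OF assms(3,4)] dt_chart_ring [OF assms(1,3)]
    dt_chart_ring [OF assms(2,4)] dt_chart_ring [OF assms(1,4)] dt_chart_ring [OF assms(2,3)]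
  have "\<gamma> (dt p q) * \<gamma> (dt k l) = \<gamma> (dt p k * dt q l + - (dt p l * dt q k))"
    unfolding seminorm(2) [OF R(1,2), symmetric] det2_pluecker [of _ _ p q k l] by simp
  also have "\<dots> \<le> max (\<gamma> (dt p k * dt q l)) (\<gamma> (- (dt p l * dt q k)))"
    by (intro seminorm(3) chart_ring_mult chart_ring_uminus R)
  also have "\<dots> = max (\<gamma> (dt p k) * \<gamma> (dt q l)) (\<gamma> (dt p l) * \<gamma> (dt q k))"
    unfolding seminorm_uminus [OF chart_ring_mult [OF R(5,6)]] seminorm(2) [OF R(3,4)] seminorm(2) [OF R(5,6)] ..
  finally have "\<gamma> (dt p q) * \<gamma> (dt k l) \<le> 0" using assms(6,7) by simp
  moreover have "0 < \<gamma> (dt p q)" "0 \<le> \<gamma> (dt k l)"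
    using seminorm(1) [OF R(1,1)] seminorm(1) [OF R(2,2)] assms(5) by auto
  ultimately show ?thesis by (simp add: mult_le_0_iff)
qed

lemma dt_swap: "\<gamma> (dt k l) = \<gamma> (dt l k)" if "k \<in> {1..n}" "l \<in> {1..n}"
proof -
  have "dt l k = - (dt k l :: 'k upoly)" by (simp add: det2_def)
  then show ?thesis using seminorm_uminus [OF dt_chart_ring [OF that]] by simp
qed

lemma dt_self: "\<gamma> (dt k k) = 0"
  using seminorm(4) [of 0 0 0] by (simp add: det2_def chart_ring_def const_simps)

text \<open>Zero columns for loops and pairwise independent columns \<open>(1, \<iota> m)\<close> for the parallel classes realize
  the vanishing pattern of a seminorm by a point over the base field.\<close>

lemma realize_vanishing:
  assumes \<iota>: "inj (\<iota> :: nat \<Rightarrow> 'k)"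
  shows "\<exists>a b :: nat \<Rightarrow> 'k. \<forall>k\<in>{1..n}. \<forall>l\<in>{1..n}. det2 a b k l = 0 \<longleftrightarrow> \<gamma> (dt k l) = 0"
proof -
  \<comment> \<open>Nonloops; \<open>rep\<close> below picks the least member of a parallel class,
    so that each class receives one value of \<iota>.\<close>
  define nl where "nl k \<longleftrightarrow> (\<exists>q\<in>{1..n}. \<gamma> (dt k q) \<noteq> 0)" for k
  define rep where "rep k = (LEAST l. l \<in> {1..n} \<and> nl l \<and> \<gamma> (dt k l) = 0)" for k
  define a where "a k = (if nl k then 1 else 0 :: 'k)" for k
  define b where "b k = (if nl k then \<iota> (rep k) else 0)" for k
  have rep: "rep k \<in> {1..n} \<and> nl (rep k) \<and> \<gamma> (dt k (rep k)) = 0" if "k \<in> {1..n}" "nl k" for k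
    unfolding rep_def by (rule LeastI [of _ k]) (use that dt_self in auto)
  have trans: "\<gamma> (dt k l) = 0" if "p \<in> {1..n}" "k \<in> {1..n}" "l \<in> {1..n}" "nl p" "\<gamma> (dt p k) = 0" "\<gamma> (dt p l) = 0"
    for p k l using that parallel_trans [of p _ k l] unfolding nl_def by blast
  have "det2 a b k l = 0 \<longleftrightarrow> \<gamma> (dt k l) = 0" if k: "k \<in> {1..n}" and l: "l \<in> {1..n}" for k l
  proof (cases "nl k \<and> nl l")
    case True
    then have nl: "nl k" "nl l" by auto
    have "rep k = rep l \<longleftrightarrow> \<gamma> (dt k l) = 0"
    proof
      assume eq: "rep k = rep l"
      have r: "rep k \<in> {1..n}" "nl (rep k)" "\<gamma> (dt k (rep k)) = 0" "\<gamma> (dt l (rep k)) = 0"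
        using rep [OF k nl(1)] rep [OF l nl(2)] eq by auto
      show "\<gamma> (dt k l) = 0"
        using trans [OF r(1) k l r(2)] r(3,4) dt_swap [OF k r(1)] dt_swap [OF l r(1)] by simp
    next
      assume kl: "\<gamma> (dt k l) = 0"
      have "\<gamma> (dt k m) = 0 \<longleftrightarrow> \<gamma> (dt l m) = 0" if m: "m \<in> {1..n}" for m
        using trans [OF k l m nl(1) kl] trans [OF l k m nl(2)] kl dt_swap [OF k l] by auto
      then have "(\<lambda>m. m \<in> {1..n} \<and> nl m \<and> \<gamma> (dt k m) = 0) = (\<lambda>m. m \<in> {1..n} \<and> nl m \<and> \<gamma> (dt l m) = 0)"
        by blast
      then show "rep k = rep l" unfolding rep_def by simp
    qed
    moreover have "det2 a b k l = \<iota> (rep l) - \<iota> (rep k)" using nl by (simp add: det2_def a_def b_def)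
    ultimately show ?thesis using inj_eq [OF \<iota>] by auto
  next
    case False
    then have "det2 a b k l = 0" by (auto simp: det2_def a_def b_def)
    moreover have "\<gamma> (dt k l) = 0" using False k l dt_swap [OF k l] unfolding nl_def by auto
    ultimately show ?thesis by simp
  qed
  then show ?thesis by blast
qed

end

text \<open>Dividing all minors by the one at ij normalizes that coordinate to 1; the relation of i,
  j, k, l then shows that the chart coordinates of the point are these quotients up to sign.\<close>

lemma point_of_columns:
  fixes a b :: "nat \<Rightarrow> 'k::field"
  assumes ij: "i \<in> {1..n}" "j \<in> {1..n}" "i \<noteq> j" and nz: "det2 a b i j \<noteq> 0"
  shows "\<exists>pt :: 'k upoly \<Rightarrow> 'k. upoly_hom pt \<and> (\<forall>k\<in>{1..n}. \<forall>l\<in>{1..n}. k \<noteq> l \<longrightarrow>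
    (pt (chart_coord i j (Upair k l)) = 0 \<longleftrightarrow> det2 a b k l = 0))"
proof -
  define \<delta> where "\<delta> = det2 a b i j"
  define v where "v e = det2 a b (Min (set_uprod e)) (Max (set_uprod e)) / \<delta>" for e
  define pt where "pt = poly_subst id v"
  have hom: "upoly_hom pt" unfolding pt_def by (rule upoly_hom_poly_subst) auto
  interpret upoly_hom pt by (rule hom)
  have uv: "pt (uvar e) = v e" for e unfolding pt_def by (rule poly_subst_uvar) auto
  have v: "v (Upair k l) = pair_sign k l * det2 a b k l / \<delta>" if "k \<noteq> l" for k l
    using that by (auto simp: v_def det2_def pair_sign_def min_def max_def)
  have ov: "pt (oriented_var k l) = det2 a b k l / \<delta>" if "k \<noteq> l" for k l
    unfolding oriented_var_eq hom_mult uv v [OF that] hom_pair_sign [unfolded const_pair_sign] by simp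
  have A: "pt (col_A i j k) = det2 a b k j / \<delta>" and B: "pt (col_B i j k) = det2 a b i k / \<delta>" for k
  proof -
    have sw: "det2 a b k j = - det2 a b j k" "det2 a b j i = - det2 a b i j" by (simp_all add: det2_def)
    have "det2 a b j j = 0" "det2 a b i i = 0" by (simp_all add: det2_def)
    then show "pt (col_A i j k) = det2 a b k j / \<delta>" "pt (col_B i j k) = det2 a b i k / \<delta>"
      using nz ij(3) unfolding col_A_def col_B_def
      by (auto simp: hom_1 hom_0 hom_uminus ov \<delta>_def sw)
  qed
  have "pt (chart_coord i j (Upair k l)) = 0 \<longleftrightarrow> det2 a b k l = 0" if kl: "k \<noteq> l" for k l
  proof -
    have "pt (chart_coord i j (Upair k l)) = pair_sign k l *
      ((det2 a b k j * det2 a b i l - det2 a b l j * det2 a b i k) / (\<delta> * \<delta>))"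
      unfolding chart_coord_minor [OF ij(3) kl] hom_mult hom_diff A B hom_pair_sign [unfolded const_pair_sign]
      by (simp add: diff_divide_distrib)
    also have "det2 a b k j * det2 a b i l - det2 a b l j * det2 a b i k = \<delta> * det2 a b k l"
      by (simp add: \<delta>_def det2_def algebra_simps)
    finally show ?thesis using nz by (simp add: \<delta>_def pair_sign_def)
  qed
  then show ?thesis using hom by blast
qed

lemma elog_eq_iff: "elog r = - \<infinity> \<longleftrightarrow> r = 0" "elog r \<noteq> \<infinity>"
  by (simp_all add: elog_def)

text \<open>The seminorm giving \<open>x\<close> may live in another chart i'j'. Columns over K with
  the same vanishing minors forget that chart and can be renormalized at ij because ij is outside
  \<open>J\<close>.\<close>

lemma stratum_point:
  fixes x :: "nat uprod \<Rightarrow> ereal"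
  assumes v: "val ` (UNIV - {0 :: 'k::valued_field}) = UNIV"
    and ij: "i \<in> {1..n}" "j \<in> {1..n}" "i \<noteq> j"
    and x: "x \<in> tp_vecs n" "tp_class n x \<in> trop_grass TYPE('k) n"
    and J: "J = vanishing_set n x" "Upair i j \<notin> J"
  shows "\<exists>pt :: 'k upoly \<Rightarrow> 'k. upoly_hom pt \<and> (\<forall>e\<in>pairs n. pt (chart_coord i j e) = 0 \<longleftrightarrow> e \<in> J)"
proof -
  obtain i' j' and \<gamma> :: "'k upoly \<Rightarrow> real" where ij': "i' \<in> {1..n}" "j' \<in> {1..n}" "i' \<noteq> j'"
    and \<gamma>: "\<gamma> \<in> berkovich_chart n i' j'" and cl: "tp_class n x = trop_chart n i' j' \<gamma>"
    using x(2) unfolding trop_grass_def by blast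
  have "x \<in> trop_chart n i' j' \<gamma>" using tp_class_self [OF x(1)] cl by simp
  then obtain c where c: "\<forall>e\<in>pairs n. x e = (\<lambda>e\<in>pairs n. elog (\<gamma> (chart_coord i' j' e))) e + ereal c"
    unfolding trop_chart_def tp_class_def tp_rel_def by auto
  have J_iff: "e \<in> J \<longleftrightarrow> \<gamma> (chart_coord i' j' e) = 0" if "e \<in> pairs n" for e
  proof -
    have "x e = elog (\<gamma> (chart_coord i' j' e)) + ereal c" using c that by simp
    moreover have "u + ereal c = - \<infinity> \<longleftrightarrow> u = - \<infinity>" for u :: ereal by (cases u) auto
    ultimately have "x e = - \<infinity> \<longleftrightarrow> \<gamma> (chart_coord i' j' e) = 0" by (simp add: elog_eq_iff)
    then show ?thesis using that unfolding J(1) vanishing_set_def by simp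
  qed
  obtain \<iota> :: "nat \<Rightarrow> 'k" where \<iota>: "inj \<iota>" using infinite_valued_field [OF v] by blast
  obtain a b :: "nat \<Rightarrow> 'k" where ab: "\<And>k l. k \<in> {1..n} \<Longrightarrow> l \<in> {1..n} \<Longrightarrow>
      det2 a b k l = 0 \<longleftrightarrow> \<gamma> (det2 (col_A i' j') (col_B i' j') k l) = 0"
    using realize_vanishing [OF \<gamma> ij' \<iota>] by blast
  have ab_J: "det2 a b k l = 0 \<longleftrightarrow> Upair k l \<in> J" if "k \<in> {1..n}" "l \<in> {1..n}" "k \<noteq> l" for k l
    using J_iff [of "Upair k l"] ab [OF that(1,2)] seminorm_chart_coord [OF \<gamma> ij' that] that by simp
  have "det2 a b i j \<noteq> 0" using ab_J [OF ij] J(2) by simp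
  from point_of_columns [OF ij this] obtain pt :: "'k upoly \<Rightarrow> 'k" where pt: "upoly_hom pt"
    "\<forall>k\<in>{1..n}. \<forall>l\<in>{1..n}. k \<noteq> l \<longrightarrow> (pt (chart_coord i j (Upair k l)) = 0 \<longleftrightarrow> det2 a b k l = 0)" by blast
  have "pt (chart_coord i j e) = 0 \<longleftrightarrow> e \<in> J" if e: "e \<in> pairs n" for e
  proof -
    obtain k l where kl: "e = Upair k l" "k \<in> {1..n}" "l \<in> {1..n}" "k \<noteq> l" using e by (rule pairsE)
    then show ?thesis using pt(2) ab_J [OF kl(2-4)] by simp
  qed
  then show ?thesis using pt(1) by blast
qed

section \<open>Compatible index sets\<close>

definition nondegenerate :: "nat \<Rightarrow> nat \<Rightarrow> nat uprod set \<Rightarrow> nat \<Rightarrow> bool" where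
  "nondegenerate i j J k \<longleftrightarrow> Upair i k \<notin> J \<and> Upair j k \<notin> J"

text \<open>The element t of conditions (ii) and (iii) at once, symmetric in \<open>i\<close> and
  \<open>j\<close>. It may be compared with all leaves below \<open>k\<close>, since these lie in
  the branch of \<open>k\<close>.\<close>

definition is_chain_pred :: "nat \<Rightarrow> nat \<Rightarrow> (nat \<times> nat) set \<Rightarrow> nat uprod set \<Rightarrow> nat uprod set \<Rightarrow> nat \<Rightarrow> nat \<Rightarrow> bool" where
  "is_chain_pred i j r J I k t \<longleftrightarrow> strictly_below r t k \<and> nondegenerate i j J t \<and> Upair k t \<in> I \<and>
     (\<forall>s. strictly_below r s k \<and> nondegenerate i j J s \<longrightarrow> (s, t) \<in> r)"

definition chain_pred :: "nat \<Rightarrow> nat \<Rightarrow> (nat \<times> nat) set \<Rightarrow> nat uprod set \<Rightarrow> nat uprod set \<Rightarrow> nat \<Rightarrow> nat" where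
  "chain_pred i j r J I k = (SOME t. is_chain_pred i j r J I k t)"

definition chain_rank :: "(nat \<times> nat) set \<Rightarrow> nat \<Rightarrow> nat" where
  "chain_rank r k = card {s. strictly_below r s k}"

lemma chain_rank_less:
  assumes r: "partial_order_on A r" "finite A" and st: "strictly_below r s t"
  shows "chain_rank r s < chain_rank r t"
  unfolding chain_rank_def
proof (rule psubset_card_mono)
  have "{s. strictly_below r s t} \<subseteq> A" using partial_order_onD(4) [OF r(1)] by auto
  then show "finite {s. strictly_below r s t}" using r(2) by (rule finite_subset)
  have "strictly_below r u t" if "strictly_below r u s" for u
    using that st partial_order_onD(2,3) [OF r(1)] by (auto dest: transD antisymD)
  then show "{u. strictly_below r u s} \<subset> {u. strictly_below r u t}" using st by blast
qed

locale compatible_tree = ordered_tree n i j T r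
  for n i j :: nat and T :: "'v ltree" and r :: "(nat \<times> nat) set" +
  fixes J I :: "nat uprod set"
  assumes compat: "compatible n T i j r (J \<inter> chart_pairs n i j) I"
begin

abbreviation "Jc \<equiv> J \<inter> chart_pairs n i j"

lemma in_Jc: "a \<in> {i, j} \<Longrightarrow> k \<in> {1..n} - {i, j} \<Longrightarrow> Upair a k \<in> Jc \<longleftrightarrow> Upair a k \<in> J"
  using ij by (auto simp: chart_pairs_def)

text \<open>The membership of ik and jk in \<open>I\<close> decides the condition: (ii) keeps ik out
  of \<open>I\<close> but puts jk in, because \<open>k\<close> belongs to its own branch, (iii) does
  the opposite, and (i) requires both.\<close>

lemma compat_cases:
  assumes k: "k \<in> {1..n} - {i, j}"
  defines "B \<equiv> branch n T i j (branch_vertex n T i j k)"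
  shows "Upair i k \<in> I \<Longrightarrow> Upair j k \<in> I \<Longrightarrow> compat_both r Jc I i j k"
    and "Upair i k \<notin> I \<Longrightarrow> compat_one r Jc I B i j k"
    and "Upair j k \<notin> I \<Longrightarrow> compat_one r Jc I B j i k"
proof -
  have kB: "k \<in> B" unfolding B_def using branch_vertex(2) [OF T ij k] .
  have "branch_vertex n T i j k \<in> path_internal T i j" using branch_vertex(1) [OF T ij k] .
  then have c: "compat_both r Jc I i j k \<or> compat_one r Jc I B i j k \<or> compat_one r Jc I B j i k"
    using compat kB unfolding compatible_def Let_def B_def by blast
  show "compat_both r Jc I i j k" if "Upair i k \<in> I" "Upair j k \<in> I"
    using c that unfolding compat_one_def by blast
  show "compat_one r Jc I B i j k" if "Upair i k \<notin> I"
    using c that kB unfolding compat_one_def compat_both_def by blast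
  show "compat_one r Jc I B j i k" if "Upair j k \<notin> I"
    using c that kB unfolding compat_one_def compat_both_def by blast
qed

lemma compat_one_pred:
  assumes k: "k \<in> {1..n} - {i, j}" and ab: "{a, b} = {i, j}" "Upair a k \<notin> I"
  shows "is_chain_pred i j r J I k (chain_pred i j r J I k)"
    and "\<And>l. l \<in> {1..n} - {i, j} \<Longrightarrow> branch_vertex n T i j l = branch_vertex n T i j k \<Longrightarrow> Upair b l \<in> I"
proof -
  let ?B = "branch n T i j (branch_vertex n T i j k)"
  have abij: "a = i \<and> b = j \<or> a = j \<and> b = i" using ab(1) by (auto simp: doubleton_eq_iff)
  have c: "compat_one r Jc I ?B a b k" using compat_cases(2,3) [OF k] abij ab(2) by blast
  obtain t where t: "t \<in> ?B" "strictly_below r t k" "Upair a t \<notin> Jc" "Upair b t \<notin> Jc" "Upair k t \<in> I"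
    "\<forall>s\<in>?B. strictly_below r s k \<and> Upair a s \<notin> Jc \<and> Upair b s \<notin> Jc \<longrightarrow> (s, t) \<in> r"
    using c unfolding compat_one_def by blast
  have BL: "l \<in> {1..n} - {i, j}" if "l \<in> ?B" for l using that by (auto simp: branch_def)
  have nd: "nondegenerate i j J l \<longleftrightarrow> Upair a l \<notin> Jc \<and> Upair b l \<notin> Jc" if "l \<in> {1..n} - {i, j}" for l
    using in_Jc [OF _ that, of i] in_Jc [OF _ that, of j] abij unfolding nondegenerate_def by blast
  have "(s, t) \<in> r" if s: "strictly_below r s k" "nondegenerate i j J s" for s
  proof -
    have sL: "s \<in> {1..n} - {i, j}" using s(1) partial_order_onD(4) [OF r] by auto
    have "branch_vertex n T i j s = branch_vertex n T i j k"
      using below_same_branch s(1) by blast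
    then have "s \<in> ?B" using branch_vertex(2) [OF T ij sL] by simp
    then show ?thesis using t(6) s nd [OF sL] by blast
  qed
  then have "is_chain_pred i j r J I k t"
    using t(2,5) nd [OF BL [OF t(1)]] t(3,4) unfolding is_chain_pred_def by blast
  then show "is_chain_pred i j r J I k (chain_pred i j r J I k)"
    unfolding chain_pred_def by (rule someI)
  fix l assume l: "l \<in> {1..n} - {i, j}" "branch_vertex n T i j l = branch_vertex n T i j k"
  then have "l \<in> ?B" using branch_vertex(2) [OF T ij l(1)] by simp
  then show "Upair b l \<in> I" using c unfolding compat_one_def by blast
qed

lemma basis_pred:
  assumes k: "k \<in> {1..n} - {i, j}" and ab: "{a, b} = {i, j}" "Upair a k \<notin> I"
  defines "t \<equiv> chain_pred i j r J I k"
  shows "t \<in> {1..n} - {i, j} \<and> chain_rank r t < chain_rank r k \<and> Upair b k \<in> I \<and> Upair b t \<in> I \<and>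
    Upair b t \<notin> J \<and> Upair k t \<in> I"
proof -
  note t = compat_one_pred(1) [OF k ab, folded t_def, unfolded is_chain_pred_def]
  have tL: "t \<in> {1..n} - {i, j}" using t partial_order_onD(4) [OF r] by auto
  have "branch_vertex n T i j t = branch_vertex n T i j k"
    using below_same_branch t by blast
  then have "Upair b t \<in> I" "Upair b k \<in> I" using compat_one_pred(2) [OF k ab] tL k by blast+
  moreover have "Upair b t \<notin> J" using t ab(1) unfolding nondegenerate_def by (auto simp: doubleton_eq_iff)
  moreover have "chain_rank r t < chain_rank r k" using chain_rank_less [OF r _, of t k] t by simp
  ultimately show ?thesis using t tL by blast
qed

text \<open>The pairs forced into \<open>I\<close> are \<open>2 (n - 2)\<close> in number, so there are no others.\<close>

lemma basis_cases:
  assumes e: "e \<in> I"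
  shows "e \<in> chart_pairs n i j \<or> (\<exists>k a b. k \<in> {1..n} - {i, j} \<and> {a, b} = {i, j} \<and> Upair a k \<notin> I \<and>
    e = Upair k (chain_pred i j r J I k))"
proof -
  let ?L = "{1..n} - {i, j}" and ?p = "chain_pred i j r J I"
  \<comment> \<open>Two injections of the leaves other than \<open>i\<close>, \<open>j\<close> into
    \<open>I\<close> with disjoint images; the forced pairs they produce already number 2(n -
    2).\<close>
  define g where "g k = (if Upair j k \<in> I then Upair j k else Upair i k)" for k
  define h where "h k = (if Upair i k \<in> I \<and> Upair j k \<in> I then Upair i k else Upair k (?p k))" for k
  have ab: "{i, j} = {i, j}" "{j, i} = {i, j}" by auto
  have p: "?p k \<in> ?L \<and> chain_rank r (?p k) < chain_rank r k \<and> Upair k (?p k) \<in> I"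
    if "k \<in> ?L" "\<not> (Upair i k \<in> I \<and> Upair j k \<in> I)" for k
    using basis_pred [OF that(1) ab(1)] basis_pred [OF that(1) ab(2)] that(2) by blast
  have gI: "g k \<in> I" if "k \<in> ?L" for k
    using basis_pred [OF that ab(2)] by (auto simp: g_def)
  have hI: "h k \<in> I" if "k \<in> ?L" for k using p [OF that] by (auto simp: h_def)
  have inj_g: "inj_on g ?L" by (rule inj_onI) (auto simp: g_def split: if_splits)
  have inj_h: "inj_on h ?L"
  proof (rule inj_onI)
    fix k l assume kl: "k \<in> ?L" "l \<in> ?L" "h k = h l"
    show "k = l"
    proof (rule ccontr)
      assume "k \<noteq> l"
      then have n: "\<not> (Upair i k \<in> I \<and> Upair j k \<in> I)" "\<not> (Upair i l \<in> I \<and> Upair j l \<in> I)"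
        using kl p [OF kl(1)] p [OF kl(2)] by (auto simp: h_def split: if_splits)
      have "Upair k (?p k) = Upair l (?p l)" using kl(3) unfolding h_def if_not_P [OF n(1)] if_not_P [OF n(2)] .
      \<comment> \<open>Different leaves with the same pair would be predecessors of each other,
        while the rank strictly decreases.\<close>
      then have "k = ?p l" "l = ?p k" using \<open>k \<noteq> l\<close> by auto
      then show False using p [OF kl(1) n(1)] p [OF kl(2) n(2)] by simp
    qed
  qed
  have disj: "g ` ?L \<inter> h ` ?L = {}"
  proof -
    have "g k \<noteq> h l" if "k \<in> ?L" "l \<in> ?L" for k l
      using that p [OF that(2)] ij(2) by (auto simp: g_def h_def split: if_splits)
    then show ?thesis by blast
  qed
  have fin: "finite I" using compat finite_pairs finite_subset unfolding compatible_def by blast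
  have "card (g ` ?L \<union> h ` ?L) = card ?L + card ?L"
    using disj inj_g inj_h by (simp add: card_Un_disjoint card_image)
  also have "\<dots> = 2 * (n - 2)" using ij by (simp add: card_Diff_subset)
  also have "\<dots> = card I" using compat unfolding compatible_def by simp
  finally have "card (g ` ?L \<union> h ` ?L) = card I" .
  moreover have "g ` ?L \<union> h ` ?L \<subseteq> I" using gI hI by blast
  ultimately have "g ` ?L \<union> h ` ?L = I" using card_subset_eq [OF fin] by blast
  then consider k where "k \<in> ?L" "e = g k" | k where "k \<in> ?L" "e = h k" using e by blast
  then show ?thesis
  proof cases
    case 1
    then show ?thesis using ij by (auto simp: g_def chart_pairs_def)
  next
    case 2
    show ?thesis
    proof (cases "Upair i k \<in> I \<and> Upair j k \<in> I")
      case True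
      then show ?thesis using 2 ij by (auto simp: h_def chart_pairs_def)
    next
      case False
      have "e = Upair k (?p k)" using 2(2) unfolding h_def if_not_P [OF False] .
      then show ?thesis using False 2(1) ab by blast
    qed
  qed
qed

end

section \<open>Assembling the theorem\<close>

lemma init_form_cong:
  assumes "f \<in> laurent_ring S" "\<And>e. e \<in> S \<Longrightarrow> \<tau> e = \<tau>' e"
  shows "init_form \<tau> c f = init_form \<tau>' c f"
  unfolding init_form_def
proof (rule sum.cong)
  fix \<alpha> assume "\<alpha> \<in> Poly_Mapping.keys f"
  then have "Poly_Mapping.keys \<alpha> \<subseteq> S" using assms(1) by (simp add: laurent_ring_def localized_ring_def)
  then have "(\<Prod>e\<in>Poly_Mapping.keys \<alpha>. \<tau> e powi Poly_Mapping.lookup \<alpha> e) =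
    (\<Prod>e\<in>Poly_Mapping.keys \<alpha>. \<tau>' e powi Poly_Mapping.lookup \<alpha> e)"
    using assms(2) by (intro prod.cong) auto
  then show "Poly_Mapping.single \<alpha> (residue_class (c * Poly_Mapping.lookup f \<alpha> *
      (\<Prod>e\<in>Poly_Mapping.keys \<alpha>. \<tau> e powi Poly_Mapping.lookup \<alpha> e))) =
    Poly_Mapping.single \<alpha> (residue_class (c * Poly_Mapping.lookup f \<alpha> *
      (\<Prod>e\<in>Poly_Mapping.keys \<alpha>. \<tau>' e powi Poly_Mapping.lookup \<alpha> e)))" by simp
qed simp

lemma init_ideal_cong:
  assumes "M \<subseteq> laurent_ring S" "\<And>e. e \<in> S \<Longrightarrow> \<tau> e = \<tau>' e"
  shows "init_ideal S y \<tau> M = init_ideal S y \<tau>' M"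
proof -
  have "init_form \<tau> c f = init_form \<tau>' c f" if "f \<in> M" for c f
    using init_form_cong assms that by blast
  then have "{init_form \<tau> c f | c f. f \<in> M \<and> f \<noteq> 0 \<and> c \<noteq> 0 \<and> val c = trop_max y f} =
    {init_form \<tau>' c f | c f. f \<in> M \<and> f \<noteq> 0 \<and> c \<noteq> 0 \<and> val c = trop_max y f}" by metis
  then show ?thesis unfolding init_ideal_def by simp
qed

theorem lemma6p2:
  fixes n i j :: nat
    and x :: "nat uprod \<Rightarrow> ereal"
    and y :: "nat uprod \<Rightarrow> real"
    and \<tau> :: "nat uprod \<Rightarrow> 'k::{valued_field, alg_closed_field}"
    and J I :: "nat uprod set"
    and T :: "'v ltree"
    and r :: "(nat \<times> nat) set"
  assumes "complete_valued TYPE('k)"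
    and "val ` (UNIV - {0 :: 'k}) = UNIV"
    and "i \<in> {1..n}" and "j \<in> {1..n}" and "i \<noteq> j"
    and "x \<in> tp_vecs n" and "tp_class n x \<in> trop_grass TYPE('k) n"
    and "J = vanishing_set n x" and "Upair i j \<notin> J"
    and "\<And>e. e \<in> torus_pairs n i j J \<Longrightarrow> ereal (y e) = x e - x (Upair i j)"
    and "\<And>e. e \<in> torus_pairs n i j J \<Longrightarrow> \<tau> e \<noteq> 0 \<and> ln (absv (\<tau> e)) = y e"
    and "labeled_tree n T" and "tp_class n x \<in> tp_topology n closure_of tree_cone n T"
    and "partial_order_on ({1..n} - {i, j}) r" and "cherry_property n T i j r"
    and "compatible n T i j r (J \<inter> chart_pairs n i j) I"
  shows "init_ideal (torus_pairs n i j J) y \<tau> (grass_ideal n i j J) =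
    ideal_gen (laurent_ring (torus_pairs n i j J))
      {lvar e - init_form \<tau> (inverse (\<tau> e)) (f_coord n i j J I e) | e.
        e \<in> pairs n - (I \<union> J \<union> {Upair i j})}"
proof -
  let ?L = "{1..n} - {i, j}" and ?S = "torus_pairs n i j J"
  note ij = assms(3-5) and x = assms(6) and J = assms(8,9) and T = assms(12) and cl = assms(13)
    and r = assms(14) and ch = assms(15) and compat = assms(16)
  have ij2: "{i, j} \<subseteq> {1..n}" using ij by blast
  have Jp: "J \<subseteq> pairs n" unfolding J(1) vanishing_set_def by blast
  have Ip: "I \<subseteq> pairs n" "Upair i j \<notin> I" using compat unfolding compatible_def by blast+
  \<comment> \<open>The value 1 off the torus makes \<tau>' nonzero everywhere; the initial forms
    involve torus coordinates only and do not change.\<close>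
  define \<tau>' where "\<tau>' e = (if e \<in> ?S then \<tau> e else 1)" for e
  define X where "X k l = eexp (x (Upair k l)) / eexp (x (Upair i j))" for k l
  let ?p = "chain_pred i j r J I" and ?rk = "chain_rank r" and ?\<beta> = "branch_vertex n T i j"
  interpret C: compatible_tree n i j T r J I
    using T ij2 ij(3) r ch compat by unfold_locales
  interpret T: tropical_tree n i j T r x
    using x cl by unfold_locales
  note bp = C.basis_pred and bc = C.basis_cases and cp = C.compat_one_pred(1)
  have eij: "eexp (x (Upair i j)) > 0"
    using J ij eexp_nonneg [of "x (Upair i j)"] by (simp add: vanishing_set_def less_le eexp_eq_0_iff)
  then have xij: "x (Upair i j) \<noteq> - \<infinity>" by auto
  have X0: "X k l = 0 \<longleftrightarrow> Upair k l \<in> J" if "k \<in> {1..n}" "l \<in> {1..n}" "k \<noteq> l" for k l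
    using that xij unfolding X_def J(1) vanishing_set_def by (simp add: eexp_eq_0_iff)
  have X\<tau>: "X k l = absv (\<tau> (Upair k l))" if "Upair k l \<in> ?S" for k l
  proof -
    have e: "Upair k l \<in> pairs n" "Upair k l \<notin> J" using that by (simp_all add: torus_pairs_def)
    obtain u where u: "x (Upair k l) = ereal u"
      using tp_vecs_less [OF x e(1)] e unfolding J(1) vanishing_set_def by (cases "x (Upair k l)") auto
    obtain w where w: "x (Upair i j) = ereal w"
      using tp_vecs_less [OF x, of "Upair i j"] ij J unfolding J(1) vanishing_set_def
      by (cases "x (Upair i j)") auto
    have "y (Upair k l) = u - w" using assms(10) [OF that] u w by simp
    moreover have "absv (\<tau> (Upair k l)) > 0"
      using assms(11) [OF that] absv_nonneg by (simp add: less_le)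
    ultimately have "absv (\<tau> (Upair k l)) = exp (u - w)"
      using assms(11) [OF that] by (metis exp_ln)
    then show ?thesis by (simp add: X_def u w exp_diff)
  qed
  obtain pt :: "'k upoly \<Rightarrow> 'k" where pt: "upoly_hom pt"
    "\<forall>e\<in>pairs n. pt (chart_coord i j e) = 0 \<longleftrightarrow> e \<in> J"
    using stratum_point [OF assms(2) ij x assms(7) J] by blast
  have basis: "pluecker_basis n i j J I ?p ?rk"
    by unfold_locales (use ij Jp J(2) Ip bp bc in \<open>blast+\<close>)
  interpret P: pluecker_stratum n i j J I ?p ?rk "TYPE('k)" pt
    unfolding pluecker_stratum_def pluecker_field_def pluecker_stratum_axioms_def
    using basis pt by blast
  have below_L: "k \<in> ?L" "l \<in> ?L" "?\<beta> k = ?\<beta> l" if "strictly_below r k l" for k l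
    using that partial_order_onD(4) [OF r] C.below_same_branch by auto
  have nd: "X i k \<noteq> 0 \<and> X j k \<noteq> 0 \<longleftrightarrow> nondegenerate i j J k" if "k \<in> ?L" for k
    using that ij X0 [of i k] X0 [of j k] by (auto simp: nondegenerate_def)
  have ab: "\<exists>b. {a, b} = {i, j}" if "a \<in> {i, j}" for a using that by blast
  have pred: "is_chain_pred i j r J I k (?p k)" if "k \<in> ?L" "a \<in> {i, j}" "Upair a k \<notin> I" for k a
    using cp [OF that(1)] ab [OF that(2)] that(3) by blast
  interpret B: tropical_basis n i j J I ?p ?rk "TYPE('k)" \<tau>' X "\<lambda>k l. strictly_below r k l" ?\<beta>
  proof unfold_locales
    show "\<tau>' e \<noteq> 0" for e using assms(11) by (simp add: \<tau>'_def)
    show "X k l = X l k" for k l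
    proof -
      have "Upair k l = Upair l k" by simp
      then show ?thesis unfolding X_def by (simp only:)
    qed
    show "X i j = 1" using eij by (simp add: X_def)
    show "X k l = 0" if "k \<in> {1..n}" "l \<in> {1..n}" "k \<noteq> l" "Upair k l \<in> J" for k l
      using X0 that by blast
    show "X k l = absv (\<tau>' (Upair k l))"
      if "k \<in> {1..n}" "l \<in> {1..n}" "k \<noteq> l" "Upair k l \<notin> J" "Upair k l \<noteq> Upair i j" for k l
    proof -
      have "Upair k l \<in> pairs n" using that(1-3) by simp
      then have S: "Upair k l \<in> ?S" using that(4,5) unfolding torus_pairs_def by blast
      then show ?thesis using X\<tau> [OF S] by (simp add: \<tau>'_def)
    qed
    show "X i k * X j l \<le> X k l" if "k \<in> ?L" "l \<in> ?L" "?\<beta> k \<noteq> ?\<beta> l" for k l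
      using T.different_branches [OF that] eij by (simp add: X_def field_simps)
    show "X k l \<le> X i k * X j l \<and> X i k * X j l = X i l * X j k"
      if "k \<in> ?L" "l \<in> ?L" "?\<beta> k = ?\<beta> l" "k \<noteq> l" for k l
      using T.same_branch [OF that] eij by (simp add: X_def field_simps)
    show "X i k * X l m \<le> X k m * X i l \<and> X i m * X k l \<le> X k m * X i l"
      if "strictly_below r k l" "strictly_below r l m" for k l m
      using T.order_chain [OF that] eij by (simp add: X_def field_simps)
    show "k \<in> ?L \<and> l \<in> ?L \<and> k \<noteq> l \<and> ?\<beta> k = ?\<beta> l" if "strictly_below r k l" for k l
      using below_L [OF that] that by blast
    show "strictly_below r k l \<or> strictly_below r l k"
      if "k \<in> ?L" "l \<in> ?L" "?\<beta> k = ?\<beta> l" "k \<noteq> l" for k l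
      using C.total_on_branch [OF that] that by blast
    fix k a assume k: "k \<in> ?L" "a \<in> {i, j}" "Upair a k \<notin> I"
    note t = pred [OF k, unfolded is_chain_pred_def]
    show "strictly_below r (?p k) k" using t by blast
    show "X i (?p k) \<noteq> 0 \<and> X j (?p k) \<noteq> 0"
      using t nd below_L(1) by blast
    show "l = ?p k \<or> strictly_below r l (?p k)" if "strictly_below r l k" "X i l \<noteq> 0" "X j l \<noteq> 0" for l
      using t that nd [OF below_L(1) [OF that(1)]] by blast
  next
    fix k l assume k: "k \<in> ?L" "Upair i k \<in> I" "Upair j k \<in> I" and l: "strictly_below r l k"
    have "compat_both r (J \<inter> chart_pairs n i j) I i j k"
      using C.compat_cases(1) [OF k] .
    then have "\<not> nondegenerate i j J l" using l unfolding compat_both_def nondegenerate_def by blast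
    then show "X i l = 0 \<or> X j l = 0" using nd [OF below_L(1) [OF l]] by blast
  qed
  \<comment> \<open>The Gauss norm bound is 0 for a pair in \<open>J\<close>, and only 0 has norm at
    most 0.\<close>
  have Fm_J: "P.Fm k l = 0" if "k \<in> {1..n}" "l \<in> {1..n}" "k \<noteq> l" "Upair k l \<in> J" for k l
    using B.Fm_bounded [OF that(1-3)] X0 [OF that(1-3)] that(4) by (simp add: B.bounded_zero_iff)
  have Sd: "?S - (I - J) = pairs n - (I \<union> J \<union> {Upair i j})" unfolding torus_pairs_def by blast
  have "init_ideal ?S y \<tau>' (grass_ideal n i j J) = ideal_gen (laurent_ring ?S)
    {lvar e - init_form \<tau>' (inverse (\<tau>' e)) (f_coord n i j J I e) | e. e \<in> ?S - (I - J)}"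
  proof (rule B.init_ideal_eq [where N = P.stratum_ideal])
    show "I - J \<subseteq> ?S" using Ip unfolding torus_pairs_def by blast
    show "y e = ln (absv (\<tau>' e))" if "e \<in> ?S" for e using assms(11) [OF that] that by (simp add: \<tau>'_def)
    show "grass_ideal n i j J \<subseteq> P.stratum_ideal" by (rule P.grass_ideal_subset [OF Fm_J])
    show "P.stratum_ideal \<subseteq> laurent_ring ?S" unfolding P.stratum_ideal_def by blast
    show "g + h \<in> P.stratum_ideal" if "g \<in> P.stratum_ideal" "h \<in> P.stratum_ideal" for g h
      using P.stratum_ideal_add [OF Fm_J that] .
    show "g * h \<in> P.stratum_ideal" if "g \<in> laurent_ring ?S" "h \<in> P.stratum_ideal" for g h
      using P.stratum_ideal_mult [OF Fm_J that] .
    show "g = 0" if "g \<in> localized_ring (I - J) (I - J)" "g \<in> P.stratum_ideal" for g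
      using P.stratum_ideal_trivial [OF Fm_J that] .
    fix e assume e: "e \<in> ?S - (I - J)"
    then have "e \<in> pairs n" by (simp add: torus_pairs_def)
    then obtain k l where kl: "e = Upair k l" "k \<in> {1..n}" "l \<in> {1..n}" "k \<noteq> l" by (rule pairsE)
    have f: "(f_coord n i j J I e :: 'k ulaurent) = pair_sign k l * P.Fm k l" unfolding kl(1) by (rule P.f_coord_eq [OF kl(2-4)])
    show "(f_coord n i j J I e :: 'k ulaurent) \<in> localized_ring (I - J) (I - J)"
      unfolding f by (intro localized_ring_mult localized_ring_pair_sign P.Fm_localized kl)
    have "X k l = absv (\<tau>' e)" using X\<tau> [of k l] e kl(1) by (simp add: \<tau>'_def)
    then show "f_coord n i j J I e \<in> B.bounded_by (absv (\<tau>' e))"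
      unfolding f using B.bounded_mult [OF B.bounded_pair_sign B.Fm_bounded [OF kl(2-4)]]
      by (simp add: absv_nonneg)
    show "(lvar e - f_coord n i j J I e :: 'k ulaurent) \<in> grass_ideal n i j J"
    proof (rule P.relation_in_grass_ideal)
      show "e \<in> ?S" using e by blast
    qed (rule Fm_J)
  qed
  moreover have "init_ideal ?S y \<tau>' (grass_ideal n i j J) = init_ideal ?S y \<tau> (grass_ideal n i j J)"
    by (rule init_ideal_cong) (auto simp: grass_ideal_def \<tau>'_def)
  moreover have eq: "lvar e - init_form \<tau>' (inverse (\<tau>' e)) (f_coord n i j J I e) =
      lvar e - init_form \<tau> (inverse (\<tau> e)) (f_coord n i j J I e)" if e: "e \<in> ?S - (I - J)" for e
  proof -
    have "e \<in> pairs n" using e by (simp add: torus_pairs_def)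
    then obtain k l where kl: "e = Upair k l" "k \<in> {1..n}" "l \<in> {1..n}" "k \<noteq> l" by (rule pairsE)
    have "f_coord n i j J I e \<in> (localized_ring (I - J) (I - J) :: 'k ulaurent set)"
      unfolding kl(1) P.f_coord_eq [OF kl(2-4)]
      by (intro localized_ring_mult localized_ring_pair_sign P.Fm_localized kl)
    then have "f_coord n i j J I e \<in> (laurent_ring ?S :: 'k ulaurent set)"
      using laurent_ring_mono [of "I - J" ?S] Ip unfolding laurent_ring_def torus_pairs_def by blast
    then have "init_form \<tau>' c (f_coord n i j J I e) = init_form \<tau> c (f_coord n i j J I e)" for c
      by (rule init_form_cong) (simp add: \<tau>'_def)
    then show ?thesis using e by (simp add: \<tau>'_def)
  qed
  have "{lvar e - init_form \<tau>' (inverse (\<tau>' e)) (f_coord n i j J I e) | e. e \<in> ?S - (I - J)} =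
    {lvar e - init_form \<tau> (inverse (\<tau> e)) (f_coord n i j J I e) | e. e \<in> ?S - (I - J)}"
    unfolding setcompr_eq_image by (rule image_cong [OF refl eq]) simp
  ultimately show ?thesis unfolding Sd by simp
qed

end
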